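(* Let $|\gamma|<1$, assume $\mu$ is not normalized Lebesgue measure, let $f\in L^2(\mu)$, and let $(g_1,g_2)=\Phi_\gamma^*f$, $g_+:=g_1\in H^2$ (identified with its analytic extension to $\mathbb D$), $g_-:=\overline{\theta_\gamma}g_1+\Delta_\gamma g_2$. Then: (1) the non-tangential boundary values of $z\mapsto\frac{1-\overline\gamma}{(1-|\gamma|^2)^{1/2}}g_+(z)$, $z\in\mathbb D$, exist and equal $f_{\mathrm s}$ for $\mu_{\mathrm s}$-a.e. point of $\mathbb T$; (2) Lebesgue-a.e. on $\mathbb T$, $$(1-|\gamma|^2)^{1/2}\,w\,f_{\mathrm a}=\frac{1-\overline\gamma\theta_0}{1-\theta_0}\,g_++\frac{1-\gamma\overline{\theta_0}}{1-\overline{\theta_0}}\,g_-.$$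
   Context: $\mathbb T=\{|z|=1\}$ with normalized Lebesgue measure $m$. Let $\mu$ be a Borel probability measure on $\mathbb T$ with Lebesgue decomposition $\mu=\mu_{\mathrm a}+\mu_{\mathrm s}$, $\mu_{\mathrm a}=w\,m$; for $f\in L^2(\mu)$, $f_{\mathrm a}=d(f\mu)_{\mathrm a}/d\mu_{\mathrm a}$ and $f_{\mathrm s}=d(f\mu)_{\mathrm s}/d\mu_{\mathrm s}$. $U=M_\xi$ on $L^2(\mu)$, $b=\mathbf 1$, $b_1(\xi)=\overline\xi$, $U_\gamma=U+(\gamma-1)(\,\cdot\,,b_1)_{L^2(\mu)}b$. For $\lambda\in\mathbb D$, $R_2\mu(\lambda)=\int\frac{1+\overline\xi\lambda}{1-\overline\xi\lambda}d\mu(\xi)$, $\theta_\gamma=\frac{(1-\gamma)R_2\mu-(1+\gamma)}{(1-\overline\gamma)R_2\mu+(1+\overline\gamma)}$ (so $\theta_0=\frac{R_2\mu-1}{R_2\mu+1}$); boundary values on $\mathbb T$ have the same names; $\Delta_\gamma=(1-|\theta_\gamma|^2)^{1/2}$. Model space $\mathcal K_\theta=(H^2\oplus\operatorname{clos}\Delta L^2)\ominus\{(\theta h,\Delta h):h\in H^2\}$, model operator $\mathcal M_\theta=P_{\mathcal K_\theta}M_z|_{\mathcal K_\theta}$. Defect vectors $c^\gamma(z)=(1-|\theta_\gamma(0)|^2)^{-1/2}(1-\overline{\theta_\gamma(0)}\theta_\gamma(z),-\overline{\theta_\gamma(0)}\Delta_\gamma(z))^T$, $c_1^\gamma(z)=(1-|\theta_\gamma(0)|^2)^{-1/2}(z^{-1}(\theta_\gamma(z)-\theta_\gamma(0)),z^{-1}\Delta_\gamma(z))^T$.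 $\Phi_\gamma:\mathcal K_{\theta_\gamma}\to L^2(\mu)$ is the unitary operator (Clark operator) with $\Phi_\gamma\mathcal M_{\theta_\gamma}=U_\gamma\Phi_\gamma$, $\Phi_\gamma c^\gamma=b$, $\Phi_\gamma c_1^\gamma=b_1$, and $\Phi_\gamma^*$ its adjoint. *)

theory Defs
  imports "HOL-Probability.Probability"
begin

type_synonym cfun = "complex \<Rightarrow> complex"

definition circle_measure :: "complex measure" where
  "circle_measure = distr (density lborel (\<lambda>t. ennreal (indicator {0..2*pi} t / (2*pi)))) borel cis"

definition L2 :: "complex measure \<Rightarrow> cfun set" where
  "L2 M = {f. f \<in> borel_measurable M \<and> integrable M (\<lambda>x. (cmod (f x))^2)}"

definition ip :: "complex measure \<Rightarrow> cfun \<Rightarrow> cfun \<Rightarrow> complex" where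
  "ip M u v = (\<integral>x. u x * cnj (v x) \<partial>M)"

definition H2 :: "cfun set" where
  "H2 = {h \<in> L2 circle_measure. \<forall>n::nat. n \<ge> 1 \<longrightarrow> (\<integral>\<zeta>. h \<zeta> * \<zeta> ^ n \<partial>circle_measure) = 0}"

definition H2_ext :: "cfun \<Rightarrow> complex \<Rightarrow> complex" where
  "H2_ext h z = (\<integral>\<zeta>. h \<zeta> / (1 - cnj \<zeta> * z) \<partial>circle_measure)"

definition stolz :: "complex \<Rightarrow> real \<Rightarrow> complex set" where
  "stolz \<zeta> \<alpha> = {z. cmod z < 1 \<and> cmod (\<zeta> - z) < \<alpha> * (1 - cmod z)}"

definition nt_lim :: "cfun \<Rightarrow> complex \<Rightarrow> complex \<Rightarrow> bool" where
  "nt_lim F \<zeta> L \<longleftrightarrow> (\<forall>\<alpha>>1. (F \<longlongrightarrow> L) (at \<zeta> within stolz \<zeta> \<alpha>))"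

definition bdry :: "cfun \<Rightarrow> cfun" where
  "bdry F \<zeta> = (THE L. nt_lim F \<zeta> L)"

definition R2 :: "complex measure \<Rightarrow> cfun" where
  "R2 \<mu> l = (\<integral>\<xi>. (1 + cnj \<xi> * l) / (1 - cnj \<xi> * l) \<partial>\<mu>)"

definition theta :: "complex measure \<Rightarrow> complex \<Rightarrow> cfun" where
  "theta \<mu> \<gamma> l = ((1 - \<gamma>) * R2 \<mu> l - (1 + \<gamma>)) / ((1 - cnj \<gamma>) * R2 \<mu> l + (1 + cnj \<gamma>))"

definition Delta :: "cfun \<Rightarrow> cfun" where
  "Delta \<theta> \<zeta> = complex_of_real (sqrt (1 - (cmod (bdry \<theta> \<zeta>))^2))"

definition closDL2 :: "cfun \<Rightarrow> cfun set" where
  "closDL2 D = {g \<in> L2 circle_measure. \<forall>e>0. \<exists>h\<in>L2 circle_measure.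
      (\<integral>\<zeta>. (cmod (g \<zeta> - D \<zeta> * h \<zeta>))^2 \<partial>circle_measure) < e}"

definition ipK :: "cfun \<times> cfun \<Rightarrow> cfun \<times> cfun \<Rightarrow> complex" where
  "ipK x y = ip circle_measure (fst x) (fst y) + ip circle_measure (snd x) (snd y)"

definition Kspace :: "cfun \<Rightarrow> (cfun \<times> cfun) set" where
  "Kspace \<theta> = {x. fst x \<in> H2 \<and> snd x \<in> closDL2 (Delta \<theta>) \<and>
      (\<forall>h\<in>H2. ipK x (\<lambda>\<zeta>. bdry \<theta> \<zeta> * h \<zeta>, \<lambda>\<zeta>. Delta \<theta> \<zeta> * h \<zeta>) = 0)}"

definition is_proj :: "(cfun \<times> cfun) set \<Rightarrow> cfun \<times> cfun \<Rightarrow> cfun \<times> cfun \<Rightarrow> bool" where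
  "is_proj K v u \<longleftrightarrow> u \<in> K \<and>
     (\<forall>y\<in>K. ipK (\<lambda>\<zeta>. fst v \<zeta> - fst u \<zeta>, \<lambda>\<zeta>. snd v \<zeta> - snd u \<zeta>) y = 0)"

definition Mz :: "cfun \<times> cfun \<Rightarrow> cfun \<times> cfun" where
  "Mz x = (\<lambda>\<zeta>. \<zeta> * fst x \<zeta>, \<lambda>\<zeta>. \<zeta> * snd x \<zeta>)"

definition Ugamma :: "complex measure \<Rightarrow> complex \<Rightarrow> cfun \<Rightarrow> cfun" where
  "Ugamma \<mu> \<gamma> h \<xi> = \<xi> * h \<xi> + (\<gamma> - 1) * ip \<mu> h cnj"

definition cvec :: "cfun \<Rightarrow> cfun \<times> cfun" where
  "cvec \<theta> = (\<lambda>z. (1 - cnj (\<theta> 0) * bdry \<theta> z) / complex_of_real (sqrt (1 - (cmod (\<theta> 0))^2)),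
              \<lambda>z. - cnj (\<theta> 0) * Delta \<theta> z / complex_of_real (sqrt (1 - (cmod (\<theta> 0))^2)))"

definition c1vec :: "cfun \<Rightarrow> cfun \<times> cfun" where
  "c1vec \<theta> = (\<lambda>z. inverse z * (bdry \<theta> z - \<theta> 0) / complex_of_real (sqrt (1 - (cmod (\<theta> 0))^2)),
               \<lambda>z. inverse z * Delta \<theta> z / complex_of_real (sqrt (1 - (cmod (\<theta> 0))^2)))"

text \<open>Phi is a (the) Clark operator: unitary K_{theta_gamma} -> L^2(mu) (defined on
  representatives, up to a.e. equality), intertwining the model operator with U_gamma,
  with Phi c^gamma = 1 and Phi c_1^gamma = b_1.\<close>
definition clark_op :: "complex measure \<Rightarrow> complex \<Rightarrow> (cfun \<times> cfun \<Rightarrow> cfun) \<Rightarrow> bool" where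
  "clark_op \<mu> \<gamma> \<Phi> \<longleftrightarrow>
    (let K = Kspace (theta \<mu> \<gamma>) in
      (\<forall>x\<in>K. \<Phi> x \<in> L2 \<mu>) \<and>
      (\<forall>x\<in>K. \<forall>y\<in>K. \<forall>a. AE \<xi> in \<mu>.
          \<Phi> (\<lambda>\<zeta>. a * fst x \<zeta> + fst y \<zeta>, \<lambda>\<zeta>. a * snd x \<zeta> + snd y \<zeta>) \<xi> = a * \<Phi> x \<xi> + \<Phi> y \<xi>) \<and>
      (\<forall>x\<in>K. \<forall>y\<in>K. ip \<mu> (\<Phi> x) (\<Phi> y) = ipK x y) \<and>
      (\<forall>f\<in>L2 \<mu>. \<exists>x\<in>K. AE \<xi> in \<mu>. \<Phi> x \<xi> = f \<xi>) \<and>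
      (\<forall>x\<in>K. \<forall>u. is_proj K (Mz x) u \<longrightarrow> (AE \<xi> in \<mu>. \<Phi> u \<xi> = Ugamma \<mu> \<gamma> (\<Phi> x) \<xi>)) \<and>
      (AE \<xi> in \<mu>. \<Phi> (cvec (theta \<mu> \<gamma>)) \<xi> = 1) \<and>
      (AE \<xi> in \<mu>. \<Phi> (c1vec (theta \<mu> \<gamma>)) \<xi> = cnj \<xi>))"

definition is_adjoint_image :: "complex measure \<Rightarrow> complex \<Rightarrow> (cfun \<times> cfun \<Rightarrow> cfun) \<Rightarrow> cfun \<Rightarrow> cfun \<times> cfun \<Rightarrow> bool" where
  "is_adjoint_image \<mu> \<gamma> \<Phi> f g \<longleftrightarrow> g \<in> Kspace (theta \<mu> \<gamma>) \<and>
     (\<forall>x\<in>Kspace (theta \<mu> \<gamma>). ipK g x = ip \<mu> f (\<Phi> x))"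

end

(* Let P denote Poisson integrals.  Reproducing vectors of the model
   space are mapped by the Clark operator to multiples of Cauchy kernels, which yields, with
   N = 2 (1 - |gamma|^2)^(1/2) / ((1 - cnj gamma) R_2 mu + 1 + cnj gamma),

     P[f mu] = g_+ / N + P[g_-] / cnj N   on the disc.

   Non-tangential limits m-almost everywhere give (2).  For (1), divide by P[mu] = (1 - |theta|^2) / |N|^2.  As
   cnj N + cnj theta N = (1 - cnj gamma) (1 - |gamma|^2)^(-1/2) (1 - |theta|^2), the quotient P[f mu] / P[mu] equals
   (1 - cnj gamma) (1 - |gamma|^2)^(-1/2) g_+ up to the error (P[g_-] - cnj theta g_+) N / (1 - |theta|^2).  The difference in
   this error is a covariance with respect to the Poisson kernel, so by Cauchy-Schwarz the square of the error is at most
   P[(|g_1|^2 + |g_2|^2) m] / P[mu], which tends to 0 at mu_s-almost every point.  All boundary limits are instances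
   of one differentiation theorem for quotients P[h sigma] / P[sigma], applied to sigma = mu + m. *)
theory Submission
  imports Defs "HOL-Complex_Analysis.Complex_Analysis"
begin

section \<open>A weak-type maximal inequality on the circle\<close>

text \<open>The singular part of \<open>\<mu>\<close> need not be doubling, so no covering argument
  that enlarges balls is available for (1). The order of the real line replaces it: a finite family
  of arcs can be thinned, without changing its union, until no point is covered more than twice.
  This yields a weak-type bound for every finite measure on the circle. Adding
  \<open>circle_measure\<close> to \<open>\<mu>\<close> keeps the Poisson integral of the reference
  measure at least 1, even near points that \<open>\<mu>\<close> does not charge.

  The factor \<open>N\<close> comes from the intertwining relation: it forces the image of a
  reproducing vector to be a multiple of a Cauchy kernel, and integrating this gives a linear
  equation for the multiple. For the conjugate vectors that equation carries a factor
  \<open>\<theta> l\<close> and is conclusive only where \<open>\<theta>\<close> does not vanish.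
  Since \<open>\<mu>\<close> is not Lebesgue measure, \<open>\<theta>\<close> is not identically
  zero, and the identity theorem covers the rest. The quotients in (2) need boundary values of
  \<open>theta \<mu> 0\<close> different from 1; this follows from Fatou's lemma for the logarithm
  of \<open>1 + F\<close>.\<close>

lemma cis_Arg_unit: "cmod x = 1 \<Longrightarrow> cis (Arg x) = x"
  using cis_Arg[of x] by (cases "x = 0") (auto simp: sgn_eq)

text \<open>The parameter interval is placed around a prescribed \<open>t0\<close> instead of a
  fixed period. Arcs through a common point thus become intervals through a common parameter and can
  be compared on the real line.\<close>

lemma sphere_Int_ball_eq_arc:
  assumes c: "cmod c = 1" and \<rho>: "\<rho> > 0" and t0: "cis t0 \<in> ball c \<rho>"
  shows "\<exists>a b. a < t0 \<and> t0 < b \<and> sphere 0 1 \<inter> ball c \<rho> = cis ` {a<..<b}"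
proof -
  \<comment> \<open>\<open>v\<close> is the angle from \<open>cis t0\<close> to the centre, so
    \<open>s\<close> is the lift of the centre that is nearest to \<open>t0\<close>.\<close>
  define v where "v = Arg (c / cis t0)"
  define s where "s = t0 + v"
  have cv: "cis v = c / cis t0" using c unfolding v_def by (intro cis_Arg_unit) (simp add: norm_divide)
  have cs: "cis s = c" unfolding s_def by (simp flip: cis_mult add: cv)
  have v_le: "\<bar>v\<bar> \<le> pi" using Arg_bounded[of "c / cis t0"] by (auto simp: v_def)
  \<comment> \<open>The chord formula turns membership in the ball into a comparison of cosines,
    which are decreasing on [0, pi].\<close>
  have d: "dist c (cis (s + u)) ^ 2 = 2 - 2 * cos u" for u
  proof -
    have "dist c (cis (s + u)) = cmod (c * (1 - cis u))"
      by (simp add: dist_norm cs[symmetric] cis_mult[symmetric] algebra_simps)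
    also have "\<dots> = cmod (1 - cis u)" using c by (simp add: norm_mult)
    also have "cmod (1 - cis u) ^ 2 = (1 - cos u)\<^sup>2 + (sin u)\<^sup>2" by (simp add: cmod_power2)
    also have "\<dots> = 2 - 2 * cos u" using sin_cos_squared_add[of u] by (simp add: power2_diff)
    finally show ?thesis .
  qed
  show ?thesis
  \<comment> \<open>A radius above 2 captures the whole circle. Any half-width above pi then makes
    an open interval wrap around it; 4 is such a number.\<close>
  proof (cases "\<rho> > 2")
    case True
    have "x \<in> cis ` {t0 - 4<..<t0 + 4}" if "cmod x = 1" for x
    proof -
      have "cis (Arg (x / cis t0)) = x / cis t0" using that by (intro cis_Arg_unit) (simp add: norm_divide)
      then have "x = cis (t0 + Arg (x / cis t0))" by (simp flip: cis_mult)
      moreover have "\<bar>Arg (x / cis t0)\<bar> < 4" using Arg_bounded[of "x / cis t0"] pi_less_4 by linarith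
      ultimately show ?thesis by (intro image_eqI[of _ _ "t0 + Arg (x / cis t0)"]) auto
    qed
    moreover have "x \<in> ball c \<rho>" if "cmod x = 1" for x
      using that c True norm_triangle_ineq4[of c x] by (auto simp: dist_norm)
    ultimately have "sphere 0 1 \<inter> ball c \<rho> = cis ` {t0 - 4<..<t0 + 4}" by auto
    then show ?thesis by (intro exI[of _ "t0 - 4"] exI[of _ "t0+4"]) auto
  next
    case False
    \<comment> \<open>The half-angle whose chord has length \<open>\<rho>\<close>, that is the
      solution of 2 - 2 cos \<eta> = \<rho>^2. At \<rho> = 2 the open arc correctly omits the
      antipode.\<close>
    define \<eta> where "\<eta> = arccos (1 - \<rho>\<^sup>2 / 2)"
    have "\<rho>^2 \<le> 2^2" using False \<rho> by (intro power_mono) auto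
    then have b: "-1 \<le> 1 - \<rho>\<^sup>2 / 2" "1 - \<rho>\<^sup>2 / 2 \<le> 1" by auto
    have \<eta>: "0 \<le> \<eta>" "\<eta> \<le> pi" "cos \<eta> = 1 - \<rho>\<^sup>2 / 2" using b arccos[of "1 - \<rho>\<^sup>2 / 2"] by (auto simp: \<eta>_def)
    have iff: "cis (s + u) \<in> ball c \<rho> \<longleftrightarrow> \<bar>u\<bar> < \<eta>" if "\<bar>u\<bar> \<le> pi" for u
    proof -
      have "cis (s + u) \<in> ball c \<rho> \<longleftrightarrow> dist c (cis (s+u))^2 < \<rho>^2"
        using \<rho> by (auto intro: power_strict_mono dest: power_less_imp_less_base)
      also have "\<dots> \<longleftrightarrow> cos \<eta> < cos \<bar>u\<bar>" by (simp add: d \<eta>) linarith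
      also have "\<dots> \<longleftrightarrow> \<bar>u\<bar> < \<eta>" using that \<eta>(1,2) by (intro cos_mono_less_eq) auto
      finally show ?thesis .
    qed
    have "\<bar>-v\<bar> < \<eta>" using iff[of "-v"] v_le t0 by (simp add: s_def)
    moreover have "sphere 0 1 \<inter> ball c \<rho> = cis ` {s - \<eta><..<s + \<eta>}"
    proof (intro equalityI subsetI)
      fix x assume x: "x \<in> sphere 0 1 \<inter> ball c \<rho>"
      then have "cis (Arg (x / cis s)) = x / cis s" by (intro cis_Arg_unit) (simp add: norm_divide)
      then have e: "x = cis (s + Arg (x / cis s))" by (simp flip: cis_mult)
      moreover have "\<bar>Arg (x / cis s)\<bar> \<le> pi" using Arg_bounded[of "x / cis s"] by linarith
      ultimately have "\<bar>Arg (x / cis s)\<bar> < \<eta>" using iff[of "Arg (x / cis s)"] x by auto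
      then show "x \<in> cis ` {s - \<eta><..<s + \<eta>}" by (intro image_eqI[of x cis "s + Arg (x / cis s)"]) (use e in auto)
    next
      fix x assume "x \<in> cis ` {s - \<eta><..<s + \<eta>}"
      then obtain t where t: "x = cis t" "\<bar>t - s\<bar> < \<eta>" by (auto simp: abs_less_iff)
      then show "x \<in> sphere 0 1 \<inter> ball c \<rho>" using iff[of "t - s"] \<eta> by auto
    qed
    ultimately show ?thesis by (intro exI[of _ "s - \<eta>"] exI[of _ "s + \<eta>"]) (auto simp: s_def)
  qed
qed

definition circle_arc :: "complex \<times> real \<Rightarrow> complex set" where
  "circle_arc B = sphere 0 1 \<inter> ball (fst B) (snd B)"

text \<open>Lifted to intervals around one parameter, an interval with the least left end and one
  with the greatest right end already cover all three.\<close>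

lemma arc_three:
  assumes B: "\<And>i. i \<in> {B1, B2, B3} \<Longrightarrow> cmod (fst i) = 1 \<and> snd i > 0 \<and> p \<in> circle_arc i"
  shows "circle_arc B1 \<subseteq> circle_arc B2 \<union> circle_arc B3 \<or> circle_arc B2 \<subseteq> circle_arc B1 \<union> circle_arc B3 \<or> circle_arc B3 \<subseteq> circle_arc B1 \<union> circle_arc B2"
proof -
  have "cmod p = 1" using B[of B1] by (auto simp: circle_arc_def)
  then obtain t0 where p: "p = cis t0"
    using cis_Arg_unit[of p] by metis
  have "\<exists>a b. a < t0 \<and> t0 < b \<and> circle_arc i = cis ` {a<..<b}" if "i \<in> {B1, B2, B3}" for i
    using sphere_Int_ball_eq_arc[of "fst i" "snd i" t0] B[OF that] p by (auto simp: circle_arc_def)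
  then obtain a1 b1 a2 b2 a3 b3 where
    1: "a1 < t0" "t0 < b1" "circle_arc B1 = cis ` {a1<..<b1}" and
    2: "a2 < t0" "t0 < b2" "circle_arc B2 = cis ` {a2<..<b2}" and
    3: "a3 < t0" "t0 < b3" "circle_arc B3 = cis ` {a3<..<b3}" by (meson insertCI)
  have *: "{a<..<b} \<subseteq> {a'<..<b'} \<union> {a''<..<b''}"
    if "min a' a'' \<le> a" "b \<le> max b' b''" "a' < t0" "t0 < b'" "a'' < t0" "t0 < b''" for a b a' b' a'' b'' :: real
    using that by (auto simp: min_def max_def split: if_splits)
  have "min a2 a3 \<le> a1 \<and> b1 \<le> max b2 b3 \<or> min a1 a3 \<le> a2 \<and> b2 \<le> max b1 b3 \<or> min a1 a2 \<le> a3 \<and> b3 \<le> max b1 b2"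
    unfolding min_le_iff_disj le_max_iff_disj by (smt (verit))
  then have "{a1<..<b1} \<subseteq> {a2<..<b2} \<union> {a3<..<b3} \<or> {a2<..<b2} \<subseteq> {a1<..<b1} \<union> {a3<..<b3}
    \<or> {a3<..<b3} \<subseteq> {a1<..<b1} \<union> {a2<..<b2}"
    using *[of a2 a3 a1 b1 b2 b3] *[of a1 a3 a2 b2 b1 b3] *[of a1 a2 a3 b3 b1 b2] 1(1,2) 2(1,2) 3(1,2) by blast
  then show ?thesis unfolding 1(3) 2(3) 3(3) by (metis image_Un image_mono)
qed

text \<open>While some point lies in three arcs, \<open>arc_three\<close> makes one of them
  redundant; deleting it shrinks the family, so the process stops at overlap two. No arc is
  enlarged, hence no doubling condition on the measure enters later.\<close>

lemma minimal_arc_cover: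
  assumes "finite \<F>" and "\<And>B. B \<in> \<F> \<Longrightarrow> cmod (fst B) = 1 \<and> snd B > 0"
  shows "\<exists>\<G>\<subseteq>\<F>. (\<Union>B\<in>\<G>. circle_arc B) = (\<Union>B\<in>\<F>. circle_arc B) \<and> (\<forall>p. card {B\<in>\<G>. p \<in> circle_arc B} \<le> 2)"
  using assms
proof (induction rule: finite_psubset_induct)
  case (psubset A)
  show ?case
  proof (cases "\<forall>p. card {B\<in>A. p \<in> circle_arc B} \<le> 2")
    case False
    then obtain p where "\<not> card {B\<in>A. p \<in> circle_arc B} \<le> 2" by blast
    then have p: "3 \<le> card {B\<in>A. p \<in> circle_arc B}" by linarith
    then obtain T where T: "T \<subseteq> {B\<in>A. p \<in> circle_arc B}" "card T = 3"
      using obtain_subset_with_card_n[OF p] by blast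
    then obtain B1 B2 B3 where B: "T = {B1, B2, B3}" "B1 \<noteq> B2" "B2 \<noteq> B3" "B1 \<noteq> B3"
      unfolding card_3_iff by blast
    have "circle_arc B1 \<subseteq> circle_arc B2 \<union> circle_arc B3 \<or> circle_arc B2 \<subseteq> circle_arc B1 \<union> circle_arc B3 \<or> circle_arc B3 \<subseteq> circle_arc B1 \<union> circle_arc B2"
      using T B psubset.prems by (intro arc_three[of _ _ _ p]) auto
    then obtain C where C: "C \<in> A" "circle_arc C \<subseteq> (\<Union>B\<in>A - {C}. circle_arc B)"
    proof (elim disjE)
      assume "circle_arc B1 \<subseteq> circle_arc B2 \<union> circle_arc B3"
      moreover have "B2 \<in> A - {B1}" "B3 \<in> A - {B1}" "B1 \<in> A" using T B by auto
      ultimately show thesis by (intro that[of B1]) blast+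
    next
      assume "circle_arc B2 \<subseteq> circle_arc B1 \<union> circle_arc B3"
      moreover have "B1 \<in> A - {B2}" "B3 \<in> A - {B2}" "B2 \<in> A" using T B by auto
      ultimately show thesis by (intro that[of B2]) blast+
    next
      assume "circle_arc B3 \<subseteq> circle_arc B1 \<union> circle_arc B2"
      moreover have "B1 \<in> A - {B3}" "B2 \<in> A - {B3}" "B3 \<in> A" using T B by auto
      ultimately show thesis by (intro that[of B3]) blast+
    qed
    obtain \<G> where G: "\<G> \<subseteq> A - {C}" "(\<Union>B\<in>\<G>. circle_arc B) = (\<Union>B\<in>A - {C}. circle_arc B)" "\<forall>p. card {B\<in>\<G>. p \<in> circle_arc B} \<le> 2"
    proof -
      have "A - {C} \<subset> A" using C by auto
      moreover have "cmod (fst B) = 1 \<and> snd B > 0" if "B \<in> A - {C}" for B using psubset.prems that by auto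
      ultimately show thesis using psubset.IH[of "A - {C}"] that by blast
    qed
    have "(\<Union>B\<in>A - {C}. circle_arc B) = (\<Union>B\<in>A. circle_arc B)" using C by auto
    then show ?thesis using G by (intro exI[of _ \<G>]) auto
  qed auto
qed

section \<open>Finite Borel measures carried by the circle, and their maximal inequality\<close>

locale circle_finite_measure = finite_measure M for M :: "complex measure" +
  assumes sets_M [measurable_cong, simp]: "sets M = sets borel"
    and on_circle: "AE \<xi> in M. cmod \<xi> = 1"
begin

lemma space_M [simp]: "space M = UNIV"
  using sets_eq_imp_space_eq[OF sets_M] by simp

lemma measure_Int_sphere: "A \<in> sets borel \<Longrightarrow> measure M (sphere 0 1 \<inter> A) = measure M A"
  using on_circle by (intro measure_eq_AE) auto

lemma set_integral_Int_sphere: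
  fixes u :: "complex \<Rightarrow> real"
  shows "A \<in> sets borel \<Longrightarrow> u \<in> borel_measurable borel \<Longrightarrow>
    (\<integral>x. indicator (sphere 0 1 \<inter> A) x * u x \<partial>M) = (\<integral>x. indicator A x * u x \<partial>M)"
  using on_circle by (intro integral_cong_AE) (auto simp: indicator_def)

definition bad_balls :: "(complex \<Rightarrow> real) \<Rightarrow> real \<Rightarrow> (complex \<times> real) set" where
  "bad_balls u t = {B. cmod (fst B) = 1 \<and> snd B > 0 \<and>
     t * measure M (ball (fst B) (snd B)) < (\<integral>x. indicator (ball (fst B) (snd B)) x * u x \<partial>M)}"

text \<open>A superlevel set of the uncentred maximal function of \<open>u\<close> relative to
  \<open>M\<close>. As a union of open balls it is Borel without any measurability argument for the
  maximal function itself.\<close>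

definition bad_set :: "(complex \<Rightarrow> real) \<Rightarrow> real \<Rightarrow> complex set" where
  "bad_set u t = (\<Union>B\<in>bad_balls u t. ball (fst B) (snd B))"

lemma open_bad_set: "open (bad_set u t)"
  by (auto simp: bad_set_def)

text \<open>After thinning, the measure of the union is at most the sum of the measures, and the sum
  of the integrals of \<open>u\<close> counts each point at most twice. This is the origin of the
  constant 2.\<close>

lemma weak_type_finite:
  fixes u :: "complex \<Rightarrow> real"
  assumes u: "integrable M u" "\<And>x. u x \<ge> 0" and t: "t > 0"
    and F: "finite \<F>" "\<F> \<subseteq> bad_balls u t"
  shows "t * measure M (\<Union>B\<in>\<F>. ball (fst B) (snd B)) \<le> 2 * (\<integral>x. u x \<partial>M)"
proof -
  have [measurable]: "u \<in> borel_measurable borel" using u(1) borel_measurable_integrable by fastforce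
  have "\<exists>\<G>\<subseteq>\<F>. (\<Union>B\<in>\<G>. circle_arc B) = (\<Union>B\<in>\<F>. circle_arc B) \<and> (\<forall>p. card {B\<in>\<G>. p \<in> circle_arc B} \<le> 2)"
    using F by (intro minimal_arc_cover) (auto simp: bad_balls_def)
  then obtain \<G> where G: "\<G> \<subseteq> \<F>" "(\<Union>B\<in>\<G>. circle_arc B) = (\<Union>B\<in>\<F>. circle_arc B)" "\<And>p. card {B\<in>\<G>. p \<in> circle_arc B} \<le> 2"
    by auto
  have fin: "finite \<G>" using F(1) G(1) finite_subset by blast
  have [measurable]: "circle_arc B \<in> sets borel" for B by (auto simp: circle_arc_def)
  have bd: "integrable M (\<lambda>x. indicator A x * u x)" if "A \<in> sets borel" for A
    using integrable_mult_indicator[OF _ u(1), of A] that by auto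
  have "measure M (\<Union>B\<in>\<F>. ball (fst B) (snd B)) = measure M (\<Union>B\<in>\<G>. circle_arc B)"
    unfolding G(2) using F(1)
    by (subst measure_Int_sphere[symmetric]) (auto simp: circle_arc_def intro!: borel_open arg_cong[where f="measure M"])
  also have "\<dots> \<le> (\<Sum>B\<in>\<G>. measure M (circle_arc B))" using fin by (intro finite_measure_subadditive_finite) auto
  finally have "t * measure M (\<Union>B\<in>\<F>. ball (fst B) (snd B)) \<le> (\<Sum>B\<in>\<G>. t * measure M (circle_arc B))"
    using t by (simp flip: sum_distrib_left)
  also have "\<dots> \<le> (\<Sum>B\<in>\<G>. \<integral>x. indicator (circle_arc B) x * u x \<partial>M)"
    using G(1) F(2) by (intro sum_mono) (auto simp: bad_balls_def circle_arc_def measure_Int_sphere set_integral_Int_sphere intro!: less_imp_le)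
  also have "\<dots> = (\<integral>x. (\<Sum>B\<in>\<G>. indicator (circle_arc B) x * u x) \<partial>M)"
    by (intro Bochner_Integration.integral_sum[symmetric] bd) auto
  also have "\<dots> \<le> (\<integral>x. 2 * u x \<partial>M)"
  proof (intro integral_mono)
    fix x
    have "(\<Sum>B\<in>\<G>. indicator (circle_arc B) x :: real) = card {B\<in>\<G>. x \<in> circle_arc B}"
      using fin by (simp add: indicator_def sum.If_cases Collect_conj_eq)
    also have "\<dots> \<le> 2" using G(3)[of x] by simp
    finally show "(\<Sum>B\<in>\<G>. indicator (circle_arc B) x * u x) \<le> 2 * u x"
      using u(2)[of x] by (simp flip: sum_distrib_right add: mult_right_mono)
  qed (use u bd in auto)
  finally show ?thesis by simp
qed

text \<open>Lindelof's theorem leaves countably many balls, and continuity of the measure from below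
  reduces these to finite families, for which the bound is uniform.\<close>

lemma weak_type:
  fixes u :: "complex \<Rightarrow> real"
  assumes u: "integrable M u" "\<And>x. u x \<ge> 0" and t: "t > 0"
  shows "t * measure M (bad_set u t) \<le> 2 * (\<integral>x. u x \<partial>M)"
proof -
  let ?b = "\<lambda>B. ball (fst B) (snd B) :: complex set"
  obtain \<F>' where F': "\<F>' \<subseteq> ?b ` bad_balls u t" "countable \<F>'" "\<Union>\<F>' = \<Union>(?b ` bad_balls u t)"
    using Lindelof[of "?b ` bad_balls u t"] by auto
  show ?thesis
  proof (cases "\<F>' = {}")
    case True
    then have "bad_set u t = {}" using F' by (auto simp: bad_set_def)
    then show ?thesis using u by (simp add: integral_nonneg)
  next
    case False
    define A where "A n = (\<Union>i\<le>n. from_nat_into \<F>' i)" for n :: nat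
    have el: "from_nat_into \<F>' i \<in> ?b ` bad_balls u t" for i using F'(1) from_nat_into[OF False] by auto
    have op: "open (from_nat_into \<F>' i)" for i using el[of i] by auto
    have "(\<Union>n. A n) = (\<Union>i. from_nat_into \<F>' i)" by (auto simp: A_def)
    also have "\<dots> = \<Union>\<F>'" using range_from_nat_into[OF False F'(2)] by simp
    finally have "(\<Union>n. A n) = \<Union>\<F>'" .
    then have UA: "(\<Union>n. A n) = bad_set u t" using F' by (simp add: bad_set_def)
    have "(\<lambda>n. measure M (A n)) \<longlonglongrightarrow> measure M (\<Union>n. A n)"
      using op by (intro finite_Lim_measure_incseq) (auto simp: A_def incseq_def intro!: borel_open, fastforce)
    then have lim: "(\<lambda>n. t * measure M (A n)) \<longlonglongrightarrow> t * measure M (bad_set u t)"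
      unfolding UA by (intro tendsto_intros)
    have "t * measure M (A n) \<le> 2 * (\<integral>x. u x \<partial>M)" for n
    proof -
      obtain B where B: "\<And>i. B i \<in> bad_balls u t \<and> from_nat_into \<F>' i = ?b (B i)"
        using el by (auto simp: image_iff) metis
      have "A n = (\<Union>C\<in>B ` {..n}. ?b C)" using B by (auto simp: A_def)
      then show ?thesis using weak_type_finite[OF u t, of "B ` {..n}"] B by auto
    qed
    then show ?thesis by (intro LIMSEQ_le_const2[OF lim]) auto
  qed
qed

lemma not_in_bad_set:
  assumes "\<zeta> \<notin> bad_set u t" "cmod \<zeta> = 1" "\<rho> > 0"
  shows "(\<integral>x. indicator (ball \<zeta> \<rho>) x * u x \<partial>M) \<le> t * measure M (ball \<zeta> \<rho>)"
proof (rule ccontr)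
  assume "\<not> ?thesis"
  then have "(\<zeta>, \<rho>) \<in> bad_balls u t" using assms by (simp add: bad_balls_def)
  then have "\<zeta> \<in> bad_set u t" using assms(3) by (force simp: bad_set_def)
  then show False using assms by auto
qed

end

section \<open>Poisson kernels\<close>

definition poisson :: "complex \<Rightarrow> complex \<Rightarrow> real" where
  "poisson z \<xi> = (1 - (cmod z)\<^sup>2) / (cmod (\<xi> - z))\<^sup>2"

lemma borel_measurable_poisson [measurable]: "poisson z \<in> borel_measurable borel"
  unfolding poisson_def by measurable

lemma cmod_diff_ge: "cmod \<xi> = 1 \<Longrightarrow> 1 - cmod z \<le> cmod (\<xi> - z)"
  using norm_triangle_ineq2[of \<xi> z] by simp

lemma poisson_nonneg: "cmod z < 1 \<Longrightarrow> poisson z \<xi> \<ge> 0"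
  by (auto simp: poisson_def abs_square_le_1 intro!: divide_nonneg_nonneg)

lemma poisson_le: "cmod z < 1 \<Longrightarrow> cmod \<xi> = 1 \<Longrightarrow> poisson z \<xi> \<le> 1 / (1 - cmod z)\<^sup>2"
  unfolding poisson_def by (intro frac_le power_mono cmod_diff_ge) auto

lemma cmod_diff_radial:
  assumes "cmod \<xi> = 1" "cmod \<zeta> = 1" "0 \<le> r"
  shows "(cmod (\<xi> - of_real r * \<zeta>))\<^sup>2 = (1 - r)\<^sup>2 + r * (cmod (\<xi> - \<zeta>))\<^sup>2"
proof -
  have "Re \<xi> ^ 2 + Im \<xi> ^ 2 = 1" "Re \<zeta> ^ 2 + Im \<zeta> ^ 2 = 1"
    using assms by (simp_all flip: cmod_power2)
  then show ?thesis unfolding cmod_power2 by simp algebra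
qed

text \<open>At a point of the radius to \<open>\<zeta>\<close> the kernel is a non-increasing
  function of the distance to \<open>\<zeta>\<close>. Its superlevel sets on the circle are
  therefore the centred arcs that the maximal function controls.\<close>

lemma poisson_radial_superlevel:
  assumes \<zeta>: "cmod \<zeta> = 1" and r: "0 \<le> r" "r < 1" and y: "y \<ge> 0"
  obtains \<rho> where "\<And>\<xi>. cmod \<xi> = 1 \<Longrightarrow> poisson (of_real r * \<zeta>) \<xi> > y \<longleftrightarrow> \<xi> \<in> ball \<zeta> \<rho>"
proof (cases "r = 0")
  case True
  have d: "dist \<zeta> \<xi> < 3" if "cmod \<xi> = 1" for \<xi>
    using norm_triangle_ineq4[of \<zeta> \<xi>] \<zeta> that by (auto simp: dist_norm)
  \<comment> \<open>At the origin the kernel is constantly 1 on the circle: radius 3 exceeds every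
    chord, radius 0 gives the empty ball.\<close>
  show ?thesis using True d by (cases "y < 1") (auto intro: that[of 3] that[of 0] simp: poisson_def)
next
  case False
  \<comment> \<open>The kernel inequality solved for the squared distance. At level 0 every circle
    point qualifies, and 9 is simply a number above the largest squared chord, 4.\<close>
  define q where "q = (if y = 0 then 9 else ((1 - r\<^sup>2) / y - (1 - r)\<^sup>2) / r)"
  have r2: "1 - r\<^sup>2 > 0" using r by (simp add: abs_square_less_1)
  show ?thesis
  proof (rule that)
    fix \<xi> :: complex assume \<xi>: "cmod \<xi> = 1"
    define d where "d = (cmod (\<xi> - \<zeta>))\<^sup>2"
    have d: "d \<ge> 0" by (simp add: d_def)
    have "cmod (\<xi> - \<zeta>) \<le> 2" using norm_triangle_ineq4[of \<xi> \<zeta>] \<zeta> \<xi> by simp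
    then have d4: "d \<le> 2^2" unfolding d_def by (intro power_mono) auto
    have pos: "(1 - r)\<^sup>2 + r * d > 0" using r d by (intro add_pos_nonneg) auto
    have "poisson (of_real r * \<zeta>) \<xi> > y \<longleftrightarrow> y * ((1 - r)\<^sup>2 + r * d) < 1 - r\<^sup>2"
      unfolding poisson_def cmod_diff_radial[OF \<xi> \<zeta> r(1)] d_def[symmetric]
      using pos \<zeta> by (simp add: norm_mult pos_less_divide_eq)
    also have "\<dots> \<longleftrightarrow> d < q"
    proof (cases "y = 0")
      case True then show ?thesis using r2 d4 by (simp add: q_def)
    next
      case False
      then have "y > 0" using y by simp
      then show ?thesis using \<open>r \<noteq> 0\<close> r unfolding q_def by (simp add: field_simps)
    qed
    also have "\<dots> \<longleftrightarrow> \<xi> \<in> ball \<zeta> (sqrt (max 0 q))"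
      using d by (auto simp: d_def dist_norm norm_minus_commute real_less_rsqrt real_sqrt_less_iff max_def
         dest: real_less_lsqrt intro: sqrt_le_D) (smt (verit) norm_ge_zero real_le_lsqrt real_sqrt_le_iff real_sqrt_unique zero_le_power2)+
    finally show "poisson (of_real r * \<zeta>) \<xi> > y \<longleftrightarrow> \<xi> \<in> ball \<zeta> (sqrt (max 0 q))" .
  qed
qed

text \<open>In a Stolz angle, \<open>z\<close> and the radial point of the same modulus are at most
  (1 + \<alpha>) (1 - |z|) apart, and 1 - |z| bounds from below the distance of either to any circle
  point. Hence their distances to \<xi> agree up to the factor 2 + \<alpha>, which the kernel
  squares.\<close>

lemma stolz_radial_compare:
  assumes z: "z \<in> stolz \<zeta> \<alpha>" and \<zeta>: "cmod \<zeta> = 1" and \<xi>: "cmod \<xi> = 1" and \<alpha>: "\<alpha> > 0"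
  shows "poisson z \<xi> \<le> (2 + \<alpha>)\<^sup>2 * poisson (of_real (cmod z) * \<zeta>) \<xi>"
    and "poisson (of_real (cmod z) * \<zeta>) \<xi> \<le> (2 + \<alpha>)\<^sup>2 * poisson z \<xi>"
proof -
  let ?w = "of_real (cmod z) * \<zeta>"
  have z1: "cmod z < 1" "cmod (\<zeta> - z) < \<alpha> * (1 - cmod z)" using z by (auto simp: stolz_def)
  have w: "cmod ?w = cmod z" using \<zeta> by (simp add: norm_mult)
  have "\<zeta> - ?w = of_real (1 - cmod z) * \<zeta>" by (simp add: algebra_simps)
  then have "cmod (\<zeta> - ?w) = \<bar>1 - cmod z\<bar>" using \<zeta> by (simp only: norm_mult norm_of_real) simp
  then have d: "cmod (z - ?w) \<le> (1 + \<alpha>) * (1 - cmod z)"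
    using norm_triangle_ineq4[of "\<zeta> - ?w" "\<zeta> - z"] z1 by (simp add: algebra_simps)
  have p: "0 < cmod (\<xi> - z)" "0 < cmod (\<xi> - ?w)"
    using cmod_diff_ge[OF \<xi>, of z] cmod_diff_ge[OF \<xi>, of ?w] z1 w by auto
  have "(1 + \<alpha>) * (1 - cmod z) \<le> (1 + \<alpha>) * cmod (\<xi> - z)" "(1 + \<alpha>) * (1 - cmod z) \<le> (1 + \<alpha>) * cmod (\<xi> - ?w)"
    using cmod_diff_ge[OF \<xi>, of z] cmod_diff_ge[OF \<xi>, of ?w] w \<alpha> by (auto intro!: mult_left_mono)
  then have 1: "cmod (\<xi> - ?w) \<le> (2 + \<alpha>) * cmod (\<xi> - z)" and 2: "cmod (\<xi> - z) \<le> (2 + \<alpha>) * cmod (\<xi> - ?w)"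
    using norm_triangle_ineq[of "\<xi> - z" "z - ?w"] norm_triangle_ineq4[of "\<xi> - ?w" "z - ?w"] d by (auto simp: algebra_simps)
  have *: "c / x\<^sup>2 \<le> k\<^sup>2 * (c / y\<^sup>2)" if "0 < x" "0 < y" "y \<le> k * x" "0 \<le> c" for c x y k :: real
  proof -
    have "y\<^sup>2 \<le> (k * x)\<^sup>2" using that by (intro power_mono) auto
    then have "c * y\<^sup>2 \<le> c * (k * x)\<^sup>2" using that by (intro mult_left_mono)
    then show ?thesis using that by (simp add: field_simps power_mult_distrib)
  qed
  have c: "0 \<le> 1 - (cmod z)\<^sup>2" using z1 by (simp add: abs_square_le_1)
  show "poisson z \<xi> \<le> (2 + \<alpha>)\<^sup>2 * poisson ?w \<xi>" "poisson ?w \<xi> \<le> (2 + \<alpha>)\<^sup>2 * poisson z \<xi>"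
    unfolding poisson_def w using *[OF p(1,2) 1 c] *[OF p(2,1) 2 c] by auto
qed

text \<open>Writing \<open>k\<close> as the integral over y \<ge> 0 of the indicators of its
  superlevel sets and exchanging the integrals lifts an inequality for those sets to one for
  \<open>k\<close>.\<close>

lemma (in finite_measure) layer_cake_mono:
  fixes u k :: "'a \<Rightarrow> real"
  assumes [measurable]: "integrable M u" "k \<in> borel_measurable M" and u: "\<And>x. u x \<ge> 0"
    and le: "\<And>y. y \<ge> 0 \<Longrightarrow> (\<integral>x. indicator {x\<in>space M. k x > y} x * u x \<partial>M) \<le> t * measure M {x\<in>space M. k x > y}"
    and t: "t \<ge> 0"
  shows "(\<integral>\<^sup>+x. ennreal (u x) * ennreal (k x) \<partial>M) \<le> ennreal t * (\<integral>\<^sup>+x. ennreal (k x) \<partial>M)"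
proof -
  interpret pair_sigma_finite M lborel ..
  have [measurable]: "u \<in> borel_measurable M" using assms(1) by auto
  have k: "ennreal (k x) = (\<integral>\<^sup>+y. indicator {y::real. 0 \<le> y \<and> y < k x} y \<partial>lborel)" for x
  proof -
    have "{y. 0 \<le> y \<and> y < k x} = {0..<k x}" by auto
    then show ?thesis by (cases "0 \<le> k x") (auto simp: ennreal_neg)
  qed
  have swap: "(\<integral>\<^sup>+x. g x * ennreal (k x) \<partial>M) = (\<integral>\<^sup>+y. \<integral>\<^sup>+x. g x * indicator {y::real. 0 \<le> y \<and> y < k x} y \<partial>M \<partial>lborel)"
    if [measurable]: "g \<in> borel_measurable M" for g :: "'a \<Rightarrow> ennreal"
  proof -
    have "(\<integral>\<^sup>+x. g x * ennreal (k x) \<partial>M) = (\<integral>\<^sup>+x. \<integral>\<^sup>+y. g x * indicator {y::real. 0 \<le> y \<and> y < k x} y \<partial>lborel \<partial>M)"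
      by (simp add: k nn_integral_cmult)
    also have "\<dots> = (\<integral>\<^sup>+y. \<integral>\<^sup>+x. g x * indicator {y::real. 0 \<le> y \<and> y < k x} y \<partial>M \<partial>lborel)"
      by (intro Fubini'[symmetric]) (simp add: indicator_def, measurable)
    finally show ?thesis .
  qed
  have "(\<integral>\<^sup>+x. ennreal (u x) * indicator {y::real. 0 \<le> y \<and> y < k x} y \<partial>M)
      \<le> ennreal t * (\<integral>\<^sup>+x. 1 * indicator {y::real. 0 \<le> y \<and> y < k x} y \<partial>M)" for y
  proof (cases "0 \<le> y")
    case True
    let ?A = "{x\<in>space M. k x > y}"
    have "(\<integral>\<^sup>+x. ennreal (u x) * indicator {y::real. 0 \<le> y \<and> y < k x} y \<partial>M) = (\<integral>\<^sup>+x. ennreal (indicator ?A x * u x) \<partial>M)"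
      using True by (intro nn_integral_cong) (auto simp: indicator_def)
    also have "\<dots> = ennreal (\<integral>x. indicator ?A x * u x \<partial>M)"
      using integrable_mult_indicator[of ?A M u] assms(1) u by (intro nn_integral_eq_integral) auto
    also have "\<dots> \<le> ennreal (t * measure M ?A)" using le[OF True] by (rule ennreal_leI)
    also have "\<dots> = ennreal t * emeasure M ?A" using t by (simp add: ennreal_mult emeasure_eq_measure)
    also have "emeasure M ?A = (\<integral>\<^sup>+x. indicator ?A x \<partial>M)" by simp
    also have "\<dots> = (\<integral>\<^sup>+x. 1 * indicator {y::real. 0 \<le> y \<and> y < k x} y \<partial>M)"
      using True by (intro nn_integral_cong) (auto simp: indicator_def)
    finally show ?thesis .
  qed auto
  then have "(\<integral>\<^sup>+x. ennreal (u x) * ennreal (k x) \<partial>M) \<le> (\<integral>\<^sup>+y. ennreal t * (\<integral>\<^sup>+x. 1 * indicator {y::real. 0 \<le> y \<and> y < k x} y \<partial>M) \<partial>lborel)"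
    by (subst swap) (auto intro!: nn_integral_mono)
  also have "\<dots> = ennreal t * (\<integral>\<^sup>+y. (\<integral>\<^sup>+x. 1 * indicator {y::real. 0 \<le> y \<and> y < k x} y \<partial>M) \<partial>lborel)"
    by (intro nn_integral_cmult) (simp add: indicator_def, measurable)
  also have "\<dots> = ennreal t * (\<integral>\<^sup>+x. 1 * ennreal (k x) \<partial>M)" by (subst swap) auto
  finally show ?thesis by simp
qed

section \<open>Maximal estimates for Poisson averages\<close>

context circle_finite_measure
begin

lemma integrable_mult_bounded:
  fixes f g :: "complex \<Rightarrow> complex"
  assumes "integrable M f" "g \<in> borel_measurable borel" "\<And>\<xi>. cmod \<xi> = 1 \<Longrightarrow> cmod (g \<xi>) \<le> B"
  shows "integrable M (\<lambda>\<xi>. f \<xi> * g \<xi>)"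
proof -
  have [measurable]: "f \<in> borel_measurable borel" "g \<in> borel_measurable borel"
    using assms borel_measurable_integrable[of M f] by auto
  show ?thesis
  proof (rule Bochner_Integration.integrable_bound[where f="\<lambda>x. B * norm (f x)"])
    show "AE x in M. norm (f x * g x) \<le> norm (B * norm (f x))"
      using on_circle
    proof eventually_elim
      case (elim x)
      have "norm (f x) * norm (g x) \<le> norm (f x) * \<bar>B\<bar>" using assms(3)[OF elim] by (intro mult_left_mono) auto
      then show ?case by (simp add: norm_mult abs_mult mult.commute)
    qed
  qed (use assms in auto)
qed

lemma integrable_mult_bounded_real:
  fixes f g :: "complex \<Rightarrow> real"
  assumes "integrable M f" "g \<in> borel_measurable borel" "\<And>\<xi>. cmod \<xi> = 1 \<Longrightarrow> \<bar>g \<xi>\<bar> \<le> B"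
  shows "integrable M (\<lambda>\<xi>. f \<xi> * g \<xi>)"
proof -
  have "integrable M (\<lambda>\<xi>. complex_of_real (f \<xi>) * complex_of_real (g \<xi>))"
    using assms by (intro integrable_mult_bounded[where B=B]) auto
  then show ?thesis by (simp flip: of_real_mult add: complex_of_real_integrable_eq)
qed

definition P_int :: "(complex \<Rightarrow> complex) \<Rightarrow> complex \<Rightarrow> complex" where
  "P_int f z = (\<integral>\<xi>. f \<xi> * of_real (poisson z \<xi>) \<partial>M)"

definition P_one :: "complex \<Rightarrow> real" where
  "P_one z = (\<integral>\<xi>. poisson z \<xi> \<partial>M)"

lemma poisson_bdd: "cmod z < 1 \<Longrightarrow> cmod \<xi> = 1 \<Longrightarrow> \<bar>poisson z \<xi>\<bar> \<le> 1 / (1 - cmod z)\<^sup>2"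
  using poisson_le poisson_nonneg by auto

lemma integrable_poisson_mult:
  "cmod z < 1 \<Longrightarrow> integrable M f \<Longrightarrow> integrable M (\<lambda>\<xi>. f \<xi> * complex_of_real (poisson z \<xi>))"
  using poisson_bdd by (intro integrable_mult_bounded[where B="1 / (1 - cmod z)\<^sup>2"]) auto

lemma integrable_poisson_mult_real:
  "cmod z < 1 \<Longrightarrow> integrable M f \<Longrightarrow> integrable M (\<lambda>\<xi>. f \<xi> * poisson z \<xi>)"
  using poisson_bdd by (intro integrable_mult_bounded_real[where B="1 / (1 - cmod z)\<^sup>2"]) auto

lemma integrable_poisson: "cmod z < 1 \<Longrightarrow> integrable M (poisson z)"
  using integrable_poisson_mult_real[of z "\<lambda>_. 1"] by simp

lemma P_one_nonneg: "cmod z < 1 \<Longrightarrow> P_one z \<ge> 0"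
  unfolding P_one_def by (intro integral_nonneg_AE) (auto simp: poisson_nonneg)

text \<open>Off the bad set every centred average of \<open>u\<close> is at most \<open>t\<close>.
  By \<open>poisson_radial_superlevel\<close> the layers of the kernel are centred arcs, so
  \<open>layer_cake_mono\<close> transfers the bound to the Poisson average.\<close>

lemma poisson_maximal_radial:
  assumes u: "integrable M u" "\<And>x. u x \<ge> 0" and t: "t > 0"
    and \<zeta>: "\<zeta> \<notin> bad_set u t" "cmod \<zeta> = 1" and r: "0 \<le> r" "r < 1"
  shows "(\<integral>\<xi>. u \<xi> * poisson (of_real r * \<zeta>) \<xi> \<partial>M) \<le> t * P_one (of_real r * \<zeta>)"
proof -
  let ?w = "of_real r * \<zeta>"
  have w: "cmod ?w < 1" using \<zeta> r by (simp add: norm_mult)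
  have [measurable]: "u \<in> borel_measurable borel" using u(1) borel_measurable_integrable by fastforce
  have "(\<integral>\<^sup>+x. ennreal (u x) * ennreal (poisson ?w x) \<partial>M) \<le> ennreal t * (\<integral>\<^sup>+x. ennreal (poisson ?w x) \<partial>M)"
  proof (rule layer_cake_mono)
    fix y :: real assume y: "y \<ge> 0"
    obtain \<rho> where \<rho>: "\<And>\<xi>. cmod \<xi> = 1 \<Longrightarrow> poisson ?w \<xi> > y \<longleftrightarrow> \<xi> \<in> ball \<zeta> \<rho>"
      using poisson_radial_superlevel[OF \<zeta>(2) r y] by metis
    have "(\<integral>x. indicator {x\<in>space M. poisson ?w x > y} x * u x \<partial>M) = (\<integral>x. indicator (ball \<zeta> \<rho>) x * u x \<partial>M)"
      using on_circle \<rho> by (intro integral_cong_AE) (auto simp: indicator_def)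
    moreover have "measure M {x\<in>space M. poisson ?w x > y} = measure M (ball \<zeta> \<rho>)"
      using on_circle \<rho> by (intro measure_eq_AE) auto
    moreover have "(\<integral>x. indicator (ball \<zeta> \<rho>) x * u x \<partial>M) \<le> t * measure M (ball \<zeta> \<rho>)"
      using not_in_bad_set[OF \<zeta>] by (cases "\<rho> > 0") (auto simp: not_less ball_empty)
    ultimately show "(\<integral>x. indicator {x\<in>space M. poisson ?w x > y} x * u x \<partial>M) \<le> t * measure M {x\<in>space M. poisson ?w x > y}"
      by simp
  qed (use u t in auto)
  also have "(\<integral>\<^sup>+x. ennreal (u x) * ennreal (poisson ?w x) \<partial>M) = ennreal (\<integral>\<xi>. u \<xi> * poisson ?w \<xi> \<partial>M)"
    using u poisson_nonneg[OF w]
    by (subst nn_integral_eq_integral[symmetric]) (auto intro!: integrable_poisson_mult_real w nn_integral_cong simp: ennreal_mult)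
  also have "(\<integral>\<^sup>+x. ennreal (poisson ?w x) \<partial>M) = ennreal (P_one ?w)"
    unfolding P_one_def using poisson_nonneg[OF w] by (intro nn_integral_eq_integral integrable_poisson w) auto
  finally show ?thesis using t P_one_nonneg[OF w] by (simp add: ennreal_mult[symmetric] ennreal_le_iff)
qed

text \<open>Replacing \<open>z\<close> by the radial point costs (2 + \<alpha>)^2 for the integral
  of \<open>u\<close> and again for \<open>P_one\<close>, hence the fourth power.\<close>

lemma poisson_maximal_stolz:
  assumes u: "integrable M u" "\<And>x. u x \<ge> 0" and t: "t > 0"
    and \<zeta>: "\<zeta> \<notin> bad_set u t" "cmod \<zeta> = 1" and z: "z \<in> stolz \<zeta> \<alpha>" and \<alpha>: "\<alpha> > 0"
  shows "(\<integral>\<xi>. u \<xi> * poisson z \<xi> \<partial>M) \<le> (2 + \<alpha>)^4 * t * P_one z"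
proof -
  let ?w = "of_real (cmod z) * \<zeta>"
  have z1: "cmod z < 1" using z by (auto simp: stolz_def)
  have w: "cmod ?w < 1" using \<zeta> z1 by (simp add: norm_mult)
  have [measurable]: "u \<in> borel_measurable borel" using u(1) borel_measurable_integrable by fastforce
  have "(\<integral>\<xi>. u \<xi> * poisson z \<xi> \<partial>M) \<le> (\<integral>\<xi>. (2 + \<alpha>)\<^sup>2 * (u \<xi> * poisson ?w \<xi>) \<partial>M)"
    using on_circle stolz_radial_compare(1)[OF z \<zeta>(2) _ \<alpha>] u
    by (intro integral_mono_AE integrable_poisson_mult_real integrable_mult_right z1 w)
       (auto intro!: mult_left_mono simp: mult.left_commute)
  also have "\<dots> = (2 + \<alpha>)\<^sup>2 * (\<integral>\<xi>. u \<xi> * poisson ?w \<xi> \<partial>M)" by simp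
  also have "\<dots> \<le> (2 + \<alpha>)\<^sup>2 * (t * P_one ?w)"
    using poisson_maximal_radial[OF u t \<zeta>, of "cmod z"] z1 by (intro mult_left_mono) auto
  finally have 1: "(\<integral>\<xi>. u \<xi> * poisson z \<xi> \<partial>M) \<le> (2 + \<alpha>)\<^sup>2 * (t * P_one ?w)" .
  have "P_one ?w \<le> (\<integral>\<xi>. (2 + \<alpha>)\<^sup>2 * poisson z \<xi> \<partial>M)"
    unfolding P_one_def using on_circle stolz_radial_compare(2)[OF z \<zeta>(2) _ \<alpha>]
    by (intro integral_mono_AE integrable_poisson integrable_mult_right z1 w) auto
  also have "\<dots> = (2 + \<alpha>)\<^sup>2 * P_one z" by (simp add: P_one_def)
  finally have "(2 + \<alpha>)\<^sup>2 * (t * P_one ?w) \<le> (2 + \<alpha>)\<^sup>2 * (t * ((2 + \<alpha>)\<^sup>2 * P_one z))"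
    using t by (intro mult_left_mono) auto
  with 1 show ?thesis by (simp add: power2_eq_square power4_eq_xxxx mult_ac)
qed

end

section \<open>Non-tangential limits of quotients of Poisson integrals\<close>

lemma nt_lim_cong:
  assumes "\<And>z. cmod z < 1 \<Longrightarrow> F z = G z"
  shows "nt_lim F \<zeta> L \<longleftrightarrow> nt_lim G \<zeta> L"
  unfolding nt_lim_def
  by (intro all_cong filterlim_cong) (auto simp: eventually_at_filter stolz_def assms)

lemma eventually_stolz: "\<forall>\<^sub>F z in at \<zeta> within stolz \<zeta> \<alpha>. z \<in> stolz \<zeta> \<alpha>"
  by (simp add: eventually_at_filter)

lemma eventually_disc: "\<forall>\<^sub>F z in at \<zeta> within stolz \<zeta> \<alpha>. cmod z < 1"
  using eventually_stolz by eventually_elim (auto simp: stolz_def)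

text \<open>The uniform lower bound makes the quotients of continuous functions converge at every
  point of the circle, including points outside the support of the measure.\<close>

locale circle_measure_pos = circle_finite_measure +
  fixes c :: real
  assumes c_pos: "c > 0" and P_one_ge: "\<And>z. cmod z < 1 \<Longrightarrow> c \<le> P_one z"
begin

definition ratio :: "(complex \<Rightarrow> complex) \<Rightarrow> complex \<Rightarrow> complex" where
  "ratio f z = P_int f z / of_real (P_one z)"

lemma P_one_pos: "cmod z < 1 \<Longrightarrow> P_one z > 0"
  using c_pos P_one_ge[of z] by linarith

lemma P_int_add: "integrable M f \<Longrightarrow> integrable M g \<Longrightarrow> cmod z < 1 \<Longrightarrow>
    P_int (\<lambda>\<xi>. f \<xi> + g \<xi>) z = P_int f z + P_int g z"
  unfolding P_int_def by (simp add: distrib_right integrable_poisson_mult)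

lemma P_int_cmult: "P_int (\<lambda>\<xi>. a * f \<xi>) z = a * P_int f z"
  unfolding P_int_def by (simp add: mult.assoc)

lemma P_int_const: "P_int (\<lambda>\<xi>. a) z = a * of_real (P_one z)"
  unfolding P_int_def P_one_def by simp

lemma ratio_const: "cmod z < 1 \<Longrightarrow> ratio (\<lambda>_. a) z = a"
  using P_one_pos[of z] by (simp add: ratio_def P_int_const)

lemma ratio_diff_bound:
  assumes f: "integrable M f" "integrable M g" and z: "cmod z < 1"
  shows "cmod (ratio f z - ratio g z) \<le> (\<integral>\<xi>. cmod (f \<xi> - g \<xi>) * poisson z \<xi> \<partial>M) / P_one z"
proof -
  have "ratio f z - ratio g z = P_int (\<lambda>\<xi>. f \<xi> - g \<xi>) z / of_real (P_one z)"
    unfolding ratio_def P_int_def using assms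
    by (simp add: left_diff_distrib integrable_poisson_mult diff_divide_distrib)
  also have "cmod \<dots> = cmod (P_int (\<lambda>\<xi>. f \<xi> - g \<xi>) z) / P_one z"
    using P_one_pos[OF z] by (simp add: norm_divide)
  also have "cmod (P_int (\<lambda>\<xi>. f \<xi> - g \<xi>) z) \<le> (\<integral>\<xi>. cmod ((f \<xi> - g \<xi>) * complex_of_real (poisson z \<xi>)) \<partial>M)"
    unfolding P_int_def by (rule integral_norm_bound)
  also have "\<dots> = (\<integral>\<xi>. cmod (f \<xi> - g \<xi>) * poisson z \<xi> \<partial>M)"
    using poisson_nonneg[OF z] by (simp add: norm_mult)
  finally show ?thesis using P_one_pos[OF z] by (simp add: divide_right_mono)
qed

definition good :: "(complex \<Rightarrow> complex) \<Rightarrow> bool" where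
  "good f \<longleftrightarrow> integrable M f \<and> (AE \<zeta> in M. nt_lim (ratio f) \<zeta> (f \<zeta>))"

lemma good_add:
  assumes "good f" "good g" shows "good (\<lambda>\<xi>. f \<xi> + g \<xi>)"
  unfolding good_def
proof
  have *: "ratio (\<lambda>\<xi>. f \<xi> + g \<xi>) z = ratio f z + ratio g z" if "cmod z < 1" for z
    using assms that by (simp add: ratio_def P_int_add good_def add_divide_distrib)
  show "AE \<zeta> in M. nt_lim (ratio (\<lambda>\<xi>. f \<xi> + g \<xi>)) \<zeta> (f \<zeta> + g \<zeta>)"
    using assms unfolding good_def
    by (subst nt_lim_cong[OF *]) (auto simp: nt_lim_def elim!: eventually_elim2 intro!: tendsto_add)
qed (use assms in \<open>auto simp: good_def\<close>)

lemma good_cmult: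
  assumes "good f" shows "good (\<lambda>\<xi>. a * f \<xi>)"
  using assms unfolding good_def ratio_def P_int_cmult
  by (auto simp: nt_lim_def elim!: eventually_mono intro!: tendsto_mult_left simp flip: times_divide_eq_right)

lemma good_const: "good (\<lambda>_. a)"
  unfolding good_def by (subst nt_lim_cong[OF ratio_const]) (auto simp: nt_lim_def)

text \<open>The passage from a dense class to its closure: along a subsequence the errors are at
  most 4^-n, so the maximal inequality at height 2^-n has summable exceptional sets, and by
  Borel-Cantelli almost every point avoids all but finitely many of them.\<close>

lemma good_closure:
  assumes s: "\<And>n. good (s n)" and f: "integrable M f"
    and lim: "(\<lambda>n. \<integral>\<xi>. cmod (s n \<xi> - f \<xi>) \<partial>M) \<longlonglongrightarrow> 0"
  shows "good f"
proof -
  have [measurable]: "f \<in> borel_measurable borel" "s n \<in> borel_measurable borel" for n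
    using f s[of n] borel_measurable_integrable[of M] by (auto simp: good_def)
  have int: "integrable M (\<lambda>\<xi>. cmod (s n \<xi> - f \<xi>))" for n
    using s[of n] f by (auto simp: good_def)
  have "\<exists>k. (\<integral>\<xi>. cmod (s k \<xi> - f \<xi>) \<partial>M) \<le> (1/4)^n" for n
    using order_tendstoD(2)[OF lim, of "(1/4)^n"] unfolding eventually_sequentially
    by (auto intro: less_imp_le)
  then obtain k where k: "\<And>n. (\<integral>\<xi>. cmod (s (k n) \<xi> - f \<xi>) \<partial>M) \<le> (1/4)^n" by metis
  define u where "u = (\<lambda>n \<xi>. cmod (s (k n) \<xi> - f \<xi>))"
  have u: "integrable M (u n)" "\<And>x. u n x \<ge> 0" for n using int by (auto simp: u_def)
  have [measurable]: "u n \<in> borel_measurable borel" for n unfolding u_def by measurable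
  \<comment> \<open>Outside \<open>A n\<close> both discrepancies are of order 2^-n: that of the
    Poisson quotients in a Stolz angle and that of the functions at the point itself.\<close>
  define A where "A n = bad_set (u n) ((1/2)^n) \<union> {x. u n x > (1/2)^n}" for n
  have bs [measurable]: "bad_set (u n) ((1/2)^n) \<in> sets borel" for n using open_bad_set by (rule borel_open)
  have A [measurable]: "A n \<in> sets borel" for n unfolding A_def by measurable
  \<comment> \<open>The weak-type bound contributes 2 and Markov's inequality contributes 1.\<close>
  have "measure M (A n) \<le> 3 * (1/2)^n" for n
  proof -
    have *: "(1/2)^n * x \<le> K * (1/4)^n \<Longrightarrow> x \<le> K * (1/2)^n" for x K :: real
    proof -
      have "(1/4)^n = (1/2)^n * ((1/2)^n :: real)" by (simp flip: power_mult_distrib)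
      then show "(1/2)^n * x \<le> K * (1/4)^n \<Longrightarrow> x \<le> K * (1/2)^n"
        using mult_le_cancel_left_pos[of "(1/2)^n" x "K * (1/2)^n"] by (simp add: mult.left_commute)
    qed
    have "(1/2)^n * measure M (bad_set (u n) ((1/2)^n)) \<le> 2 * (1/4)^n"
      using weak_type[OF u, of "(1/2)^n" n] k[of n] by (simp add: u_def)
    then have 1: "measure M (bad_set (u n) ((1/2)^n)) \<le> 2 * (1/2)^n" by (rule *)
    have "(1/2)^n * measure M {x. u n x > (1/2)^n} = (\<integral>x. indicator {x. u n x > (1/2)^n} x * (1/2)^n \<partial>M)" by simp
    also have "\<dots> \<le> (\<integral>x. u n x \<partial>M)"
      using u(2)[of n]
      by (intro integral_mono integrable_mult_left integrable_real_indicator u(1)) (auto simp: emeasure_eq_measure indicator_def intro: less_imp_le)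
    also have "\<dots> \<le> 1 * (1/4)^n" using k[of n] by (simp add: u_def)
    finally have 2: "measure M {x. u n x > (1/2)^n} \<le> 1 * (1/2)^n" by (rule *)
    have "measure M (A n) \<le> measure M (bad_set (u n) ((1/2)^n)) + measure M {x. u n x > (1/2)^n}"
      unfolding A_def by (intro measure_Un_le) auto
    with 1 2 show ?thesis by simp
  qed
  then have "summable (\<lambda>n. measure M (A n))"
    by (intro summable_comparison_test'[OF summable_mult[OF summable_geometric[of "1/2::real"]], of _ _ 3]) auto
  then have "AE x in M. \<forall>\<^sub>F n in sequentially. x \<in> space M - A n"
    by (intro borel_cantelli_AE1) (auto simp: emeasure_eq_measure)
  moreover have "AE x in M. \<forall>n. nt_lim (ratio (s n)) x (s n x)"
    using s unfolding AE_all_countable good_def by auto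
  ultimately have "AE \<zeta> in M. nt_lim (ratio f) \<zeta> (f \<zeta>)"
    using on_circle
  proof eventually_elim
    case (elim \<zeta>)
    show ?case unfolding nt_lim_def
    proof (intro allI impI tendstoI)
      fix \<alpha> e :: real assume \<alpha>: "\<alpha> > 1" and e: "e > 0"
      have "(\<lambda>n. ((2 + \<alpha>)^4 + 1) * (1/2)^n) \<longlonglongrightarrow> ((2 + \<alpha>)^4 + 1) * 0"
        by (intro tendsto_intros LIMSEQ_power_zero) auto
      then have "\<forall>\<^sub>F n in sequentially. ((2 + \<alpha>)^4 + 1) * (1/2)^n < e / 2"
        using e by (intro order_tendstoD) auto
      then have ev: "\<forall>\<^sub>F n in sequentially. ((2 + \<alpha>)^4 + 1) * (1/2)^n < e / 2 \<and> \<zeta> \<notin> A n"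
        using elim(1) by eventually_elim auto
      then obtain n where n: "((2 + \<alpha>)^4 + 1) * (1/2)^n < e / 2" "\<zeta> \<notin> A n"
        using eventually_happens'[OF sequentially_bot ev] by blast
      have "\<forall>\<^sub>F z in at \<zeta> within stolz \<zeta> \<alpha>. dist (ratio (s (k n)) z) (s (k n) \<zeta>) < e / 2"
        using elim(2) \<alpha> e by (intro tendstoD) (auto simp: nt_lim_def)
      then show "\<forall>\<^sub>F z in at \<zeta> within stolz \<zeta> \<alpha>. dist (ratio f z) (f \<zeta>) < e"
        using eventually_stolz eventually_disc
      proof eventually_elim
        case (elim z)
        have g: "integrable M (s (k n))" using s by (auto simp: good_def)
        have "cmod (ratio (s (k n)) z - ratio f z) \<le> (\<integral>\<xi>. u n \<xi> * poisson z \<xi> \<partial>M) / P_one z"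
          unfolding u_def by (rule ratio_diff_bound[OF g f elim(3)])
        also have "\<dots> \<le> (2 + \<alpha>)^4 * (1/2)^n"
          using poisson_maximal_stolz[OF u, of "(1/2)^n" \<zeta> n z \<alpha>] n(2) \<open>cmod \<zeta> = 1\<close> elim \<alpha> P_one_pos[of z]
          by (simp add: A_def divide_le_eq)
        finally have 1: "dist (ratio (s (k n)) z) (ratio f z) \<le> (2 + \<alpha>)^4 * (1/2)^n" by (simp add: dist_norm)
        have 2: "dist (s (k n) \<zeta>) (f \<zeta>) \<le> (1/2)^n" using n(2) by (auto simp: A_def u_def dist_norm)
        have "dist (ratio f z) (f \<zeta>) \<le> dist (ratio (s (k n)) z) (ratio f z) + dist (ratio (s (k n)) z) (s (k n) \<zeta>) + dist (s (k n) \<zeta>) (f \<zeta>)"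
          using dist_triangle[of "ratio f z" "f \<zeta>" "ratio (s (k n)) z"] dist_triangle[of "ratio (s (k n)) z" "f \<zeta>" "s (k n) \<zeta>"]
          by (simp add: dist_commute)
        then show ?case using 1 2 n(1) elim(1) by (simp add: distrib_right)
      qed
    qed
  qed
  then show ?thesis using f by (simp add: good_def)
qed

text \<open>Near \<zeta> the oscillation of \<open>f\<close> is small; away from \<zeta> the kernel
  is of order 1 - |z|^2, while the denominator stays above \<open>c\<close>.\<close>

lemma good_continuous:
  assumes f: "continuous_on UNIV f" and B: "\<And>x. cmod (f x) \<le> B"
  shows "good f"
proof -
  have [measurable]: "f \<in> borel_measurable borel" using f by (rule borel_measurable_continuous_onI)
  have int: "integrable M f" by (rule integrable_const_bound[where B=B]) (auto simp: B)
  have B0: "B \<ge> 0" using B[of 0] norm_ge_zero[of "f 0"] by linarith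
  have "nt_lim (ratio f) \<zeta> (f \<zeta>)" if \<zeta>: "cmod \<zeta> = 1" for \<zeta>
    unfolding nt_lim_def
  proof (intro allI impI tendstoI)
    fix \<alpha> e :: real assume \<alpha>: "\<alpha> > 1" and e: "e > 0"
    obtain \<delta> where \<delta>: "\<delta> > 0" "\<And>\<xi>. dist \<xi> \<zeta> < \<delta> \<Longrightarrow> dist (f \<xi>) (f \<zeta>) < e / 2"
      using f e unfolding continuous_on_iff by (metis UNIV_I half_gt_zero)
    \<comment> \<open>On the far part |\<xi> - z| is at least \<delta> / 2 and \<open>f\<close>
      varies by at most 2 B, so K (1 - |z|^2) dominates the integrand there.\<close>
    define K where "K = 2 * B / (\<delta> / 2)\<^sup>2"
    have K0: "K \<ge> 0" using B0 by (simp add: K_def)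
    have "((\<lambda>z. (1 - (cmod z)\<^sup>2) * (K * measure M UNIV / c)) \<longlongrightarrow> (1 - (cmod \<zeta>)\<^sup>2) * (K * measure M UNIV / c)) (at \<zeta> within stolz \<zeta> \<alpha>)"
      by (intro tendsto_intros)
    then have "\<forall>\<^sub>F z in at \<zeta> within stolz \<zeta> \<alpha>. (1 - (cmod z)\<^sup>2) * (K * measure M UNIV / c) < e / 2"
      using \<zeta> e by (intro order_tendstoD) auto
    moreover have "\<forall>\<^sub>F z in at \<zeta> within stolz \<zeta> \<alpha>. dist z \<zeta> < \<delta> / 2"
      using \<delta> by (auto simp: eventually_at intro!: exI[of _ "\<delta> / 2"])
    ultimately show "\<forall>\<^sub>F z in at \<zeta> within stolz \<zeta> \<alpha>. dist (ratio f z) (f \<zeta>) < e"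
      using eventually_disc
    proof eventually_elim
      case (elim z)
      have z2: "1 - (cmod z)\<^sup>2 \<ge> 0" using elim by (simp add: abs_square_le_1)
      have pt: "cmod (f \<xi> - f \<zeta>) * poisson z \<xi> \<le> e / 2 * poisson z \<xi> + K * (1 - (cmod z)\<^sup>2)" if \<xi>: "cmod \<xi> = 1" for \<xi>
      proof (cases "dist \<xi> \<zeta> < \<delta>")
        case True
        then have "cmod (f \<xi> - f \<zeta>) * poisson z \<xi> \<le> e / 2 * poisson z \<xi>"
          using \<delta>(2)[of \<xi>] poisson_nonneg[OF elim(3)] by (intro mult_right_mono) (auto simp: dist_norm)
        then show ?thesis using mult_nonneg_nonneg[OF K0 z2] by linarith
      next
        case False
        have "dist \<xi> \<zeta> \<le> dist \<xi> z + dist z \<zeta>" by (rule dist_triangle)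
        then have "\<delta> / 2 \<le> cmod (\<xi> - z)" using False elim(2) by (simp add: dist_norm)
        then have "poisson z \<xi> \<le> (1 - (cmod z)\<^sup>2) / (\<delta> / 2)\<^sup>2"
          unfolding poisson_def using z2 \<delta>(1) by (intro divide_left_mono power_mono mult_pos_pos zero_less_power) auto
        moreover have "cmod (f \<xi> - f \<zeta>) \<le> 2 * B" using norm_triangle_ineq4[of "f \<xi>" "f \<zeta>"] B[of \<xi>] B[of \<zeta>] by linarith
        ultimately have "cmod (f \<xi> - f \<zeta>) * poisson z \<xi> \<le> (2 * B) * ((1 - (cmod z)\<^sup>2) / (\<delta> / 2)\<^sup>2)"
          using poisson_nonneg[OF elim(3)] B0 by (intro mult_mono) auto
        also have "\<dots> = K * (1 - (cmod z)\<^sup>2)" by (simp add: K_def)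
        finally show ?thesis using mult_nonneg_nonneg[OF _ poisson_nonneg[OF elim(3), of \<xi>], of "e / 2"] e by linarith
      qed
      have AE: "AE \<xi> in M. cmod (f \<xi> - f \<zeta>) * poisson z \<xi> \<le> e / 2 * poisson z \<xi> + K * (1 - (cmod z)\<^sup>2)"
        using on_circle by eventually_elim (rule pt)
      have "dist (ratio f z) (f \<zeta>) = cmod (ratio f z - ratio (\<lambda>_. f \<zeta>) z)" by (simp add: ratio_const elim dist_norm)
      also have "\<dots> \<le> (\<integral>\<xi>. cmod (f \<xi> - f \<zeta>) * poisson z \<xi> \<partial>M) / P_one z"
        by (rule ratio_diff_bound) (use int elim in auto)
      also have "\<dots> \<le> (\<integral>\<xi>. e / 2 * poisson z \<xi> + K * (1 - (cmod z)\<^sup>2) \<partial>M) / P_one z"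
        using P_one_pos[OF elim(3)] int
        by (intro divide_right_mono integral_mono_AE AE integrable_poisson_mult_real elim Bochner_Integration.integrable_add integrable_mult_right integrable_poisson)
           auto
      also have "(\<integral>\<xi>. e / 2 * poisson z \<xi> + K * (1 - (cmod z)\<^sup>2) \<partial>M) = e / 2 * P_one z + K * (1 - (cmod z)\<^sup>2) * measure M UNIV"
        by (subst Bochner_Integration.integral_add) (auto intro!: integrable_poisson elim simp: P_one_def)
      also have "(e / 2 * P_one z + K * (1 - (cmod z)\<^sup>2) * measure M UNIV) / P_one z = e / 2 + K * (1 - (cmod z)\<^sup>2) * measure M UNIV / P_one z"
        using P_one_pos[OF elim(3)] by (simp add: field_simps)
      also have "K * (1 - (cmod z)\<^sup>2) * measure M UNIV / P_one z \<le> K * (1 - (cmod z)\<^sup>2) * measure M UNIV / c"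
        using K0 z2 P_one_ge[OF elim(3)] c_pos by (intro divide_left_mono mult_nonneg_nonneg) (auto intro!: mult_pos_pos P_one_pos elim)
      also have "K * (1 - (cmod z)\<^sup>2) * measure M UNIV / c = (1 - (cmod z)\<^sup>2) * (K * measure M UNIV / c)" by simp
      finally show ?case using elim(1) by linarith
    qed
  qed
  then show ?thesis using int on_circle unfolding good_def by (auto elim!: eventually_mono)
qed

lemma good_indicator_closed:
  assumes "closed K" shows "good (\<lambda>x. indicator K x)"
\<comment> \<open>The distance \<open>infdist\<close> to the empty set is 0 by convention, so the
  approximants below would be constantly 1 for it.\<close>
proof (cases "K = {}")
  case True then show ?thesis using good_const[of 0] by simp
next
  case False
  define s where "s n x = complex_of_real (max 0 (1 - real n * infdist x K))" for n :: nat and x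
  have [measurable]: "K \<in> sets borel" using assms by (rule borel_closed)
  have cont: "continuous_on UNIV (s n)" for n unfolding s_def by (intro continuous_intros)
  have [measurable]: "s n \<in> borel_measurable borel" for n using cont by (rule borel_measurable_continuous_onI)
  have bd: "cmod (s n x) \<le> 1" for n x using infdist_nonneg[of x K] by (auto simp: s_def)
  show ?thesis
  proof (rule good_closure)
    show "good (s n)" for n by (rule good_continuous[OF cont bd])
    show "complex_integrable M (indicator K)"
      by (rule integrable_const_bound[where B=1]) (auto simp: indicator_def)
    have pt: "(\<lambda>n. s n x) \<longlonglongrightarrow> indicator K x" for x
    proof (cases "x \<in> K")
      case True then show ?thesis by (simp add: s_def)
    next
      case F: False
      then have d: "infdist x K > 0"
        using assms False by (metis in_closed_iff_infdist_zero infdist_nonneg less_eq_real_def)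
      have "\<forall>\<^sub>F n in sequentially. real n \<ge> 1 / infdist x K"
        by (rule eventually_ge_at_top[THEN filterlim_real_sequentially[THEN filterlim_iff[THEN iffD1, rule_format]]])
      then have "\<forall>\<^sub>F n in sequentially. s n x = 0"
        by eventually_elim (use d in \<open>auto simp: s_def field_simps\<close>)
      then show ?thesis using F by (simp add: tendsto_eventually)
    qed
    have "(\<lambda>n. \<integral>\<xi>. cmod (s n \<xi> - indicator K \<xi>) \<partial>M) \<longlonglongrightarrow> (\<integral>\<xi>. 0 \<partial>M)"
    proof (rule integral_dominated_convergence[where w="\<lambda>_. 2"])
      show "AE x in M. (\<lambda>i. cmod (s i x - indicator K x)) \<longlonglongrightarrow> 0"
        using pt by (simp add: LIM_zero_iff tendsto_norm_zero_iff)
      show "AE x in M. norm (cmod (s i x - indicator K x)) \<le> 2" for i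
      proof (rule AE_I2)
        fix x
        have "cmod (indicator K x) \<le> 1" by (simp add: indicator_def)
        then show "norm (cmod (s i x - indicator K x)) \<le> 2"
          using bd[of i x] norm_triangle_ineq4[of "s i x" "indicator K x"] by simp
      qed
    qed auto
    then show "(\<lambda>n. \<integral>\<xi>. cmod (s n \<xi> - indicator K \<xi>) \<partial>M) \<longlonglongrightarrow> 0" by simp
  qed
qed

text \<open>Dynkin argument: closed sets form an intersection-stable generator, complements use
  linearity, and disjoint unions use \<open>good_closure\<close>.\<close>

lemma good_indicator:
  assumes "A \<in> sets borel" shows "good (\<lambda>x. indicator A x)"
proof -
  have "Int_stable (Collect closed :: complex set set)" by (auto simp: Int_stable_def)
  moreover have "A \<in> sigma_sets UNIV (Collect closed)"
    using assms by (simp add: borel_eq_closed)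
  ultimately show ?thesis
  proof (induction rule: sigma_sets_induct_disjoint[consumes 1, of "Collect closed" UNIV, simplified, consumes 2, case_names basic empty compl union])
    case (basic A) then show ?case by (simp add: good_indicator_closed)
  next
    case empty then show ?case using good_const[of 0] by simp
  next
    case (compl A)
    have "good (\<lambda>x. 1 + (-1) * indicator A x)" by (intro good_add good_const good_cmult compl)
    also have "(\<lambda>x. 1 + (-1) * indicator A x) = (\<lambda>x. indicator (UNIV - A) x :: complex)" by (auto simp: indicator_def)
    finally show ?case by simp
  next
    case (union A)
    have [measurable]: "A i \<in> sets borel" for i using union(2) by (auto simp: borel_eq_closed)
    have eq: "(\<Sum>i<n. indicator (A i) x) = (indicator (\<Union>i<n. A i) x :: complex)" for n x
      using union(1) by (intro indicator_UN_disjoint[symmetric]) (auto simp: disjoint_family_on_def)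
    show ?case
    proof (rule good_closure)
      show "good (\<lambda>x. \<Sum>i<n. indicator (A i) x)" for n
        by (induction n) (auto intro!: good_const good_add union)
      show "complex_integrable M (indicator (\<Union> (range A)))"
        by (rule integrable_const_bound[where B=1]) (auto simp: indicator_def)
      have "(\<lambda>n. \<integral>\<xi>. cmod (indicator (\<Union>i<n. A i) \<xi> - indicator (\<Union> (range A)) \<xi>) \<partial>M) \<longlonglongrightarrow> (\<integral>\<xi>. 0 \<partial>M)"
      proof (rule integral_dominated_convergence[where w="\<lambda>_. 1"])
        show "AE x in M. (\<lambda>n. cmod (indicator (\<Union>i<n. A i) x - indicator (\<Union> (range A)) x :: complex)) \<longlonglongrightarrow> 0"
        proof (rule AE_I2)
          fix x
          have "(\<lambda>n. indicator (\<Union>i<n. A i) x :: complex) \<longlonglongrightarrow> indicator (\<Union> (range A)) x"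
            by (rule LIMSEQ_indicator_UN)
          then show "(\<lambda>n. cmod (indicator (\<Union>i<n. A i) x - indicator (\<Union> (range A)) x :: complex)) \<longlonglongrightarrow> 0"
            by (intro tendsto_norm_zero LIM_zero)
        qed
        show "AE x in M. norm (cmod (indicator (\<Union>i<n. A i) x - indicator (\<Union> (range A)) x)) \<le> 1" for n
          by (intro AE_I2) (simp add: indicator_def)
      qed measurable
      then show "(\<lambda>n. \<integral>\<xi>. cmod ((\<Sum>i<n. indicator (A i) \<xi>) - indicator (\<Union> (range A)) \<xi>) \<partial>M) \<longlonglongrightarrow> 0"
        unfolding eq by simp
    qed
  qed
qed

theorem poisson_ratio_nt_lim:
  assumes "integrable M f"
  shows "AE \<zeta> in M. nt_lim (ratio f) \<zeta> (f \<zeta>)"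
proof -
  have "good f" using assms
  proof (induction rule: integrable_induct)
    case (base A a)
    have "good (\<lambda>x. a * indicator A x)" using base by (intro good_cmult good_indicator) auto
    also have "(\<lambda>x. a * indicator A x) = (\<lambda>x. indicat_real A x *\<^sub>R a)" by (auto simp: indicator_def)
    finally show ?case .
  next
    case (add f g) then show ?case by (intro good_add)
  next
    case (lim f s)
    show ?case
    proof (rule good_closure[OF lim(5) lim(4)])
      have "(\<lambda>n. \<integral>\<xi>. cmod (s n \<xi> - f \<xi>) \<partial>M) \<longlonglongrightarrow> (\<integral>\<xi>. 0 \<partial>M)"
      proof (rule integral_dominated_convergence[where w="\<lambda>x. 3 * cmod (f x)"])
        show "AE x in M. (\<lambda>n. cmod (s n x - f x)) \<longlonglongrightarrow> 0"
          using lim(2) by (intro AE_I2) (simp add: LIM_zero_iff tendsto_norm_zero_iff)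
        show "AE x in M. norm (cmod (s n x - f x)) \<le> 3 * cmod (f x)" for n
        proof (rule AE_I2)
          fix x assume "x \<in> space M"
          then show "norm (cmod (s n x - f x)) \<le> 3 * cmod (f x)"
            using lim(3)[of x n] norm_triangle_ineq4[of "s n x" "f x"] by simp
        qed
        show "(\<lambda>x. cmod (s n x - f x)) \<in> borel_measurable M" for n
          using lim(1)[of n] lim(4) by measurable
      qed (use lim in auto)
      then show "(\<lambda>n. \<integral>\<xi>. cmod (s n \<xi> - f \<xi>) \<partial>M) \<longlonglongrightarrow> 0" by simp
    qed
  qed
  then show ?thesis by (simp add: good_def)
qed

end

section \<open>Normalised Lebesgue measure on the circle\<close>

lemma sets_circle_measure [measurable_cong, simp]: "sets circle_measure = sets borel"
  by (simp add: circle_measure_def)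

lemma borel_measurable_cnj [measurable]:
  "f \<in> borel_measurable M \<Longrightarrow> (\<lambda>x. cnj (f x)) \<in> borel_measurable M"
  by (rule borel_measurable_continuous_on[of cnj]) (auto intro: continuous_intros)

lemma integral_circle_measure:
  fixes f :: "complex \<Rightarrow> complex"
  assumes [measurable]: "f \<in> borel_measurable borel"
  shows "(\<integral>\<zeta>. f \<zeta> \<partial>circle_measure) = (\<integral>t. indicator {0..2*pi} t *\<^sub>R f (cis t) \<partial>lborel) / (2 * pi)"
proof -
  have [measurable]: "cis \<in> borel_measurable borel"
    by (intro borel_measurable_continuous_onI continuous_intros)
  have "(\<integral>\<zeta>. f \<zeta> \<partial>circle_measure) = (\<integral>t. (indicator {0..2*pi} t / (2*pi)) *\<^sub>R f (cis t) \<partial>lborel)"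
    unfolding circle_measure_def
    by (subst integral_distr) (auto intro!: integral_density)
  also have "\<dots> = (\<integral>t. (indicator {0..2*pi} t *\<^sub>R f (cis t)) / (2 * pi) \<partial>lborel)"
    by (intro Bochner_Integration.integral_cong) (auto simp: scaleR_conv_of_real)
  finally show ?thesis by simp
qed

lemma prob_space_circle_measure: "prob_space circle_measure"
proof
  have [measurable]: "cis \<in> borel_measurable borel"
    by (intro borel_measurable_continuous_onI continuous_intros)
  have "emeasure circle_measure (space circle_measure) = (\<integral>\<^sup>+t. ennreal (indicator {0..2*pi} t / (2*pi)) \<partial>lborel)"
    unfolding circle_measure_def by (subst emeasure_distr) (auto simp: emeasure_density)
  also have "\<dots> = (\<integral>\<^sup>+t. ennreal (1 / (2*pi)) * indicator {0..2*pi} t \<partial>lborel)"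
    by (intro nn_integral_cong) (auto simp: indicator_def)
  also have "\<dots> = 1" by (subst nn_integral_cmult_indicator) (auto simp flip: ennreal_mult)
  finally show "emeasure circle_measure (space circle_measure) = 1" .
qed

interpretation cm: prob_space circle_measure by (rule prob_space_circle_measure)

lemma AE_circle_measure_norm: "AE \<zeta> in circle_measure. cmod \<zeta> = 1"
proof -
  have [measurable]: "cis \<in> borel_measurable borel"
    by (intro borel_measurable_continuous_onI continuous_intros)
  show ?thesis unfolding circle_measure_def
    by (subst AE_distr_iff) auto
qed

interpretation cm: circle_finite_measure circle_measure
  by unfold_locales (auto simp: AE_circle_measure_norm)

section \<open>Moments, power series and the Poisson formula for normalised Lebesgue measure\<close>

lemma moment_circle_measure: "n \<ge> 1 \<Longrightarrow> (\<integral>\<zeta>. \<zeta> ^ n \<partial>circle_measure) = 0"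
proof -
  assume n: "n \<ge> 1"
  have "(\<integral>t. indicator {0..2*pi} t *\<^sub>R cis (real n * t) \<partial>lborel)
      = cis (real n * (2 * pi)) / (\<i> * n) - cis (real n * 0) / (\<i> * n)"
  proof (rule integral_FTC_Icc)
    show "((\<lambda>t. cis (real n * t) / (\<i> * n)) has_vector_derivative cis (real n * t)) (at t within {0..2 * pi})" for t
    proof -
      have "((\<lambda>z. exp (\<i> * of_nat n * z) / (\<i> * n)) has_field_derivative exp (\<i> * of_nat n * of_real t)) (at (of_real t))"
        using n by (auto intro!: derivative_eq_intros)
      then have "((\<lambda>t. exp (\<i> * of_nat n * of_real t) / (\<i> * n)) has_vector_derivative exp (\<i> * of_nat n * of_real t)) (at t within {0..2 * pi})"
        by (rule has_vector_derivative_real_field)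
      then show ?thesis by (simp add: cis_conv_exp mult.assoc)
    qed
  qed (auto intro!: continuous_intros)
  also have "\<dots> = 0" using cis_multiple_2pi[of "real n"] by (simp add: mult.commute)
  finally have "(\<integral>t. indicator {0..2*pi} t *\<^sub>R cis (real n * t) \<partial>lborel) = 0" .
  moreover have "cis (real n * t) = cis t ^ n" for t by (simp add: Complex.DeMoivre)
  ultimately show ?thesis by (simp add: integral_circle_measure)
qed

lemma integral_cnj_circle: "(\<integral>\<zeta>. cnj (f \<zeta>) \<partial>M) = cnj (\<integral>\<zeta>. f \<zeta> \<partial>M)"
proof (cases "integrable M f")
  case False
  then have "\<not> integrable M (\<lambda>\<zeta>. cnj (f \<zeta>))"
    using integrable_cnj[of M "\<lambda>\<zeta>. cnj (f \<zeta>)"] by auto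
  with False show ?thesis by (simp add: not_integrable_integral_eq)
qed simp

lemma cnj_eq_inverse: "cmod \<zeta> = 1 \<Longrightarrow> cnj \<zeta> = inverse \<zeta>"
  by (metis complex_norm_square inverse_unique of_real_1 power_one)

lemma integrable_circle_bounded:
  assumes "f \<in> borel_measurable borel" "\<And>\<zeta>. cmod \<zeta> = 1 \<Longrightarrow> cmod (f \<zeta>) \<le> B"
  shows "integrable circle_measure f"
  using cm.integrable_mult_bounded[of "\<lambda>_. 1" f B] assms by simp

lemma moment2_circle_measure:
  "(\<integral>\<zeta>. \<zeta> ^ k * cnj \<zeta> ^ n \<partial>circle_measure) = (if k = n then 1 else 0)"
proof -
  have *: "(\<integral>\<zeta>. \<zeta> ^ k * cnj \<zeta> ^ n \<partial>circle_measure) = (\<integral>\<zeta>. \<zeta> ^ (k - n) \<partial>circle_measure)" if "n \<le> k" for k n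
  proof (intro integral_cong_AE)
    show "AE \<zeta> in circle_measure. \<zeta> ^ k * cnj \<zeta> ^ n = \<zeta> ^ (k - n)"
      using AE_circle_measure_norm
    proof eventually_elim
      case (elim \<zeta>)
      then have "\<zeta> \<noteq> 0" by auto
      then show ?case using elim that by (simp add: cnj_eq_inverse power_diff field_simps)
    qed
  qed auto
  show ?thesis
  proof (cases "n \<le> k")
    case True
    then show ?thesis using *[OF True] moment_circle_measure[of "k - n"] cm.prob_space by (auto simp: not_le)
  next
    case False
    have "(\<integral>\<zeta>. \<zeta> ^ k * cnj \<zeta> ^ n \<partial>circle_measure) = cnj (\<integral>\<zeta>. \<zeta> ^ n * cnj \<zeta> ^ k \<partial>circle_measure)"
      by (subst integral_cnj_circle[symmetric]) (simp add: mult.commute)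
    then show ?thesis using False *[of k n] moment_circle_measure[of "n - k"] by simp
  qed
qed

text \<open>Convergence beyond the unit circle makes the coefficients absolutely summable, which
  permits termwise integration against a merely integrable \<open>h\<close>.\<close>

lemma power_series_integral:
  fixes a :: "nat \<Rightarrow> complex"
  assumes q: "\<And>w. cmod w < R \<Longrightarrow> (\<lambda>n. a n * w ^ n) sums q w" and R: "R > 1"
    and [measurable]: "q \<in> borel_measurable borel" and h: "integrable circle_measure h"
  shows "(\<lambda>n. a n * (\<integral>\<zeta>. \<zeta> ^ n * h \<zeta> \<partial>circle_measure)) sums (\<integral>\<zeta>. q \<zeta> * h \<zeta> \<partial>circle_measure)"
proof -
  have [measurable]: "h \<in> borel_measurable borel" using h borel_measurable_integrable by fastforce
  \<comment> \<open>Any point of modulus strictly between 1 and R serves; its modulus exceeds 1, so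
    convergence there gives absolute convergence at 1.\<close>
  define x :: complex where "x = of_real ((1 + R) / 2)"
  have x: "cmod x = (1 + R) / 2" using R unfolding x_def by (subst norm_of_real) auto
  then have "summable (\<lambda>n. a n * x ^ n)" using q[of x] R by (intro sums_summable) auto
  from powser_insidea[OF this, of 1] x R have sa: "summable (\<lambda>n. cmod (a n))" by simp
  have int: "integrable circle_measure (\<lambda>\<zeta>. a n * \<zeta> ^ n * h \<zeta>)" for n
    using cm.integrable_mult_bounded[of h "\<lambda>\<zeta>. a n * \<zeta> ^ n" "cmod (a n)"] h
    by (simp add: norm_mult norm_power mult.commute)
  have "(\<lambda>n. \<integral>\<zeta>. a n * \<zeta> ^ n * h \<zeta> \<partial>circle_measure) sums (\<integral>\<zeta>. (\<Sum>n. a n * \<zeta> ^ n * h \<zeta>) \<partial>circle_measure)"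
  proof (rule sums_integral[OF int])
    show "AE \<zeta> in circle_measure. summable (\<lambda>n. norm (a n * \<zeta> ^ n * h \<zeta>))"
      using AE_circle_measure_norm by eventually_elim (simp add: norm_mult norm_power summable_mult2 sa)
    have "(\<integral>\<zeta>. norm (a n * \<zeta> ^ n * h \<zeta>) \<partial>circle_measure) = (\<integral>\<zeta>. cmod (a n) * cmod (h \<zeta>) \<partial>circle_measure)" for n
      using AE_circle_measure_norm by (intro integral_cong_AE) (auto simp: norm_mult norm_power)
    then show "summable (\<lambda>n. \<integral>\<zeta>. norm (a n * \<zeta> ^ n * h \<zeta>) \<partial>circle_measure)" by (simp add: summable_mult2 sa)
  qed
  also have "(\<integral>\<zeta>. (\<Sum>n. a n * \<zeta> ^ n * h \<zeta>) \<partial>circle_measure) = (\<integral>\<zeta>. q \<zeta> * h \<zeta> \<partial>circle_measure)"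
  proof (intro integral_cong_AE)
    show "AE \<zeta> in circle_measure. (\<Sum>n. a n * \<zeta> ^ n * h \<zeta>) = q \<zeta> * h \<zeta>"
      using AE_circle_measure_norm
    proof eventually_elim
      case (elim \<zeta>)
      have "(\<lambda>n. a n * \<zeta> ^ n * h \<zeta>) sums (q \<zeta> * h \<zeta>)" using q[of \<zeta>] elim R by (intro sums_mult2) auto
      then show ?case by (rule sums_unique[symmetric])
    qed
  qed auto
  finally show ?thesis by (simp add: mult.assoc)
qed


lemma holomorphic_imp_sums:
  assumes "q holomorphic_on ball 0 R" "cmod w < R"
  shows "(\<lambda>n. (deriv ^^ n) q 0 / fact n * w ^ n) sums q w"
  using holomorphic_power_series[OF assms(1), of w] assms(2) by simp

lemma mean_value_circle_measure:
  assumes q: "q holomorphic_on ball 0 R" and R: "R > 1" and qm: "q \<in> borel_measurable borel"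
  shows "(\<integral>\<zeta>. q \<zeta> \<partial>circle_measure) = q 0"
proof -
  define a where "a n = (deriv ^^ n) q 0 / fact n" for n
  have 1: "(\<lambda>n. a n * (\<integral>\<zeta>. \<zeta> ^ n * 1 \<partial>circle_measure)) sums (\<integral>\<zeta>. q \<zeta> * 1 \<partial>circle_measure)"
    using holomorphic_imp_sums[OF q] by (intro power_series_integral[OF _ R qm]) (auto simp: a_def)
  have 2: "(\<lambda>n. a n * (\<integral>\<zeta>. \<zeta> ^ n * 1 \<partial>circle_measure)) = (\<lambda>n. if n = 0 then a n else 0)"
    using cm.prob_space moment_circle_measure by (intro ext) (simp del: One_nat_def)
  have "(\<lambda>n. if n = 0 then a n else 0) sums a 0"
    using sums_If_finite[of "\<lambda>n. n = 0" a] by simp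
  from sums_unique2[OF 1[unfolded 2] this] show ?thesis by (simp add: a_def)
qed

text \<open>Splits the kernel into a part analytic in \<open>z\<close> and an antianalytic part
  vanishing at z = 0. The two parts later carry the data of \<open>g1\<close> and of
  \<open>gm\<close> separately.\<close>

lemma poisson_decomp:
  assumes "cmod \<zeta> = 1" "cmod z < 1"
  shows "complex_of_real (poisson z \<zeta>) = 1 / (1 - cnj \<zeta> * z) + \<zeta> * cnj z / (1 - \<zeta> * cnj z)"
proof -
  have n0: "\<zeta> \<noteq> z" using assms by auto
  have 1: "\<zeta> * cnj \<zeta> = 1" using assms by (simp flip: complex_norm_square)
  have d1: "1 - cnj \<zeta> * z = cnj \<zeta> * (\<zeta> - z)" using 1 by (simp add: algebra_simps)
  have d2: "1 - \<zeta> * cnj z = \<zeta> * cnj (\<zeta> - z)" using 1 by (simp add: algebra_simps)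
  have nz: "\<zeta> \<noteq> 0" "cnj \<zeta> \<noteq> 0" "\<zeta> - z \<noteq> 0" "cnj (\<zeta> - z) \<noteq> 0" using assms n0 by (auto simp flip: complex_cnj_diff)
  have e1: "1 / (1 - cnj \<zeta> * z) = \<zeta> / (\<zeta> - z)"
    unfolding d1 using nz 1 by (simp add: divide_simps)
  have e2: "\<zeta> * cnj z / (1 - \<zeta> * cnj z) = cnj z / cnj (\<zeta> - z)"
    unfolding d2 using nz by simp
  have "\<zeta> / (\<zeta> - z) + cnj z / cnj (\<zeta> - z) = (\<zeta> * cnj (\<zeta> - z) + cnj z * (\<zeta> - z)) / ((\<zeta> - z) * cnj (\<zeta> - z))"
    using nz(3,4) by (rule add_frac_eq)
  also have "\<zeta> * cnj (\<zeta> - z) + cnj z * (\<zeta> - z) = 1 - z * cnj z" using 1 by (simp add: algebra_simps)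
  finally have "\<zeta> / (\<zeta> - z) + cnj z / cnj (\<zeta> - z) = (1 - z * cnj z) / ((\<zeta> - z) * cnj (\<zeta> - z))" .
  then show ?thesis
    unfolding poisson_def e1 e2 of_real_divide of_real_diff of_real_1 complex_norm_square by (rule sym)
qed

lemma one_minus_ne0: "cmod a < 1 \<Longrightarrow> cmod b \<le> 1 \<Longrightarrow> 1 - a * b \<noteq> 0" "cmod a < 1 \<Longrightarrow> cmod b \<le> 1 \<Longrightarrow> 1 - b * a \<noteq> 0"
proof -
  assume "cmod a < 1" "cmod b \<le> 1"
  then have "cmod (a * b) < 1" unfolding norm_mult by (meson le_less_trans mult_left_le norm_ge_zero)
  then show "1 - a * b \<noteq> 0" "1 - b * a \<noteq> 0" by (auto simp: mult.commute)
qed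

lemma norm_one_minus_ge: "cmod z < 1 \<Longrightarrow> cmod \<xi> = 1 \<Longrightarrow> 1 - cmod z \<le> cmod (1 - \<xi> * z)"
  using norm_triangle_ineq2[of 1 "\<xi> * z"] by (simp add: norm_mult)

lemma integral_cauchy_kernel:
  assumes z: "cmod z < 1"
  shows "(\<integral>\<zeta>. 1 / (1 - \<zeta> * cnj z) \<partial>circle_measure) = 1" "(\<integral>\<zeta>. 1 / (1 - cnj \<zeta> * z) \<partial>circle_measure) = 1"
proof -
  \<comment> \<open>The distance of the pole of the kernel from the origin; for z = 0 there is no
    pole and any number above 1 will do.\<close>
  define R where "R = (if z = 0 then 2 else 1 / cmod z)"
  have R: "R > 1" using z by (auto simp: R_def field_simps)
  have "1 - \<zeta> * cnj z \<noteq> 0" if "cmod \<zeta> < R" for \<zeta>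
  proof -
    have "cmod (\<zeta> * cnj z) < 1" using that by (auto simp: R_def norm_mult field_simps split: if_splits)
    then show ?thesis by auto
  qed
  then have "(\<lambda>\<zeta>. 1 / (1 - \<zeta> * cnj z)) holomorphic_on ball 0 R" by (auto intro!: holomorphic_intros)
  from mean_value_circle_measure[OF this R] show 1: "(\<integral>\<zeta>. 1 / (1 - \<zeta> * cnj z) \<partial>circle_measure) = 1" by simp
  have "(\<integral>\<zeta>. 1 / (1 - cnj \<zeta> * z) \<partial>circle_measure) = (\<integral>\<zeta>. cnj (1 / (1 - \<zeta> * cnj z)) \<partial>circle_measure)" by simp
  also have "\<dots> = 1" unfolding integral_cnj_circle 1 by simp
  finally show "(\<integral>\<zeta>. 1 / (1 - cnj \<zeta> * z) \<partial>circle_measure) = 1" .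
qed

text \<open>With the kernel split by \<open>poisson_decomp\<close>, the antianalytic part in z pairs
  with \<open>q\<close> to an integrand analytic in \<zeta> that vanishes at 0. In the Cauchy part
  \<open>q\<close> is written as q z + (\<zeta> - z) p; the second summand contributes the integral
  of \<zeta> p, again 0, and the first contributes q z.\<close>

lemma poisson_formula:
  assumes q: "q holomorphic_on ball 0 R" and R: "R > 1" and qm [measurable]: "q \<in> borel_measurable borel"
    and bd: "\<And>\<zeta>. cmod \<zeta> = 1 \<Longrightarrow> cmod (q \<zeta>) \<le> B" and z: "cmod z < 1"
  shows "cm.P_int q z = q z"
proof -
  define p where "p w = (if w = z then deriv q z else (q w - q z) / (w - z))" for w
  have [measurable]: "p \<in> borel_measurable borel" unfolding p_def by measurable
  have p: "p holomorphic_on ball 0 R" unfolding p_def using z R by (intro pole_lemma[OF q]) auto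
  have "(\<lambda>w. w * p w) holomorphic_on ball 0 R" using p by (intro holomorphic_intros)
  from mean_value_circle_measure[OF this R] have p0: "(\<integral>\<zeta>. \<zeta> * p \<zeta> \<partial>circle_measure) = 0" by simp
  have B0: "0 \<le> B" using order_trans[OF norm_ge_zero bd[of 1]] by simp
  define R' where "R' = (if z = 0 then R else min R (1 / cmod z))"
  have R': "R' > 1" "R' \<le> R" using z R by (auto simp: R'_def field_simps)
  have nz: "1 - \<zeta> * cnj z \<noteq> 0" if "cmod \<zeta> < R'" for \<zeta>
  proof -
    have "cmod (\<zeta> * cnj z) < 1" using that by (auto simp: R'_def norm_mult field_simps split: if_splits)
    then show ?thesis by auto
  qed
  have q': "q holomorphic_on ball 0 R'" using q R' by (rule_tac holomorphic_on_subset[of q "ball 0 R"]) auto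
  have "(\<lambda>w. q w * w * cnj z / (1 - w * cnj z)) holomorphic_on ball 0 R'"
    using q' nz by (intro holomorphic_intros) auto
  from mean_value_circle_measure[OF this R'(1)]
  have e0: "(\<integral>\<zeta>. q \<zeta> * \<zeta> * cnj z / (1 - \<zeta> * cnj z) \<partial>circle_measure) = 0" by simp
  have dz: "0 < 1 - cmod z" using z by simp
  have i1: "integrable circle_measure (\<lambda>\<zeta>. \<zeta> * p \<zeta>)"
  proof (rule integrable_circle_bounded)
    fix \<zeta> assume \<zeta>: "cmod \<zeta> = 1"
    have "\<zeta> \<noteq> z" using \<zeta> z by auto
    then have "cmod (\<zeta> * p \<zeta>) = cmod (q \<zeta> - q z) / cmod (\<zeta> - z)" using \<zeta> by (simp add: p_def norm_mult norm_divide)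
    also have "\<dots> \<le> (B + cmod (q z)) / (1 - cmod z)"
      using cmod_diff_ge[OF \<zeta>, of z] dz bd[OF \<zeta>] norm_triangle_ineq4[of "q \<zeta>" "q z"] B0 by (intro frac_le) auto
    finally show "cmod (\<zeta> * p \<zeta>) \<le> (B + cmod (q z)) / (1 - cmod z)" .
  qed auto
  have i2: "integrable circle_measure (\<lambda>\<zeta>. 1 / (1 - cnj \<zeta> * z))"
  proof (rule integrable_circle_bounded)
    fix \<zeta> assume \<zeta>: "cmod \<zeta> = 1"
    show "cmod (1 / (1 - cnj \<zeta> * z)) \<le> 1 / (1 - cmod z)"
      using norm_one_minus_ge[of z "cnj \<zeta>"] dz z \<zeta> by (simp add: norm_divide frac_le)
  qed auto
  have i3: "integrable circle_measure (\<lambda>\<zeta>. q \<zeta> * \<zeta> * cnj z / (1 - \<zeta> * cnj z))"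
  proof (rule integrable_circle_bounded)
    fix \<zeta> assume \<zeta>: "cmod \<zeta> = 1"
    have "cmod (q \<zeta> * \<zeta> * cnj z / (1 - \<zeta> * cnj z)) = cmod (q \<zeta>) * cmod z / cmod (1 - \<zeta> * cnj z)"
      using \<zeta> by (simp add: norm_divide norm_mult)
    also have "\<dots> \<le> B * cmod z / (1 - cmod z)"
      using norm_one_minus_ge[of "cnj z" "\<zeta>"] dz z \<zeta> bd[OF \<zeta>] B0 by (intro frac_le mult_right_mono) auto
    finally show "cmod (q \<zeta> * \<zeta> * cnj z / (1 - \<zeta> * cnj z)) \<le> B * cmod z / (1 - cmod z)" .
  qed auto
  have "cm.P_int q z = (\<integral>\<zeta>. \<zeta> * p \<zeta> + q z * (1 / (1 - cnj \<zeta> * z)) + q \<zeta> * \<zeta> * cnj z / (1 - \<zeta> * cnj z) \<partial>circle_measure)"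
    unfolding cm.P_int_def
  proof (intro integral_cong_AE)
    show "AE \<zeta> in circle_measure. q \<zeta> * complex_of_real (poisson z \<zeta>)
        = \<zeta> * p \<zeta> + q z * (1 / (1 - cnj \<zeta> * z)) + q \<zeta> * \<zeta> * cnj z / (1 - \<zeta> * cnj z)"
      using AE_circle_measure_norm
    proof eventually_elim
      case (elim \<zeta>)
      have "\<zeta> - z \<noteq> 0" using elim z by auto
      moreover have c: "cnj \<zeta> * \<zeta> = 1" using elim by (simp add: mult.commute flip: complex_norm_square)
      moreover have d: "1 - cnj \<zeta> * z = cnj \<zeta> * (\<zeta> - z)" by (simp add: right_diff_distrib c)
      moreover have d2: "cnj \<zeta> = 1 / \<zeta>" "\<zeta> \<noteq> 0" using cnj_eq_inverse[OF elim] elim by (auto simp: inverse_eq_divide)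
      ultimately have "\<zeta> * p \<zeta> + q z * (1 / (1 - cnj \<zeta> * z)) = q \<zeta> * (1 / (1 - cnj \<zeta> * z))"
        unfolding d unfolding d2(1) using d2(2) by (auto simp: p_def divide_simps) (simp add: algebra_simps)
      then show ?case by (simp add: poisson_decomp[OF elim z] distrib_left mult.assoc)
    qed
  qed auto
  also have "\<dots> = (\<integral>\<zeta>. \<zeta> * p \<zeta> \<partial>circle_measure) + q z * (\<integral>\<zeta>. 1 / (1 - cnj \<zeta> * z) \<partial>circle_measure)
     + (\<integral>\<zeta>. q \<zeta> * \<zeta> * cnj z / (1 - \<zeta> * cnj z) \<partial>circle_measure)"
    using i1 i2 i3 by (simp del: mult_1_right times_divide_eq_right)
  finally show ?thesis by (simp add: p0 e0 integral_cauchy_kernel[OF z])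
qed

lemma P_one_circle_measure: "cmod z < 1 \<Longrightarrow> cm.P_one z = 1"
  using poisson_formula[of "\<lambda>_. 1" 2 1 z] unfolding cm.P_int_def cm.P_one_def by simp

interpretation cm: circle_measure_pos circle_measure 1
  by unfold_locales (auto simp: P_one_circle_measure)

lemma ratio_circle_measure: "cmod z < 1 \<Longrightarrow> cm.ratio f z = cm.P_int f z"
  by (simp add: cm.ratio_def P_one_circle_measure)

text \<open>A fixed sequence of radii increasing to 1. The shift by 2 makes the first radius
  positive, since the radii are used as divisors.\<close>

definition rad :: "nat \<Rightarrow> real" where "rad n = 1 - 1 / (real n + 2)"

lemma rad: "0 < rad n" "rad n < 1" by (auto simp: rad_def)

lemma rad_LIMSEQ: "rad \<longlonglongrightarrow> 1"
proof -
  have "(\<lambda>n. 1 - 1 / real (n + 2)) \<longlonglongrightarrow> 1 - 0"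
    by (intro tendsto_diff tendsto_const LIMSEQ_ignore_initial_segment[OF lim_1_over_n])
  then show ?thesis by (simp add: rad_def[abs_def] add.commute)
qed

lemma rad_mono: "n \<le> m \<Longrightarrow> rad n \<le> rad m"
  by (auto simp: rad_def intro!: divide_left_mono)

lemma rad_stolz: "cmod \<zeta> = 1 \<Longrightarrow> \<alpha> > 1 \<Longrightarrow> of_real (rad n) * \<zeta> \<in> stolz \<zeta> \<alpha>"
proof -
  assume \<zeta>: "cmod \<zeta> = 1" and \<alpha>: "\<alpha> > 1"
  have "\<zeta> - of_real (rad n) * \<zeta> = of_real (1 - rad n) * \<zeta>" by (simp add: algebra_simps)
  then have "cmod (\<zeta> - of_real (rad n) * \<zeta>) = 1 - rad n" using \<zeta> rad[of n] by (simp only: norm_mult norm_of_real) simp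
  then show ?thesis using \<zeta> \<alpha> rad[of n] by (simp add: stolz_def norm_mult)
qed

lemma filterlim_rad_stolz:
  assumes "cmod \<zeta> = 1" "\<alpha> > 1"
  shows "filterlim (\<lambda>n. of_real (rad n) * \<zeta>) (at \<zeta> within stolz \<zeta> \<alpha>) sequentially"
  unfolding filterlim_at
proof
  show "\<forall>\<^sub>F n in sequentially. of_real (rad n) * \<zeta> \<in> stolz \<zeta> \<alpha> \<and> of_real (rad n) * \<zeta> \<noteq> \<zeta>"
  proof (intro always_eventually allI conjI)
    fix n
    show "of_real (rad n) * \<zeta> \<in> stolz \<zeta> \<alpha>" using rad_stolz assms by auto
    have "cmod (of_real (rad n) * \<zeta>) \<noteq> cmod \<zeta>" using rad[of n] assms by (simp add: norm_mult)
    then show "of_real (rad n) * \<zeta> \<noteq> \<zeta>" by metis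
  qed
  have "(\<lambda>n. of_real (rad n) * \<zeta>) \<longlonglongrightarrow> of_real 1 * \<zeta>"
    by (intro tendsto_intros rad_LIMSEQ)
  then show "(\<lambda>n. of_real (rad n) * \<zeta>) \<longlonglongrightarrow> \<zeta>" by simp
qed

lemma nt_lim_radial:
  assumes "nt_lim F \<zeta> L" "cmod \<zeta> = 1"
  shows "(\<lambda>n. F (of_real (rad n) * \<zeta>)) \<longlonglongrightarrow> L"
  using filterlim_compose[OF _ filterlim_rad_stolz[OF assms(2), of 2], of F "nhds L"] assms(1)
  by (auto simp: nt_lim_def)

lemma nt_lim_unique: "nt_lim F \<zeta> L \<Longrightarrow> nt_lim F \<zeta> L' \<Longrightarrow> cmod \<zeta> = 1 \<Longrightarrow> L = L'"
  using nt_lim_radial LIMSEQ_unique by blast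

lemma bdry_eq: "nt_lim F \<zeta> L \<Longrightarrow> cmod \<zeta> = 1 \<Longrightarrow> bdry F \<zeta> = L"
  unfolding bdry_def using nt_lim_unique by (intro the_equality) auto

section \<open>Measurability of boundary functions\<close>

lemma open_stolz: "open (stolz \<zeta> \<alpha>)"
proof -
  have "stolz \<zeta> \<alpha> = {z. cmod z < 1} \<inter> {z. cmod (\<zeta> - z) < \<alpha> * (1 - cmod z)}" by (auto simp: stolz_def)
  moreover have "open {z. cmod z < 1}" "open {z. cmod (\<zeta> - z) < \<alpha> * (1 - cmod z)}"
    by (intro open_Collect_less continuous_intros)+
  ultimately show ?thesis by auto
qed

text \<open>\<open>bdry F\<close> is total on the plane, so Borel measurability also concerns points
  off the circle. At an interior point the Stolz region is an open neighbourhood, and the limit is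
  the ordinary one.\<close>

lemma bdry_interior:
  assumes F: "continuous_on (ball 0 1) F" and z: "cmod z < 1"
  shows "bdry F z = F z"
proof -
  have lim: "(F \<longlongrightarrow> F z) (at z)"
    using F z by (metis at_within_open centre_in_ball continuous_on_def dist_0_norm mem_ball open_ball)
  have at: "at z within stolz z \<alpha> = at z" if "\<alpha> > 1" for \<alpha>
    using z that by (intro at_within_open open_stolz) (auto simp: stolz_def)
  have "nt_lim F z L \<longleftrightarrow> L = F z" for L
  proof
    assume "nt_lim F z L"
    then have "(F \<longlongrightarrow> L) (at z)" unfolding nt_lim_def using at[of 2] by (metis one_less_numeral_iff semiring_norm(76))
    then show "L = F z" using lim tendsto_unique[of "at z"] by auto
  qed (use lim in \<open>auto simp: nt_lim_def at\<close>)
  then have "nt_lim F z = (\<lambda>L. L = F z)" by blast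
  then show ?thesis unfolding bdry_def by simp
qed

text \<open>The filter is trivial here, so every number is a limit and \<open>THE\<close> returns
  one fixed unspecified value.\<close>

lemma bdry_exterior:
  assumes z: "cmod z > 1"
  shows "bdry F z = (THE L. True)"
proof -
  have "at z within stolz z \<alpha> = bot" for \<alpha>
  proof -
    have "stolz z \<alpha> \<subseteq> cball 0 1" by (auto simp: stolz_def)
    then have "\<not> z islimpt stolz z \<alpha>"
      using z by (metis closed_cball closed_limpt dist_0_norm islimpt_subset mem_cball not_less)
    then show ?thesis by (simp add: trivial_limit_within)
  qed
  then have "nt_lim F z = (\<lambda>L. True)" by (intro ext) (simp add: nt_lim_def)
  then show ?thesis unfolding bdry_def by simp
qed

lemma borel_measurable_cutoff:
  assumes F: "continuous_on (ball 0 1) F"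
  shows "(\<lambda>z. if cmod z < 1 then F z else (0::complex)) \<in> borel_measurable borel"
proof -
  have "(\<lambda>z. indicator (ball 0 1) z *\<^sub>R F z) \<in> borel_measurable borel"
    by (rule borel_measurable_continuous_on_indicator[OF _ F]) auto
  also have "(\<lambda>z. indicator (ball 0 1) z *\<^sub>R F z) = (\<lambda>z. if cmod z < 1 then F z else 0)"
    by (auto simp: indicator_def)
  finally show ?thesis .
qed

text \<open>By continuity of \<open>F\<close> the Cauchy criterion need only be tested on a countable dense set, so the set
  of points at which the non-tangential limit exists is Borel.\<close>
lemma nt_lim_exists_iff:
  assumes F: "continuous_on (ball 0 1) F" and \<zeta>: "cmod \<zeta> = 1"
    and Q: "\<And>X. open X \<Longrightarrow> X \<noteq> {} \<Longrightarrow> \<exists>d\<in>Q. d \<in> (X :: complex set)"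
  shows "(\<exists>L. nt_lim F \<zeta> L) \<longleftrightarrow>
     (\<forall>n j. \<exists>k. \<forall>p\<in>Q. \<forall>q\<in>Q. p \<in> stolz \<zeta> (real n + 2) \<longrightarrow> dist \<zeta> p < 1 / (real k + 1) \<longrightarrow>
        q \<in> stolz \<zeta> (real n + 2) \<longrightarrow> dist \<zeta> q < 1 / (real k + 1) \<longrightarrow> dist (F p) (F q) \<le> 1 / (real j + 1))"
    (is "?L \<longleftrightarrow> ?R")
proof
  assume ?L
  then obtain L where L: "nt_lim F \<zeta> L" by auto
  show ?R
  proof (intro allI)
    fix n j :: nat
    have "(F \<longlongrightarrow> L) (at \<zeta> within stolz \<zeta> (real n + 2))" using L by (auto simp: nt_lim_def)
    from tendstoD[OF this, of "1 / (real j + 1) / 2"] obtain d where d: "d > 0"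
      "\<And>z. z \<in> stolz \<zeta> (real n + 2) \<Longrightarrow> z \<noteq> \<zeta> \<Longrightarrow> dist z \<zeta> < d \<Longrightarrow> dist (F z) L < 1 / (real j + 1) / 2"
      unfolding eventually_at by auto
    obtain k :: nat where k: "1 / (real k + 1) < d"
      using reals_Archimedean[OF d(1)] by (auto simp: inverse_eq_divide add.commute)
    have ne: "z \<noteq> \<zeta>" if "z \<in> stolz \<zeta> (real n + 2)" for z using that \<zeta> by (auto simp: stolz_def)
    have "dist (F p) (F q) \<le> 1 / (real j + 1)"
      if "p \<in> stolz \<zeta> (real n + 2)" "dist \<zeta> p < 1 / (real k + 1)" "q \<in> stolz \<zeta> (real n + 2)" "dist \<zeta> q < 1 / (real k + 1)" for p q
    proof -
      have "dist (F p) L < 1 / (real j + 1) / 2" "dist (F q) L < 1 / (real j + 1) / 2"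
        using d(2)[of p] d(2)[of q] that k ne by (auto simp: dist_commute)
      then show ?thesis using dist_triangle2[of "F p" "F q" L] by linarith
    qed
    then show "\<exists>k. \<forall>p\<in>Q. \<forall>q\<in>Q. p \<in> stolz \<zeta> (real n + 2) \<longrightarrow> dist \<zeta> p < 1 / (real k + 1) \<longrightarrow>
        q \<in> stolz \<zeta> (real n + 2) \<longrightarrow> dist \<zeta> q < 1 / (real k + 1) \<longrightarrow> dist (F p) (F q) \<le> 1 / (real j + 1)"
      by blast
  qed
next
  assume R: ?R
  define U where "U n k = stolz \<zeta> (real n + 2) \<inter> ball \<zeta> (1 / (real k + 1))" for n k :: nat
  have U: "open (U n k)" "U n k \<subseteq> ball 0 1" for n k
    unfolding U_def by (intro open_Int open_stolz open_ball) (auto simp: stolz_def)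
  have approx: "\<exists>s. (\<forall>i. s i \<in> Q \<inter> U n k) \<and> (\<lambda>i. F (s i)) \<longlonglongrightarrow> F p" if p: "p \<in> U n k" for n k p
  proof -
    have "p \<in> closure (Q \<inter> U n k)"
      unfolding closure_approachable
    proof (intro allI impI)
      fix e :: real assume "e > 0"
      then have "open (ball p e \<inter> U n k)" "ball p e \<inter> U n k \<noteq> {}" using U(1) p centre_in_ball by blast+
      from Q[OF this] show "\<exists>y\<in>Q \<inter> U n k. dist y p < e" by (auto simp: dist_commute)
    qed
    then obtain s where s: "\<And>i. s i \<in> Q \<inter> U n k" "s \<longlonglongrightarrow> p" by (auto simp: closure_sequential)
    have "p \<in> ball 0 1" using p U(2) by blast
    then have "isCont F p" using F continuous_on_eq_continuous_at open_ball by blast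
    then have "(\<lambda>i. F (s i)) \<longlonglongrightarrow> F p" using s(2) by (rule isCont_tendsto_compose)
    then show ?thesis using s by auto
  qed
  have R': "\<exists>k. \<forall>p\<in>U n k. \<forall>q\<in>U n k. dist (F p) (F q) \<le> 1 / (real j + 1)" for n j
  proof -
    obtain k where k: "\<And>p q. p \<in> Q \<inter> U n k \<Longrightarrow> q \<in> Q \<inter> U n k \<Longrightarrow> dist (F p) (F q) \<le> 1 / (real j + 1)"
      using R[rule_format, of n j] by (auto simp: U_def)
    have "dist (F p) (F q) \<le> 1 / (real j + 1)" if p: "p \<in> U n k" and q: "q \<in> U n k" for p q
    proof -
      obtain s t where s: "\<And>i. s i \<in> Q \<inter> U n k" "(\<lambda>i. F (s i)) \<longlonglongrightarrow> F p"
        and t: "\<And>i. t i \<in> Q \<inter> U n k" "(\<lambda>i. F (t i)) \<longlonglongrightarrow> F q"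
        using approx[OF p] approx[OF q] by auto
      have "(\<lambda>i. dist (F (s i)) (F (t i))) \<longlonglongrightarrow> dist (F p) (F q)" by (intro tendsto_dist s t)
      then show ?thesis using k s(1) t(1) by (intro LIMSEQ_le_const2) auto
    qed
    then show ?thesis by blast
  qed
  \<comment> \<open>The radial sequence eventually enters every truncated Stolz region, so it
    supplies one candidate limit valid for all apertures.\<close>
  define r where "r i = complex_of_real (rad i) * \<zeta>" for i
  have rU: "\<forall>\<^sub>F i in sequentially. r i \<in> U n k" for n k
  proof -
    have "r \<longlonglongrightarrow> of_real 1 * \<zeta>" unfolding r_def by (intro tendsto_intros rad_LIMSEQ)
    then have "\<forall>\<^sub>F i in sequentially. dist (r i) \<zeta> < 1 / (real k + 1)" by (intro tendstoD) auto
    then show ?thesis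
      by eventually_elim (auto simp: U_def r_def dist_commute intro!: rad_stolz \<zeta>)
  qed
  have "Cauchy (\<lambda>i. F (r i))"
    unfolding Cauchy_def
  proof (intro allI impI)
    fix e :: real assume "e > 0"
    then obtain j where j: "1 / (real j + 1) < e" using reals_Archimedean by (auto simp: inverse_eq_divide add.commute)
    obtain k where k: "\<forall>p\<in>U 0 k. \<forall>q\<in>U 0 k. dist (F p) (F q) \<le> 1 / (real j + 1)" using R' by blast
    obtain N where N: "\<And>i. i \<ge> N \<Longrightarrow> r i \<in> U 0 k" using rU[of 0 k] by (auto simp: eventually_sequentially)
    then show "\<exists>M. \<forall>m\<ge>M. \<forall>n\<ge>M. dist (F (r m)) (F (r n)) < e" using k j by (meson le_less_trans)
  qed
  then obtain L where L: "(\<lambda>i. F (r i)) \<longlonglongrightarrow> L" using Cauchy_convergent_iff convergent_def by blast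
  have "nt_lim F \<zeta> L"
    unfolding nt_lim_def
  proof (intro allI impI tendstoI)
    fix \<alpha> e :: real assume \<alpha>: "\<alpha> > 1" and e: "e > 0"
    obtain n :: nat where n: "\<alpha> \<le> real n" using real_arch_simple by blast
    have sub: "stolz \<zeta> \<alpha> \<subseteq> stolz \<zeta> (real n + 2)"
    proof
      fix z assume z: "z \<in> stolz \<zeta> \<alpha>"
      then have "\<alpha> * (1 - cmod z) \<le> (real n + 2) * (1 - cmod z)" using n by (intro mult_right_mono) (auto simp: stolz_def)
      moreover have "cmod z < 1" "cmod (\<zeta> - z) < \<alpha> * (1 - cmod z)" using z by (auto simp: stolz_def)
      ultimately show "z \<in> stolz \<zeta> (real n + 2)" unfolding stolz_def mem_Collect_eq by linarith
    qed
    obtain j where j: "1 / (real j + 1) < e" using reals_Archimedean[OF e] by (auto simp: inverse_eq_divide add.commute)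
    obtain k where k: "\<forall>p\<in>U n k. \<forall>q\<in>U n k. dist (F p) (F q) \<le> 1 / (real j + 1)" using R' by blast
    have le: "dist (F p) L \<le> 1 / (real j + 1)" if p: "p \<in> U n k" for p
    proof -
      have "(\<lambda>i. dist (F p) (F (r i))) \<longlonglongrightarrow> dist (F p) L" by (intro tendsto_intros L)
      moreover have "\<forall>\<^sub>F i in sequentially. dist (F p) (F (r i)) \<le> 1 / (real j + 1)"
        using rU[of n k] by eventually_elim (use k p in auto)
      ultimately show ?thesis by (intro tendsto_upperbound) auto
    qed
    have "\<forall>\<^sub>F z in at \<zeta> within stolz \<zeta> \<alpha>. dist \<zeta> z < 1 / (real k + 1)"
      by (auto simp: eventually_at dist_commute intro!: exI[of _ "1 / (real k + 1)"])
    then show "\<forall>\<^sub>F z in at \<zeta> within stolz \<zeta> \<alpha>. dist (F z) L < e"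
      using eventually_stolz
    proof eventually_elim
      case (elim z)
      then have "z \<in> U n k" using sub by (auto simp: U_def)
      then show ?case using le j by fastforce
    qed
  qed
  then show ?L by blast
qed

lemma borel_measurable_bdry:
  assumes F: "continuous_on (ball 0 1) F"
  shows "bdry F \<in> borel_measurable borel"
proof -
  obtain Q :: "complex set" where Q: "countable Q" "\<And>X. open X \<Longrightarrow> X \<noteq> {} \<Longrightarrow> \<exists>d\<in>Q. d \<in> X"
    using countable_dense_exists by auto
  define E where "E = {\<zeta>. \<forall>n j::nat. \<exists>k::nat. \<forall>p\<in>Q. \<forall>q\<in>Q. p \<in> stolz \<zeta> (real n + 2) \<longrightarrow> dist \<zeta> p < 1 / (real k + 1) \<longrightarrow>
        q \<in> stolz \<zeta> (real n + 2) \<longrightarrow> dist \<zeta> q < 1 / (real k + 1) \<longrightarrow> dist (F p) (F q) \<le> 1 / (real j + 1)}"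
  define F' where "F' z = (if cmod z < 1 then F z else 0)" for z
  have [measurable]: "F' \<in> borel_measurable borel" unfolding F'_def by (rule borel_measurable_cutoff[OF F])
  have [measurable]: "Measurable.pred borel (\<lambda>\<zeta>. p \<in> stolz \<zeta> a)" for p a
    unfolding stolz_def by simp
  have [measurable]: "E \<in> sets borel"
    unfolding E_def using Q(1) by measurable
  \<comment> \<open>On the circle outside \<open>E\<close> no limit exists, the predicate under
    \<open>THE\<close> is constantly false, and its value is the same at all such points. On
    \<open>E\<close> the value is a limit along \<open>rad\<close>, hence measurable.\<close>
  have "bdry F = (\<lambda>z. if cmod z < 1 then F' z else if cmod z > 1 then (THE L. True) else
     if z \<in> E then lim (\<lambda>n. F' (of_real (rad n) * z)) else (THE L. False))"
  proof
    fix z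
    consider "cmod z < 1" | "cmod z > 1" | "cmod z = 1" "z \<in> E" | "cmod z = 1" "z \<notin> E" by linarith
    then show "bdry F z = (if cmod z < 1 then F' z else if cmod z > 1 then (THE L. True) else
     if z \<in> E then lim (\<lambda>n. F' (of_real (rad n) * z)) else (THE L. False))"
    proof cases
      case 3
      then obtain L where L: "nt_lim F z L" using nt_lim_exists_iff[OF F 3(1) Q(2)] by (auto simp: E_def)
      have "(\<lambda>n. F (of_real (rad n) * z)) \<longlonglongrightarrow> L" by (rule nt_lim_radial[OF L 3(1)])
      also have "(\<lambda>n. F (of_real (rad n) * z)) = (\<lambda>n. F' (of_real (rad n) * z))"
        using 3(1) rad by (auto simp: F'_def norm_mult abs_of_pos)
      finally show ?thesis using 3 bdry_eq[OF L 3(1)] by (simp add: limI)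
    next
      case 4
      then have "\<not> (\<exists>L. nt_lim F z L)" using nt_lim_exists_iff[OF F 4(1) Q(2)] unfolding E_def by blast
      then have "nt_lim F z = (\<lambda>L. False)" by blast
      then show ?thesis using 4 by (simp add: bdry_def)
    qed (simp_all add: bdry_interior[OF F] bdry_exterior F'_def)
  qed
  also have "\<dots> \<in> borel_measurable borel" by measurable
  finally show ?thesis .
qed

section \<open>Bounded analytic functions and the Hardy space\<close>

lemma P_int_LIMSEQ:
  assumes [measurable]: "\<And>n. s n \<in> borel_measurable borel" "f \<in> borel_measurable borel"
    and lim: "AE \<zeta> in circle_measure. (\<lambda>n. s n \<zeta>) \<longlonglongrightarrow> f \<zeta>"
    and bd: "\<And>n \<zeta>. cmod \<zeta> = 1 \<Longrightarrow> cmod (s n \<zeta>) \<le> B" and z: "cmod z < 1"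
  shows "(\<lambda>n. cm.P_int (s n) z) \<longlonglongrightarrow> cm.P_int f z"
  unfolding cm.P_int_def
proof (rule integral_dominated_convergence[where w="\<lambda>\<zeta>. B * poisson z \<zeta>"])
  show "AE \<zeta> in circle_measure. (\<lambda>n. s n \<zeta> * complex_of_real (poisson z \<zeta>)) \<longlonglongrightarrow> f \<zeta> * complex_of_real (poisson z \<zeta>)"
    using lim by eventually_elim (intro tendsto_intros)
  show "AE \<zeta> in circle_measure. cmod (s n \<zeta> * complex_of_real (poisson z \<zeta>)) \<le> B * poisson z \<zeta>" for n
    using AE_circle_measure_norm by eventually_elim (auto simp: norm_mult poisson_nonneg[OF z] intro!: mult_right_mono bd)
  show "integrable circle_measure (\<lambda>\<zeta>. B * poisson z \<zeta>)" by (intro integrable_mult_right cm.integrable_poisson z)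
qed measurable

text \<open>Integrates the pointwise inequality t \<le> e + t^2 / e, a substitute for Cauchy-Schwarz
  without square roots.\<close>

lemma L1_le_L2:
  assumes "e > 0" and [measurable]: "f \<in> borel_measurable borel" and bd: "\<And>\<zeta>. cmod \<zeta> = 1 \<Longrightarrow> cmod (f \<zeta>) \<le> B"
  shows "(\<integral>\<zeta>. cmod (f \<zeta>) \<partial>circle_measure) \<le> e + (\<integral>\<zeta>. (cmod (f \<zeta>))\<^sup>2 \<partial>circle_measure) / e"
proof -
  have "\<bar>(cmod (f \<zeta>))\<^sup>2\<bar> \<le> B\<^sup>2" if "cmod \<zeta> = 1" for \<zeta> using bd[OF that] by (auto intro: power_mono)
  then have int: "integrable circle_measure (\<lambda>\<zeta>. cmod (f \<zeta>))" "integrable circle_measure (\<lambda>\<zeta>. (cmod (f \<zeta>))\<^sup>2)"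
    using cm.integrable_mult_bounded_real[of "\<lambda>_. 1" "\<lambda>\<zeta>. cmod (f \<zeta>)" B]
      cm.integrable_mult_bounded_real[of "\<lambda>_. 1" "\<lambda>\<zeta>. (cmod (f \<zeta>))\<^sup>2" "B\<^sup>2"] bd by simp_all
  have "(\<integral>\<zeta>. cmod (f \<zeta>) \<partial>circle_measure) \<le> (\<integral>\<zeta>. e + (cmod (f \<zeta>))\<^sup>2 / e \<partial>circle_measure)"
  proof (intro integral_mono)
    fix \<zeta>
    show "cmod (f \<zeta>) \<le> e + (cmod (f \<zeta>))\<^sup>2 / e"
    proof (cases "cmod (f \<zeta>) \<le> e")
      case True then show ?thesis using assms(1) by (simp add: add_increasing2)
    next
      case False
      then have "e * cmod (f \<zeta>) \<le> (cmod (f \<zeta>))\<^sup>2" unfolding power2_eq_square by (intro mult_right_mono) auto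
      then have "cmod (f \<zeta>) \<le> (cmod (f \<zeta>))\<^sup>2 / e" using assms(1) by (simp add: field_simps)
      then show ?thesis using assms(1) by linarith
    qed
  qed (use int in auto)
  then show ?thesis using int cm.prob_space by simp
qed

text \<open>By Parseval the inner product \<open>A i j\<close> of two dilations has real terms
  |a_n|^2 (rad i * rad j)^n. It is bounded by the sum S of all |a_n|^2 and approaches S as both
  indices grow. Hence the squared distance A i i + A j j - 2 A i j tends to 0.\<close>

lemma dilation_L1_Cauchy:
  assumes \<theta>: "\<theta> holomorphic_on ball 0 1" and bd: "\<And>z. cmod z < 1 \<Longrightarrow> cmod (\<theta> z) \<le> 1"
    and T: "\<And>i z. T i z = (if cmod (of_real (rad i) * z) < 1 then \<theta> (of_real (rad i) * z) else 0)"
    and Tm [measurable]: "\<And>i. T i \<in> borel_measurable borel" and e: "e > 0"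
  shows "\<exists>N. \<forall>i\<ge>N. \<forall>j\<ge>N. (\<integral>\<zeta>. cmod (T i \<zeta> - T j \<zeta>) \<partial>circle_measure) < e"
proof -
  define a where "a n = (deriv ^^ n) \<theta> 0 / fact n" for n
  define b where "b n = (cmod (a n))\<^sup>2" for n
  have T1: "cmod (T i z) \<le> 1" for i z by (auto simp: T bd)
  have Tint: "integrable circle_measure (T i)" for i
    using T1 by (intro integrable_circle_bounded[where B=1]) auto
  have R: "1 / rad i > 1" for i using rad[of i] by simp
  have ser: "(\<lambda>n. (a n * of_real (rad i) ^ n) * w ^ n) sums T i w" if "cmod w < 1 / rad i" for i w
  proof -
    have "cmod (of_real (rad i) * w) < 1" using that rad[of i] by (simp add: norm_mult field_simps)
    then show ?thesis using holomorphic_imp_sums[OF \<theta>, of "of_real (rad i) * w"]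
      by (simp add: T a_def power_mult_distrib mult_ac)
  qed
  have psi: "(\<lambda>n. (a n * of_real (rad i) ^ n) * (\<integral>\<zeta>. \<zeta> ^ n * h \<zeta> \<partial>circle_measure)) sums (\<integral>\<zeta>. T i \<zeta> * h \<zeta> \<partial>circle_measure)"
    if "integrable circle_measure h" for i h
    using ser R[of i] Tm that by (rule power_series_integral)
  have mom: "(\<integral>\<zeta>. T j \<zeta> * cnj \<zeta> ^ n \<partial>circle_measure) = a n * of_real (rad j) ^ n" for j n
  proof -
    have "integrable circle_measure (\<lambda>\<zeta>. cnj \<zeta> ^ n)"
      by (intro integrable_circle_bounded[where B=1]) (auto simp: norm_power)
    from psi[OF this]
    have "(\<lambda>k. a k * of_real (rad j) ^ k * (if k = n then 1 else 0)) sums (\<integral>\<zeta>. T j \<zeta> * cnj \<zeta> ^ n \<partial>circle_measure)"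
      by (simp add: moment2_circle_measure)
    moreover have "(\<lambda>k. a k * of_real (rad j) ^ k * (if k = n then 1 else 0)) sums (a n * of_real (rad j) ^ n)"
      using sums_If_finite[of "\<lambda>k. k = n" "\<lambda>k. a k * of_real (rad j) ^ k"]
      by (simp add: if_distrib cong: if_cong)
    ultimately show ?thesis by (rule sums_unique2)
  qed
  define A where "A i j = Re (\<integral>\<zeta>. T i \<zeta> * cnj (T j \<zeta>) \<partial>circle_measure)" for i j
  have Aint: "integrable circle_measure (\<lambda>\<zeta>. T i \<zeta> * cnj (T j \<zeta>))" for i j
    using T1 by (intro integrable_circle_bounded[where B=1]) (auto simp: norm_mult intro!: mult_le_one)
  have A: "(\<lambda>n. b n * (rad i * rad j) ^ n) sums A i j" for i j
  proof -
    have "(\<integral>\<zeta>. \<zeta> ^ n * cnj (T j \<zeta>) \<partial>circle_measure) = cnj (a n * of_real (rad j) ^ n)" for n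
      unfolding mom[symmetric] by (subst integral_cnj_circle[symmetric]) (simp add: mult.commute)
    moreover have "integrable circle_measure (\<lambda>\<zeta>. cnj (T j \<zeta>))" using Tint by auto
    ultimately have "(\<lambda>n. (a n * of_real (rad i) ^ n) * cnj (a n * of_real (rad j) ^ n)) sums (\<integral>\<zeta>. T i \<zeta> * cnj (T j \<zeta>) \<partial>circle_measure)"
      using psi[of "\<lambda>\<zeta>. cnj (T j \<zeta>)" i] by simp
    then have "(\<lambda>n. Re ((a n * of_real (rad i) ^ n) * cnj (a n * of_real (rad j) ^ n))) sums A i j"
      unfolding A_def by (rule sums_Re)
    moreover have "Re ((a n * of_real (rad i) ^ n) * cnj (a n * of_real (rad j) ^ n)) = b n * (rad i * rad j) ^ n" for n
    proof -
      have "(a n * of_real (rad i) ^ n) * cnj (a n * of_real (rad j) ^ n) = (a n * cnj (a n)) * of_real ((rad i * rad j) ^ n)"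
        by (simp add: power_mult_distrib)
      also have "\<dots> = of_real (b n * (rad i * rad j) ^ n)" unfolding b_def by (simp flip: complex_norm_square)
      finally show ?thesis by simp
    qed
    ultimately show ?thesis by simp
  qed
  have b0: "b n \<ge> 0" for n by (simp add: b_def)
  have rr: "0 < rad i * rad j" "rad i * rad j < 1" for i j
    using rad[of i] rad[of j] mult_strict_mono[of "rad i" 1 "rad j" 1] by auto
  have part: "(\<Sum>n<N. b n * (rad i * rad j) ^ n) \<le> A i j" for N i j
    using b0 rr[of i j] by (intro sum_le_suminf[OF sums_summable[OF A], unfolded sums_unique[OF A, symmetric]]) (auto intro!: mult_nonneg_nonneg)
  have A1: "A i i \<le> 1" for i
  proof -
    have "A i i \<le> cmod (\<integral>\<zeta>. T i \<zeta> * cnj (T i \<zeta>) \<partial>circle_measure)" unfolding A_def by (rule complex_Re_le_cmod)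
    also have "\<dots> \<le> (\<integral>\<zeta>. cmod (T i \<zeta> * cnj (T i \<zeta>)) \<partial>circle_measure)" by (rule integral_norm_bound)
    also have "\<dots> \<le> (\<integral>\<zeta>. 1 \<partial>circle_measure)"
      using T1 by (intro integral_mono integrable_norm Aint) (auto simp: norm_mult intro!: mult_le_one)
    finally show ?thesis using cm.prob_space by simp
  qed
  have lim: "(\<lambda>i. \<Sum>n<N. b n * (rad i * rad i) ^ n) \<longlonglongrightarrow> (\<Sum>n<N. b n * (1 * 1) ^ n)" for N
    by (intro tendsto_intros rad_LIMSEQ)
  have bs: "(\<Sum>n<N. b n) \<le> 1" for N
  proof -
    have "(\<Sum>n<N. b n * (rad i * rad i) ^ n) \<le> 1" for i
      using part[where N=N and i=i and j=i] A1[of i] by linarith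
    then show ?thesis using LIMSEQ_le_const2[OF lim[of N], of 1] by simp
  qed
  have sb: "summable b"
    using bs b0 by (intro summableI_nonneg_bounded[of b 1]) auto
  define S where "S = suminf b"
  have AS: "A i j \<le> S" for i j
    unfolding S_def sums_unique[OF A]
    using b0 rr[of i j] by (intro suminf_le sums_summable[OF A] sb) (auto intro!: mult_left_le power_le_one)
  \<comment> \<open>The margin e^2 / 16 makes the squared distance smaller than e^2 / 8;
    \<open>L1_le_L2\<close> with parameter e / 2 then yields less than e / 2 + e / 4.\<close>
  obtain N where N: "(\<Sum>n<N. b n) > S - e\<^sup>2 / 16"
    using order_tendstoD(1)[OF summable_LIMSEQ[OF sb], of "S - e\<^sup>2 / 16"] e unfolding S_def
    by (auto simp: eventually_sequentially)
  obtain I where I: "(\<Sum>n<N. b n * (rad I * rad I) ^ n) > S - e\<^sup>2 / 16"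
    using order_tendstoD(1)[OF lim[of N], of "S - e\<^sup>2 / 16"] N by (auto simp: eventually_sequentially)
  have Age: "A i j > S - e\<^sup>2 / 16" if "i \<ge> I" "j \<ge> I" for i j
  proof -
    have "rad I * rad I \<le> rad i * rad j" using rad[of I] rad[of i] rad_mono that by (intro mult_mono) auto
    then have "(\<Sum>n<N. b n * (rad I * rad I) ^ n) \<le> (\<Sum>n<N. b n * (rad i * rad j) ^ n)"
      using b0 rr[of I I] by (intro sum_mono mult_left_mono power_mono) auto
    then show ?thesis using part[where N=N and i=i and j=j] I by linarith
  qed
  have "(\<integral>\<zeta>. cmod (T i \<zeta> - T j \<zeta>) \<partial>circle_measure) < e" if ij: "i \<ge> I" "j \<ge> I" for i j
  proof -
    define g where "g i j \<zeta> = T i \<zeta> * cnj (T j \<zeta>)" for i j \<zeta>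
    have gint: "integrable circle_measure (g i j)" for i j using Aint unfolding g_def .
    have pt: "(cmod (T i \<zeta> - T j \<zeta>))\<^sup>2 = Re (g i i \<zeta>) + Re (g j j \<zeta>) - 2 * Re (g i j \<zeta>)" for \<zeta>
      unfolding g_def cmod_power2 by (simp add: power2_eq_square algebra_simps)
    have "(\<integral>\<zeta>. (cmod (T i \<zeta> - T j \<zeta>))\<^sup>2 \<partial>circle_measure) = A i i + A j j - 2 * A i j"
      unfolding pt A_def g_def[symmetric] using gint by simp
    also have "\<dots> < e\<^sup>2 / 8" using AS[of i i] AS[of j j] Age[OF ij] by linarith
    finally have "(\<integral>\<zeta>. (cmod (T i \<zeta> - T j \<zeta>))\<^sup>2 \<partial>circle_measure) / (e / 2) < (e\<^sup>2 / 8) / (e / 2)"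
      using e by (intro divide_strict_right_mono) auto
    also have "\<dots> = e / 4" using e by (simp add: power2_eq_square)
    finally have 1: "(\<integral>\<zeta>. (cmod (T i \<zeta> - T j \<zeta>))\<^sup>2 \<partial>circle_measure) / (e / 2) < e / 4" .
    have "(\<integral>\<zeta>. cmod (T i \<zeta> - T j \<zeta>) \<partial>circle_measure) \<le> e / 2 + (\<integral>\<zeta>. (cmod (T i \<zeta> - T j \<zeta>))\<^sup>2 \<partial>circle_measure) / (e / 2)"
    proof (rule L1_le_L2[where B=2])
      show "cmod (T i \<zeta> - T j \<zeta>) \<le> 2" for \<zeta>
        using T1[of i \<zeta>] T1[of j \<zeta>] norm_triangle_ineq4[of "T i \<zeta>" "T j \<zeta>"] by linarith
    qed (use e in auto)
    with 1 e show ?thesis by linarith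
  qed
  then show ?thesis by blast
qed

text \<open>A subsequence of dilations converges almost everywhere to some \<phi>, and dominated
  convergence shows that the Poisson integral of \<phi> is \<theta>. The differentiation theorem for
  \<phi> then produces the full non-tangential limits and identifies \<phi> with the boundary
  function.\<close>

theorem fatou_bounded:
  assumes \<theta>: "\<theta> holomorphic_on ball 0 1" and bd: "\<And>z. cmod z < 1 \<Longrightarrow> cmod (\<theta> z) \<le> 1"
  shows fatou_nt_lim: "AE \<zeta> in circle_measure. nt_lim \<theta> \<zeta> (bdry \<theta> \<zeta>)"
    and fatou_bdry_le: "AE \<zeta> in circle_measure. cmod (bdry \<theta> \<zeta>) \<le> 1"
    and fatou_poisson: "\<And>z. cmod z < 1 \<Longrightarrow> cm.P_int (bdry \<theta>) z = \<theta> z"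
proof -
  define \<theta>' where "\<theta>' z = (if cmod z < 1 then \<theta> z else 0)" for z
  have [measurable]: "\<theta>' \<in> borel_measurable borel"
    unfolding \<theta>'_def by (intro borel_measurable_cutoff holomorphic_on_imp_continuous_on \<theta>)
  define T where "T i z = \<theta>' (of_real (rad i) * z)" for i z
  have [measurable]: "T i \<in> borel_measurable borel" for i unfolding T_def by measurable
  have T: "T i z = (if cmod (of_real (rad i) * z) < 1 then \<theta> (of_real (rad i) * z) else 0)" for i z
    by (simp add: T_def \<theta>'_def)
  have T1: "cmod (T i z) \<le> 1" for i z by (auto simp: T bd)
  have Tint: "integrable circle_measure (T i)" for i
    using T1 by (intro integrable_circle_bounded[where B=1]) auto
  obtain \<rho> where \<rho>: "strict_mono \<rho>" "AE \<zeta> in circle_measure. Cauchy (\<lambda>i. T (\<rho> i) \<zeta>)"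
  proof (rule cauchy_L1_AE_cauchy_subseq[of circle_measure T])
    show "\<exists>N. \<forall>i\<ge>N. \<forall>j\<ge>N. (\<integral>\<zeta>. cmod (T i \<zeta> - T j \<zeta>) \<partial>circle_measure) < e" if "e > 0" for e
      by (rule dilation_L1_Cauchy[OF \<theta> bd T _ that]) auto
  qed (use Tint in auto)
  define \<phi> where "\<phi> \<zeta> = lim (\<lambda>i. T (\<rho> i) \<zeta>)" for \<zeta>
  have [measurable]: "\<phi> \<in> borel_measurable borel" unfolding \<phi>_def by (rule borel_measurable_lim_metric) measurable
  have lim: "AE \<zeta> in circle_measure. (\<lambda>i. T (\<rho> i) \<zeta>) \<longlonglongrightarrow> \<phi> \<zeta>"
    using \<rho>(2) by eventually_elim (simp add: \<phi>_def Cauchy_convergent_iff convergent_LIMSEQ_iff)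
  have \<phi>1: "AE \<zeta> in circle_measure. cmod (\<phi> \<zeta>) \<le> 1"
    using lim by eventually_elim (auto intro!: LIMSEQ_le_const2[OF tendsto_norm] T1)
  have \<phi>int: "integrable circle_measure \<phi>" using \<phi>1 by (intro cm.integrable_const_bound[where B=1]) auto
  have PT: "cm.P_int (T i) z = \<theta> (of_real (rad i) * z)" if z: "cmod z < 1" for i z
  proof -
    have "(\<lambda>w. \<theta> (of_real (rad i) * w)) holomorphic_on ball 0 (1 / rad i)"
      using rad[of i] by (intro holomorphic_on_compose_gen[OF _ \<theta>, unfolded o_def] holomorphic_intros)
        (auto simp: norm_mult field_simps)
    moreover have "\<theta> (of_real (rad i) * w) = T i w" if "w \<in> ball 0 (1 / rad i)" for w
      using that rad[of i] by (simp add: T norm_mult field_simps)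
    ultimately have "T i holomorphic_on ball 0 (1 / rad i)"
      by (rule holomorphic_transform)
    moreover have "1 / rad i > 1" using rad[of i] by simp
    ultimately have "cm.P_int (T i) z = T i z" using T1 z by (intro poisson_formula) auto
    moreover have "cmod (of_real (rad i) * z) < 1"
      using rad[of i] z mult_strict_mono[of "rad i" 1 "cmod z" 1] by (auto simp: norm_mult)
    ultimately show ?thesis by (simp add: T)
  qed
  have P\<phi>: "cm.P_int \<phi> z = \<theta> z" if z: "cmod z < 1" for z
  proof (rule LIMSEQ_unique)
    show "(\<lambda>i. cm.P_int (T (\<rho> i)) z) \<longlonglongrightarrow> cm.P_int \<phi> z"
      by (rule P_int_LIMSEQ[OF _ _ lim _ z, where B=1]) (auto simp: T1)
    have "isCont \<theta> z"
      using holomorphic_on_imp_continuous_on[OF \<theta>] z by (simp add: continuous_on_eq_continuous_at)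
    moreover have "(\<lambda>i. of_real (rad (\<rho> i)) * z) \<longlonglongrightarrow> of_real 1 * z"
      by (intro tendsto_intros LIMSEQ_subseq_LIMSEQ[OF rad_LIMSEQ \<rho>(1), unfolded o_def])
    ultimately have "(\<lambda>i. \<theta> (of_real (rad (\<rho> i)) * z)) \<longlonglongrightarrow> \<theta> z"
      by (intro isCont_tendsto_compose[of _ \<theta>]) auto
    then show "(\<lambda>i. cm.P_int (T (\<rho> i)) z) \<longlonglongrightarrow> \<theta> z" by (simp add: PT[OF z])
  qed
  have nt: "AE \<zeta> in circle_measure. nt_lim \<theta> \<zeta> (\<phi> \<zeta>)"
    using cm.poisson_ratio_nt_lim[OF \<phi>int]
    by (subst nt_lim_cong[of \<theta> "cm.ratio \<phi>"]) (auto simp: ratio_circle_measure P\<phi>)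
  have eq: "AE \<zeta> in circle_measure. bdry \<theta> \<zeta> = \<phi> \<zeta>"
    using nt AE_circle_measure_norm by eventually_elim (rule bdry_eq)
  show "AE \<zeta> in circle_measure. nt_lim \<theta> \<zeta> (bdry \<theta> \<zeta>)" using nt eq by eventually_elim simp
  show "AE \<zeta> in circle_measure. cmod (bdry \<theta> \<zeta>) \<le> 1" using \<phi>1 eq by eventually_elim simp
  have [measurable]: "bdry \<theta> \<in> borel_measurable borel"
    by (intro borel_measurable_bdry holomorphic_on_imp_continuous_on \<theta>)
  show "cm.P_int (bdry \<theta>) z = \<theta> z" if "cmod z < 1" for z
    unfolding P\<phi>[OF that, symmetric] cm.P_int_def using eq by (intro integral_cong_AE) auto
qed

section \<open>Square-integrable functions and orthogonality to the Hardy space\<close>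

context circle_finite_measure
begin

lemma L2_iff: "f \<in> L2 M \<longleftrightarrow> f \<in> borel_measurable borel \<and> integrable M (\<lambda>x. (cmod (f x))\<^sup>2)"
  by (simp add: L2_def measurable_cong_sets[OF sets_M refl])

lemma L2_mult_integrable:
  assumes "f \<in> L2 M" "g \<in> L2 M" shows "integrable M (\<lambda>x. f x * g x)"
proof (rule Bochner_Integration.integrable_bound[where f="\<lambda>x. (cmod (f x))\<^sup>2 + (cmod (g x))\<^sup>2"])
  show "AE x in M. norm (f x * g x) \<le> norm ((cmod (f x))\<^sup>2 + (cmod (g x))\<^sup>2)"
  proof (rule AE_I2)
    fix x
    have "2 * (cmod (f x) * cmod (g x)) \<le> (cmod (f x))\<^sup>2 + (cmod (g x))\<^sup>2"
      using zero_le_power2[of "cmod (f x) - cmod (g x)"] by (simp add: power2_diff)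
    moreover have "0 \<le> cmod (f x) * cmod (g x)" by simp
    ultimately show "norm (f x * g x) \<le> norm ((cmod (f x))\<^sup>2 + (cmod (g x))\<^sup>2)"
      unfolding norm_mult real_norm_def by linarith
  qed
qed (use assms in \<open>auto simp: L2_iff\<close>)

lemma L2_bounded:
  assumes "f \<in> borel_measurable borel" "AE x in M. cmod (f x) \<le> B" shows "f \<in> L2 M"
proof -
  have "AE x in M. norm ((cmod (f x))\<^sup>2) \<le> B\<^sup>2"
    using assms(2) by eventually_elim (auto intro: power_mono)
  then have "integrable M (\<lambda>x. (cmod (f x))\<^sup>2)" using assms(1) by (intro integrable_const_bound) auto
  then show ?thesis using assms by (simp add: L2_iff)
qed

lemma L2_integrable:
  assumes "f \<in> L2 M" shows "integrable M f"
proof -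
  have "(\<lambda>_. 1) \<in> L2 M" by (rule L2_bounded[where B=1]) auto
  from L2_mult_integrable[OF assms this] show ?thesis by simp
qed

lemma L2_cnj: "f \<in> L2 M \<Longrightarrow> (\<lambda>x. cnj (f x)) \<in> L2 M"
  by (auto simp: L2_iff)

lemma L2_add:
  assumes "f \<in> L2 M" "g \<in> L2 M" shows "(\<lambda>x. f x + g x) \<in> L2 M"
proof -
  have [measurable]: "f \<in> borel_measurable borel" "g \<in> borel_measurable borel" using assms by (auto simp: L2_iff)
  have "integrable M (\<lambda>x. (cmod (f x + g x))\<^sup>2)"
  proof (rule Bochner_Integration.integrable_bound[where f="\<lambda>x. 2 * (cmod (f x))\<^sup>2 + 2 * (cmod (g x))\<^sup>2"])
    show "AE x in M. norm ((cmod (f x + g x))\<^sup>2) \<le> norm (2 * (cmod (f x))\<^sup>2 + 2 * (cmod (g x))\<^sup>2)"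
    proof (rule AE_I2)
      fix x
      have "(cmod (f x + g x))\<^sup>2 \<le> (cmod (f x) + cmod (g x))\<^sup>2" by (intro power_mono norm_triangle_ineq) auto
      also have "\<dots> \<le> 2 * (cmod (f x))\<^sup>2 + 2 * (cmod (g x))\<^sup>2"
        using zero_le_power2[of "cmod (f x) - cmod (g x)"] by (simp add: power2_diff power2_sum)
      finally show "norm ((cmod (f x + g x))\<^sup>2) \<le> norm (2 * (cmod (f x))\<^sup>2 + 2 * (cmod (g x))\<^sup>2)" by simp
    qed
  qed (use assms in \<open>auto simp: L2_iff\<close>)
  then show ?thesis using assms by (simp add: L2_iff)
qed

lemma L2_bounded_mult:
  assumes "g \<in> borel_measurable borel" "AE x in M. cmod (g x) \<le> B" "f \<in> L2 M"
  shows "(\<lambda>x. g x * f x) \<in> L2 M"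
proof -
  have [measurable]: "f \<in> borel_measurable borel" "g \<in> borel_measurable borel" using assms by (auto simp: L2_iff)
  have "integrable M (\<lambda>x. (cmod (g x * f x))\<^sup>2)"
  proof (rule Bochner_Integration.integrable_bound[where f="\<lambda>x. B\<^sup>2 * (cmod (f x))\<^sup>2"])
    show "AE x in M. norm ((cmod (g x * f x))\<^sup>2) \<le> norm (B\<^sup>2 * (cmod (f x))\<^sup>2)"
      using assms(2) by eventually_elim (auto simp: norm_mult power_mult_distrib intro!: mult_right_mono power_mono)
  qed (use assms in \<open>auto simp: L2_iff\<close>)
  then show ?thesis using assms by (simp add: L2_iff)
qed

lemma L2_cmult: "f \<in> L2 M \<Longrightarrow> (\<lambda>x. a * f x) \<in> L2 M"
  using L2_bounded_mult[of "\<lambda>_. a" "cmod a" f] by simp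

end

lemma H2_L2: "h \<in> H2 \<Longrightarrow> h \<in> L2 circle_measure"
  by (simp add: H2_def)

text \<open>Each dilation of \<open>q\<close> is a power series whose terms, multiplied by \<zeta>,
  are annihilated by \<open>h\<close>; dominated convergence passes to the boundary. The bound is
  required only in an annulus, so difference quotients with a removable singularity inside
  qualify.\<close>

lemma H2_boundary_orth:
  assumes q: "q holomorphic_on ball 0 1"
    and bd: "\<rho> < 1" "\<And>z. \<rho> < cmod z \<Longrightarrow> cmod z < 1 \<Longrightarrow> cmod (q z) \<le> C"
    and [measurable]: "Q \<in> borel_measurable borel"
    and lim: "AE \<zeta> in circle_measure. (\<lambda>n. q (of_real (rad n) * \<zeta>)) \<longlonglongrightarrow> Q \<zeta>"
    and h: "h \<in> H2"
  shows "(\<integral>\<zeta>. \<zeta> * Q \<zeta> * h \<zeta> \<partial>circle_measure) = 0"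
proof -
  have hint: "integrable circle_measure h" using cm.L2_integrable H2_L2[OF h] .
  have [measurable]: "h \<in> borel_measurable borel" using H2_L2[OF h] cm.L2_iff by auto
  define q' where "q' z = (if cmod z < 1 then q z else 0)" for z
  have [measurable]: "q' \<in> borel_measurable borel"
    unfolding q'_def by (intro borel_measurable_cutoff holomorphic_on_imp_continuous_on q)
  define T where "T i z = q' (of_real (rad i) * z)" for i z
  have [measurable]: "T i \<in> borel_measurable borel" for i unfolding T_def by measurable
  have z: "(\<integral>\<zeta>. T i \<zeta> * (\<zeta> * h \<zeta>) \<partial>circle_measure) = 0" for i
  proof -
    define a where "a n = (deriv ^^ n) q 0 / fact n" for n
    have ser: "(\<lambda>n. (a n * of_real (rad i) ^ n) * w ^ n) sums T i w" if "cmod w < 1 / rad i" for w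
    proof -
      have "cmod (of_real (rad i) * w) < 1" using that rad[of i] by (simp add: norm_mult field_simps)
      then show ?thesis using holomorphic_imp_sums[OF q, of "of_real (rad i) * w"]
        by (simp add: T_def q'_def a_def power_mult_distrib mult_ac)
    qed
    have "integrable circle_measure (\<lambda>\<zeta>. \<zeta> * h \<zeta>)"
      using cm.integrable_mult_bounded[OF hint, of "\<lambda>\<zeta>. \<zeta>" 1] by (simp add: mult.commute)
    from power_series_integral[OF ser _ _ this]
    have "(\<lambda>n. a n * of_real (rad i) ^ n * (\<integral>\<zeta>. \<zeta> ^ n * (\<zeta> * h \<zeta>) \<partial>circle_measure)) sums (\<integral>\<zeta>. T i \<zeta> * (\<zeta> * h \<zeta>) \<partial>circle_measure)"
      using rad[of i] by simp
    moreover have "(\<integral>\<zeta>. \<zeta> ^ n * (\<zeta> * h \<zeta>) \<partial>circle_measure) = 0" for n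
    proof -
      have "(\<integral>\<zeta>. h \<zeta> * \<zeta> ^ Suc n \<partial>circle_measure) = 0" using h unfolding H2_def by auto
      then show ?thesis by (simp add: mult_ac)
    qed
    ultimately have "(\<lambda>n. 0) sums (\<integral>\<zeta>. T i \<zeta> * (\<zeta> * h \<zeta>) \<partial>circle_measure)" by simp
    then show ?thesis using sums_unique2[OF sums_zero] by metis
  qed
  \<comment> \<open>From this index on the dilated circle lies in the annulus where \<open>C\<close>
    bounds \<open>q\<close>.\<close>
  obtain N where N: "rad N > \<rho>" using order_tendstoD(1)[OF rad_LIMSEQ bd(1)] by (auto simp: eventually_sequentially)
  have "(\<lambda>i. \<integral>\<zeta>. T (i + N) \<zeta> * (\<zeta> * h \<zeta>) \<partial>circle_measure) \<longlonglongrightarrow> (\<integral>\<zeta>. Q \<zeta> * (\<zeta> * h \<zeta>) \<partial>circle_measure)"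
  proof (rule integral_dominated_convergence[where w="\<lambda>\<zeta>. C * cmod (h \<zeta>)"])
    show "AE \<zeta> in circle_measure. (\<lambda>i. T (i + N) \<zeta> * (\<zeta> * h \<zeta>)) \<longlonglongrightarrow> Q \<zeta> * (\<zeta> * h \<zeta>)"
      using lim AE_circle_measure_norm
    proof eventually_elim
      case (elim \<zeta>)
      have "T i \<zeta> = q (of_real (rad i) * \<zeta>)" for i using elim(2) rad[of i] by (simp add: T_def q'_def norm_mult)
      then have "(\<lambda>i. T (i + N) \<zeta>) \<longlonglongrightarrow> Q \<zeta>" using elim(1) LIMSEQ_ignore_initial_segment by simp
      then show ?case by (intro tendsto_intros)
    qed
    show "AE \<zeta> in circle_measure. norm (T (i + N) \<zeta> * (\<zeta> * h \<zeta>)) \<le> C * cmod (h \<zeta>)" for i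
      using AE_circle_measure_norm
    proof eventually_elim
      case (elim \<zeta>)
      have "rad (i + N) > \<rho>" using N rad_mono[of N "i + N"] by simp
      then have "cmod (T (i + N) \<zeta>) \<le> C" using elim rad[of "i + N"] by (auto simp: T_def q'_def norm_mult intro!: bd)
      then show ?case using elim by (simp add: norm_mult mult_right_mono)
    qed
  qed (use hint in auto)
  then have "(\<integral>\<zeta>. Q \<zeta> * (\<zeta> * h \<zeta>) \<partial>circle_measure) = 0" by (simp add: z LIMSEQ_const_iff)
  then show ?thesis by (simp add: mult_ac)
qed

section \<open>Cauchy integrals and the characteristic function\<close>

context circle_finite_measure
begin

definition cauchy_int :: "(complex \<Rightarrow> complex) \<Rightarrow> complex \<Rightarrow> complex" where
  "cauchy_int f z = (\<integral>\<xi>. f \<xi> / (1 - cnj \<xi> * z) \<partial>M)"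

lemma inverse_kernel_bound:
  assumes "cmod z < 1" "cmod \<xi> = 1"
  shows "cmod (1 / (1 - cnj \<xi> * z)) \<le> 1 / (1 - cmod z)" "cmod (1 / (1 - \<xi> * z)) \<le> 1 / (1 - cmod z)"
  using norm_one_minus_ge[of z "cnj \<xi>"] norm_one_minus_ge[of z "\<xi>"] assms by (simp_all add: norm_divide frac_le)

lemma integrable_cauchy:
  assumes "integrable M f" "cmod z < 1"
  shows "integrable M (\<lambda>\<xi>. f \<xi> / (1 - cnj \<xi> * z))"
  using integrable_mult_bounded[OF assms(1), of "\<lambda>\<xi>. 1 / (1 - cnj \<xi> * z)" "1 / (1 - cmod z)"]
    inverse_kernel_bound(1)[OF assms(2)] by simp

lemma cauchy_int_holomorphic:
  assumes f: "integrable M f"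
  shows "cauchy_int f holomorphic_on ball 0 1"
proof (rule power_series_holomorphic)
  fix w :: complex assume "w \<in> ball 0 1"
  then have w: "cmod w < 1" by simp
  have int: "integrable M (\<lambda>\<xi>. f \<xi> * (cnj \<xi> * w) ^ n)" for n
    using w by (intro integrable_mult_bounded[OF f, where B=1]) (auto simp: norm_mult norm_power intro!: power_le_one)
  have "(\<lambda>n. \<integral>\<xi>. f \<xi> * (cnj \<xi> * w) ^ n \<partial>M) sums (\<integral>\<xi>. (\<Sum>n. f \<xi> * (cnj \<xi> * w) ^ n) \<partial>M)"
  proof (rule sums_integral[OF int])
    show "AE \<xi> in M. summable (\<lambda>n. norm (f \<xi> * (cnj \<xi> * w) ^ n))"
      using on_circle by eventually_elim (simp add: norm_mult norm_power w summable_geometric)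
    have "(\<integral>\<xi>. norm (f \<xi> * (cnj \<xi> * w) ^ n) \<partial>M) = (\<integral>\<xi>. norm (f \<xi>) * cmod w ^ n \<partial>M)" for n
      using on_circle borel_measurable_integrable[OF f] by (intro integral_cong_AE) (auto simp: norm_mult norm_power)
    then show "summable (\<lambda>n. \<integral>\<xi>. norm (f \<xi> * (cnj \<xi> * w) ^ n) \<partial>M)"
      by (simp add: w summable_geometric summable_mult)
  qed
  also have "(\<integral>\<xi>. (\<Sum>n. f \<xi> * (cnj \<xi> * w) ^ n) \<partial>M) = cauchy_int f w"
    unfolding cauchy_int_def
  proof (intro integral_cong_AE)
    have [measurable]: "f \<in> borel_measurable borel" using borel_measurable_integrable[OF f] by simp
    show "AE \<xi> in M. (\<Sum>n. f \<xi> * (cnj \<xi> * w) ^ n) = f \<xi> / (1 - cnj \<xi> * w)"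
      using on_circle
    proof eventually_elim
      case (elim \<xi>)
      then have "cmod (cnj \<xi> * w) < 1" using w by (simp add: norm_mult)
      from sums_mult[OF geometric_sums[OF this], of "f \<xi>"] show ?case by (simp add: sums_iff)
    qed
  qed (use f in measurable)
  finally show "(\<lambda>n. (\<integral>\<xi>. f \<xi> * cnj \<xi> ^ n \<partial>M) * (w - 0) ^ n) sums cauchy_int f w"
    by (simp add: power_mult_distrib flip: mult.assoc)
qed

text \<open>The antianalytic part of the kernel is a conjugated Cauchy kernel minus 1. The
  conjugation falls on \<open>f\<close>, and the subtracted mean prevents the constant term from
  being counted twice.\<close>

lemma P_int_eq_cauchy:
  assumes f: "integrable M f" and z: "cmod z < 1"
  shows "P_int f z = cauchy_int f z + cnj (cauchy_int (\<lambda>\<xi>. cnj (f \<xi>)) z - (\<integral>\<xi>. cnj (f \<xi>) \<partial>M))"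
proof -
  have [measurable]: "f \<in> borel_measurable borel" using borel_measurable_integrable[OF f] by simp
  have cf: "integrable M (\<lambda>\<xi>. cnj (f \<xi>))" using f by simp
  have "P_int f z = (\<integral>\<xi>. f \<xi> / (1 - cnj \<xi> * z) + cnj (cnj (f \<xi>) / (1 - cnj \<xi> * z) - cnj (f \<xi>)) \<partial>M)"
    unfolding P_int_def
  proof (intro integral_cong_AE)
    show "AE \<xi> in M. f \<xi> * complex_of_real (poisson z \<xi>) = f \<xi> / (1 - cnj \<xi> * z) + cnj (cnj (f \<xi>) / (1 - cnj \<xi> * z) - cnj (f \<xi>))"
      using on_circle
    proof eventually_elim
      case (elim \<xi>)
      have "1 - \<xi> * cnj z \<noteq> 0" using one_minus_ne0(2)[of "cnj z" \<xi>] z elim by simp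
      then have e: "\<xi> * cnj z / (1 - \<xi> * cnj z) = 1 / (1 - \<xi> * cnj z) - 1" by (simp add: divide_simps)
      show ?case unfolding poisson_decomp[OF elim z] e by (simp add: algebra_simps)
    qed
  qed auto
  also have "\<dots> = cauchy_int f z + (\<integral>\<xi>. cnj (cnj (f \<xi>) / (1 - cnj \<xi> * z) - cnj (f \<xi>)) \<partial>M)"
    unfolding cauchy_int_def
    by (intro Bochner_Integration.integral_add integrable_cauchy f z integrable_cnj Bochner_Integration.integrable_diff cf)
  also have "(\<integral>\<xi>. cnj (cnj (f \<xi>) / (1 - cnj \<xi> * z) - cnj (f \<xi>)) \<partial>M) = cnj (cauchy_int (\<lambda>\<xi>. cnj (f \<xi>)) z - (\<integral>\<xi>. cnj (f \<xi>) \<partial>M))"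
    unfolding integral_cnj_circle[of M "\<lambda>\<xi>. cnj (f \<xi>) / (1 - cnj \<xi> * z) - cnj (f \<xi>)"] cauchy_int_def
    using integrable_cauchy[OF cf z] cf by simp
  finally show ?thesis .
qed

end

text \<open>Monomials belong to \<open>H2\<close>, so testing \<open>H2_boundary_orth\<close> on
  them gives exactly the vanishing Fourier coefficients required.\<close>

lemma H2_boundary_mem:
  assumes q: "q holomorphic_on ball 0 1"
    and bd: "\<rho> < 1" "\<And>z. \<rho> < cmod z \<Longrightarrow> cmod z < 1 \<Longrightarrow> cmod (q z) \<le> C"
    and Q: "Q \<in> borel_measurable borel"
    and lim: "AE \<zeta> in circle_measure. (\<lambda>n. q (of_real (rad n) * \<zeta>)) \<longlonglongrightarrow> Q \<zeta>"
  shows "Q \<in> H2"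
proof -
  obtain N where N: "rad N > \<rho>" using order_tendstoD(1)[OF rad_LIMSEQ bd(1)] by (auto simp: eventually_sequentially)
  have "AE \<zeta> in circle_measure. cmod (Q \<zeta>) \<le> C"
    using lim AE_circle_measure_norm
  proof eventually_elim
    case (elim \<zeta>)
    have "cmod (q (of_real (rad n) * \<zeta>)) \<le> C" if "n \<ge> N" for n
      using rad[of n] elim(2) N rad_mono[OF that] by (intro bd) (auto simp: norm_mult)
    then show ?case by (intro LIMSEQ_le_const2[OF tendsto_norm[OF elim(1)]]) auto
  qed
  then have L2: "Q \<in> L2 circle_measure" by (rule cm.L2_bounded[OF Q])
  have pow: "(\<lambda>\<zeta>. \<zeta> ^ m) \<in> H2" for m
  proof -
    have "(\<lambda>\<zeta>::complex. \<zeta> ^ m) \<in> L2 circle_measure"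
      using AE_circle_measure_norm by (intro cm.L2_bounded[where B=1]) (auto elim!: eventually_mono simp: norm_power)
    then show ?thesis by (auto simp: H2_def moment_circle_measure simp flip: power_add)
  qed
  have "(\<integral>\<zeta>. Q \<zeta> * \<zeta> ^ n \<partial>circle_measure) = 0" if n: "n \<ge> 1" for n
  proof -
    obtain m where "n = Suc m" using n by (cases n) auto
    then show ?thesis using H2_boundary_orth[OF q bd Q lim pow[of m]] by (simp add: mult_ac)
  qed
  then show ?thesis using L2 by (simp add: H2_def)
qed

section \<open>The characteristic function in the disc and on its boundary\<close>

locale clark_data = circle_finite_measure \<mu> for \<mu> :: "complex measure" +
  fixes \<gamma> :: complex
  assumes total: "measure \<mu> UNIV = 1" and gamma: "cmod \<gamma> < 1"
begin

definition s :: real where "s = sqrt (1 - (cmod \<gamma>)\<^sup>2)"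

abbreviation F :: "complex \<Rightarrow> complex" where "F \<equiv> R2 \<mu>"

abbreviation \<theta> :: "complex \<Rightarrow> complex" where "\<theta> \<equiv> theta \<mu> \<gamma>"

abbreviation B :: "complex \<Rightarrow> complex" where "B \<equiv> bdry \<theta>"

abbreviation D :: "complex \<Rightarrow> complex" where "D \<equiv> Delta \<theta>"

definition num :: "complex \<Rightarrow> complex" where "num z = (1 - \<gamma>) * F z - (1 + \<gamma>)"

definition den :: "complex \<Rightarrow> complex" where "den z = (1 - cnj \<gamma>) * F z + (1 + cnj \<gamma>)"

definition N :: "complex \<Rightarrow> complex" where "N z = 2 * of_real s / den z"

lemma theta_eq: "\<theta> z = num z / den z"
  by (simp add: theta_def num_def den_def)

lemma s_pos: "s > 0" and s_sq: "s\<^sup>2 = 1 - (cmod \<gamma>)\<^sup>2"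
  using gamma by (simp_all add: s_def abs_square_less_1 abs_square_le_1)

lemma F_eq: "cmod z < 1 \<Longrightarrow> F z = 2 * cauchy_int (\<lambda>_. 1) z - 1"
proof -
  assume z: "cmod z < 1"
  have "F z = (\<integral>\<xi>. 2 * (1 / (1 - cnj \<xi> * z)) - 1 \<partial>\<mu>)"
    unfolding R2_def
  proof (intro integral_cong_AE)
    show "AE \<xi> in \<mu>. (1 + cnj \<xi> * z) / (1 - cnj \<xi> * z) = 2 * (1 / (1 - cnj \<xi> * z)) - 1"
      using on_circle
    proof eventually_elim
      case (elim \<xi>)
      have "1 - cnj \<xi> * z \<noteq> 0" using one_minus_ne0(2)[of z "cnj \<xi>"] z elim by simp
      then show ?case by (simp add: divide_simps)
    qed
  qed auto
  also have "\<dots> = 2 * cauchy_int (\<lambda>_. 1) z - 1"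
    using integrable_cauchy[of "\<lambda>_. 1" z] z total unfolding cauchy_int_def by (simp del: times_divide_eq_right)
  finally show ?thesis .
qed

lemma F_holomorphic: "F holomorphic_on ball 0 1"
proof -
  have "(\<lambda>z. 2 * cauchy_int (\<lambda>_. 1) z - 1) holomorphic_on ball 0 1"
    by (intro holomorphic_intros cauchy_int_holomorphic) auto
  then show ?thesis by (rule holomorphic_transform) (simp add: F_eq)
qed

lemma Re_F: "cmod z < 1 \<Longrightarrow> Re (F z) = P_one z"
proof -
  assume z: "cmod z < 1"
  have "complex_of_real (P_one z) = P_int (\<lambda>_. 1) z" unfolding P_one_def P_int_def by simp
  also have "\<dots> = cauchy_int (\<lambda>_. 1) z + cnj (cauchy_int (\<lambda>_. 1) z - 1)"
    using P_int_eq_cauchy[of "\<lambda>_. 1" z] z total by simp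
  finally have "Re (complex_of_real (P_one z)) = Re (cauchy_int (\<lambda>_. 1) z + cnj (cauchy_int (\<lambda>_. 1) z - 1))" by simp
  then show ?thesis by (simp add: F_eq[OF z])
qed

text \<open>From |\<xi> - z| \<le> 2. The bound degenerates at the circle, but it gives strict
  positivity of \<open>Re (F z)\<close> inside.\<close>

lemma P_one_lower: "cmod z < 1 \<Longrightarrow> (1 - (cmod z)\<^sup>2) / 4 \<le> P_one z"
proof -
  assume z: "cmod z < 1"
  have "(\<integral>\<xi>. (1 - (cmod z)\<^sup>2) / 4 \<partial>\<mu>) \<le> P_one z"
    unfolding P_one_def
  proof (intro integral_mono_AE integrable_poisson z)
    show "AE \<xi> in \<mu>. (1 - (cmod z)\<^sup>2) / 4 \<le> poisson z \<xi>"
      using on_circle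
    proof eventually_elim
      case (elim \<xi>)
      have "0 < cmod (\<xi> - z)" using cmod_diff_ge[OF elim, of z] z by linarith
      moreover have "cmod (\<xi> - z) \<le> 2" using norm_triangle_ineq4[of \<xi> z] elim z by linarith
      then have "(cmod (\<xi> - z))\<^sup>2 \<le> 2\<^sup>2" by (intro power_mono) auto
      ultimately show ?case unfolding poisson_def using z
        by (intro divide_left_mono) (auto simp: abs_square_le_1)
    qed
  qed auto
  then show ?thesis using total by simp
qed

lemma P_one_pos': "cmod z < 1 \<Longrightarrow> P_one z > 0"
  by (rule less_le_trans[OF _ P_one_lower]) (auto simp: abs_square_less_1)

text \<open>On expanding, every term except the one in \<open>Re (F z)\<close> cancels. Positivity
  of the right side is the source of both \<open>den_ne0\<close> and
  \<open>theta_lt1\<close>.\<close>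

lemma den_num: "cmod z < 1 \<Longrightarrow> (cmod (den z))\<^sup>2 - (cmod (num z))\<^sup>2 = 4 * s\<^sup>2 * P_one z"
proof -
  assume z: "cmod z < 1"
  obtain a b where F: "F z = Complex a b" by (cases "F z")
  obtain c d where g: "\<gamma> = Complex c d" by (cases \<gamma>)
  have P: "P_one z = a" using Re_F[OF z] F by simp
  show ?thesis unfolding s_sq num_def den_def unfolding F P cmod_power2 unfolding g by (simp; algebra)
qed

lemma den_ne0: "cmod z < 1 \<Longrightarrow> den z \<noteq> 0"
proof
  assume z: "cmod z < 1" and "den z = 0"
  then have "4 * s\<^sup>2 * P_one z = - (cmod (num z))\<^sup>2" using den_num[OF z] by simp
  also have "\<dots> \<le> 0" by simp
  finally have "4 * s\<^sup>2 * P_one z \<le> 0" .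
  moreover have "4 * s\<^sup>2 * P_one z > 0" using P_one_pos'[OF z] s_pos by simp
  ultimately show False by linarith
qed

lemma one_minus_theta_sq: "cmod z < 1 \<Longrightarrow> 1 - (cmod (\<theta> z))\<^sup>2 = (cmod (N z))\<^sup>2 * P_one z"
proof -
  assume z: "cmod z < 1"
  have "(cmod (den z))\<^sup>2 > 0" using den_ne0[OF z] by simp
  then have "1 - (cmod (\<theta> z))\<^sup>2 = ((cmod (den z))\<^sup>2 - (cmod (num z))\<^sup>2) / (cmod (den z))\<^sup>2"
    by (simp add: theta_eq norm_divide power_divide diff_divide_distrib)
  also have "\<dots> = (cmod (N z))\<^sup>2 * P_one z"
    unfolding den_num[OF z] using s_pos by (simp add: N_def norm_divide norm_mult power_divide power_mult_distrib)
  finally show ?thesis .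
qed

lemma N_ne0: "cmod z < 1 \<Longrightarrow> N z \<noteq> 0"
  using den_ne0 s_pos by (simp add: N_def)

lemma theta_lt1: "cmod z < 1 \<Longrightarrow> cmod (\<theta> z) < 1"
proof -
  assume z: "cmod z < 1"
  have "1 - (cmod (\<theta> z))\<^sup>2 > 0" unfolding one_minus_theta_sq[OF z] using N_ne0[OF z] P_one_pos'[OF z] by simp
  then show ?thesis using abs_square_less_1[of "cmod (\<theta> z)"] by simp
qed

lemma theta_holomorphic: "\<theta> holomorphic_on ball 0 1"
proof -
  have "(\<lambda>z. num z / den z) holomorphic_on ball 0 1"
    unfolding num_def den_def using den_ne0
    by (intro holomorphic_intros F_holomorphic) (auto simp: den_def)
  then show ?thesis by (rule holomorphic_transform) (simp add: theta_eq)
qed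

lemma N_holomorphic: "N holomorphic_on ball 0 1"
  unfolding N_def den_def using den_ne0
  by (intro holomorphic_intros F_holomorphic) (auto simp: den_def)

lemma theta_0: "\<theta> 0 = - \<gamma>"
proof -
  have "F 0 = 1" unfolding R2_def using total by simp
  then show ?thesis by (simp add: theta_def)
qed

lemma continuous_theta: "continuous_on (ball 0 1) \<theta>"
  using theta_holomorphic by (rule holomorphic_on_imp_continuous_on)

lemma B_measurable [measurable]: "B \<in> borel_measurable borel"
  using continuous_theta by (rule borel_measurable_bdry)

lemma D_measurable [measurable]: "D \<in> borel_measurable borel"
  unfolding Delta_def by measurable

lemma B_nt_lim: "AE \<zeta> in circle_measure. nt_lim \<theta> \<zeta> (B \<zeta>)"
  using theta_lt1 by (intro fatou_nt_lim theta_holomorphic less_imp_le)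

lemma B_le: "AE \<zeta> in circle_measure. cmod (B \<zeta>) \<le> 1"
  using theta_lt1 by (intro fatou_bdry_le theta_holomorphic less_imp_le)

lemma B_poisson: "cmod z < 1 \<Longrightarrow> cm.P_int B z = \<theta> z"
  using theta_lt1 by (intro fatou_poisson theta_holomorphic less_imp_le)

lemma B_radial: "AE \<zeta> in circle_measure. (\<lambda>n. \<theta> (of_real (rad n) * \<zeta>)) \<longlonglongrightarrow> B \<zeta>"
  using B_nt_lim AE_circle_measure_norm by eventually_elim (rule nt_lim_radial)

lemma cnj_D: "cnj (D \<zeta>) = D \<zeta>"
  by (simp add: Delta_def)

lemma D_sq: "cmod (B \<zeta>) \<le> 1 \<Longrightarrow> D \<zeta> * D \<zeta> = 1 - B \<zeta> * cnj (B \<zeta>)"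
proof -
  assume "cmod (B \<zeta>) \<le> 1"
  then have "0 \<le> 1 - (cmod (B \<zeta>))\<^sup>2" by (simp add: abs_square_le_1)
  then have "D \<zeta> * D \<zeta> = of_real (1 - (cmod (B \<zeta>))\<^sup>2)"
    unfolding Delta_def by (simp del: of_real_diff flip: of_real_mult)
  then show ?thesis by (simp flip: complex_norm_square)
qed

lemma D_le: "AE \<zeta> in circle_measure. cmod (D \<zeta>) \<le> 1"
  using B_le
proof eventually_elim
  case (elim \<zeta>)
  then have "0 \<le> 1 - (cmod (B \<zeta>))\<^sup>2" by (simp add: abs_square_le_1)
  then show ?case by (auto simp: Delta_def)
qed

end

section \<open>Vectors in the model space\<close>

lemma H2_lincomb:
  assumes "h \<in> H2" "h' \<in> H2" shows "(\<lambda>\<zeta>. a * h \<zeta> + h' \<zeta>) \<in> H2"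
proof -
  have L: "h \<in> L2 circle_measure" "h' \<in> L2 circle_measure" using assms H2_L2 by auto
  have "(\<integral>\<zeta>. (a * h \<zeta> + h' \<zeta>) * \<zeta> ^ n \<partial>circle_measure) = 0" if n: "n \<ge> 1" for n
  proof -
    have i: "integrable circle_measure (\<lambda>\<zeta>. f \<zeta> * \<zeta> ^ n)" if "f \<in> L2 circle_measure" for f
      using that by (intro cm.integrable_mult_bounded[OF cm.L2_integrable, where B=1]) (auto simp: norm_power)
    have "(\<integral>\<zeta>. (a * h \<zeta> + h' \<zeta>) * \<zeta> ^ n \<partial>circle_measure) = (\<integral>\<zeta>. a * (h \<zeta> * \<zeta> ^ n) + h' \<zeta> * \<zeta> ^ n \<partial>circle_measure)"
      by (simp add: algebra_simps)
    also have "\<dots> = a * (\<integral>\<zeta>. h \<zeta> * \<zeta> ^ n \<partial>circle_measure) + (\<integral>\<zeta>. h' \<zeta> * \<zeta> ^ n \<partial>circle_measure)"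
      using i[OF L(1)] i[OF L(2)] by simp
    also have "\<dots> = 0" using assms n by (simp add: H2_def)
    finally show ?thesis .
  qed
  moreover have "(\<lambda>\<zeta>. a * h \<zeta> + h' \<zeta>) \<in> L2 circle_measure" by (intro cm.L2_add cm.L2_cmult L)
  ultimately show ?thesis by (simp add: H2_def)
qed

text \<open>Boundedness is asked on the circle only, because resolvents 1 / (\<zeta> - l) have a
  pole inside the disc.\<close>

definition bdd_circle :: "(complex \<Rightarrow> complex) \<Rightarrow> bool" where
  "bdd_circle p \<longleftrightarrow> p \<in> borel_measurable borel \<and> (\<exists>C. \<forall>\<zeta>. cmod \<zeta> = 1 \<longrightarrow> cmod (p \<zeta>) \<le> C)"

lemma bdd_circle_measurable: "bdd_circle p \<Longrightarrow> p \<in> borel_measurable borel"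
  by (simp add: bdd_circle_def)

lemma (in circle_finite_measure) bdd_circle_L2: "bdd_circle p \<Longrightarrow> p \<in> L2 M"
proof -
  assume "bdd_circle p"
  then obtain C where C: "\<And>\<zeta>. cmod \<zeta> = 1 \<Longrightarrow> cmod (p \<zeta>) \<le> C" and p: "p \<in> borel_measurable borel"
    by (auto simp: bdd_circle_def)
  have "AE \<zeta> in M. cmod (p \<zeta>) \<le> C" using on_circle by eventually_elim (rule C)
  then show ?thesis by (rule L2_bounded[OF p])
qed

lemma bdd_circle_lincomb:
  assumes "bdd_circle p" "bdd_circle q" shows "bdd_circle (\<lambda>\<zeta>. a * p \<zeta> + q \<zeta>)"
proof -
  obtain C C' where C: "\<And>\<zeta>. cmod \<zeta> = 1 \<Longrightarrow> cmod (p \<zeta>) \<le> C" "\<And>\<zeta>. cmod \<zeta> = 1 \<Longrightarrow> cmod (q \<zeta>) \<le> C'"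
    using assms by (auto simp: bdd_circle_def)
  have "cmod (a * p \<zeta> + q \<zeta>) \<le> cmod a * C + C'" if "cmod \<zeta> = 1" for \<zeta>
    using norm_triangle_ineq[of "a * p \<zeta>" "q \<zeta>"] C[OF that] mult_left_mono[OF C(1)[OF that], of "cmod a"]
    by (simp add: norm_mult)
  then show ?thesis using assms unfolding bdd_circle_def by auto
qed

lemma bdd_circle_const: "bdd_circle (\<lambda>_. c)"
  by (auto simp: bdd_circle_def)

lemma bdd_circle_cmult: "bdd_circle p \<Longrightarrow> bdd_circle (\<lambda>\<zeta>. a * p \<zeta>)"
  using bdd_circle_lincomb[OF _ bdd_circle_const[of 0], of p a] by simp

definition szego :: "complex \<Rightarrow> complex \<Rightarrow> complex" where
  "szego l \<zeta> = 1 / (1 - cnj l * \<zeta>)"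

lemma bdd_szego: "cmod l < 1 \<Longrightarrow> bdd_circle (szego l)"
  unfolding bdd_circle_def szego_def
  using cm.inverse_kernel_bound(2)[of "cnj l"] by (auto simp: mult.commute)

lemma bdd_resolvent: "cmod l < 1 \<Longrightarrow> bdd_circle (\<lambda>\<zeta>. 1 / (\<zeta> - l))"
  unfolding bdd_circle_def using cmod_diff_ge[of _ l]
  by (auto intro!: exI[of _ "1 / (1 - cmod l)"] frac_le simp: norm_divide)

text \<open>Conjugation on the circle exchanges Szego kernels and resolvents up to the factor
  \<zeta>. This is the symmetry between the two families of reproducing vectors.\<close>

lemma cnj_resolvent: "cmod \<zeta> = 1 \<Longrightarrow> cmod l < 1 \<Longrightarrow> cnj (1 / (\<zeta> - l)) = \<zeta> * szego l \<zeta>"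
  and cnj_szego: "cmod \<zeta> = 1 \<Longrightarrow> cmod l < 1 \<Longrightarrow> cnj (szego l \<zeta>) = \<zeta> * (1 / (\<zeta> - l))"
proof -
  assume \<zeta>: "cmod \<zeta> = 1" and l: "cmod l < 1"
  have nz: "\<zeta> \<noteq> 0" "\<zeta> - l \<noteq> 0" "cnj \<zeta> - cnj l \<noteq> 0" "1 - cnj l * \<zeta> \<noteq> 0" "1 - l * cnj \<zeta> \<noteq> 0"
    using \<zeta> l one_minus_ne0(1)[of "cnj l" \<zeta>] one_minus_ne0(1)[of "l" "cnj \<zeta>"] by (auto simp flip: complex_cnj_diff)
  have 1: "\<zeta> * cnj \<zeta> = 1" using \<zeta> by (simp flip: complex_norm_square)
  have "\<zeta> * (cnj \<zeta> - cnj l) = 1 - cnj l * \<zeta>" using 1 by (simp add: algebra_simps)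
  then show "cnj (1 / (\<zeta> - l)) = \<zeta> * szego l \<zeta>"
    unfolding szego_def using nz by (simp add: divide_simps)
  have "\<zeta> * (1 - l * cnj \<zeta>) = \<zeta> - l" using 1 by (simp add: algebra_simps)
  then show "cnj (szego l \<zeta>) = \<zeta> * (1 / (\<zeta> - l))"
    unfolding szego_def using nz by (simp add: divide_simps)
qed

lemma szego_H2: "cmod l < 1 \<Longrightarrow> szego l \<in> H2"
  and szego_orth: "cmod l < 1 \<Longrightarrow> h \<in> H2 \<Longrightarrow> (\<integral>\<zeta>. \<zeta> * szego l \<zeta> * h \<zeta> \<partial>circle_measure) = 0"
proof -
  assume l: "cmod l < 1"
  have nz: "1 - cnj l * z \<noteq> 0" if "cmod z \<le> 1" for z using one_minus_ne0(1)[of "cnj l" z] l that by simp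
  have hol: "szego l holomorphic_on ball 0 1"
    unfolding szego_def using nz by (intro holomorphic_intros) auto
  have bd: "cmod (szego l z) \<le> 1 / (1 - cmod l)" if "0 < cmod z" "cmod z < 1" for z
  proof -
    have "cmod (cnj l * z) \<le> cmod l" using that by (simp add: norm_mult mult_left_le)
    then have "1 - cmod l \<le> cmod (1 - cnj l * z)" using norm_triangle_ineq2[of 1 "cnj l * z"] by simp
    then show ?thesis using l by (simp add: szego_def norm_divide frac_le)
  qed
  have lim: "AE \<zeta> in circle_measure. (\<lambda>n. szego l (of_real (rad n) * \<zeta>)) \<longlonglongrightarrow> szego l \<zeta>"
    using AE_circle_measure_norm
  proof eventually_elim
    case (elim \<zeta>)
    have "(\<lambda>n. 1 / (1 - cnj l * (of_real (rad n) * \<zeta>))) \<longlonglongrightarrow> 1 / (1 - cnj l * (of_real 1 * \<zeta>))"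
      using nz[of \<zeta>] elim by (intro tendsto_intros rad_LIMSEQ) auto
    then show ?case by (simp add: szego_def)
  qed
  have m: "szego l \<in> borel_measurable borel" using bdd_szego[OF l] by (rule bdd_circle_measurable)
  show "szego l \<in> H2" by (rule H2_boundary_mem[OF hol zero_less_one bd m lim])
  show "(\<integral>\<zeta>. \<zeta> * szego l \<zeta> * h \<zeta> \<partial>circle_measure) = 0" if "h \<in> H2"
    by (rule H2_boundary_orth[OF hol zero_less_one bd m lim that])
qed

context clark_data
begin

lemma B_mult_L2: "f \<in> L2 circle_measure \<Longrightarrow> (\<lambda>\<zeta>. B \<zeta> * f \<zeta>) \<in> L2 circle_measure"
  by (rule cm.L2_bounded_mult[OF B_measurable B_le])

lemma D_mult_L2: "f \<in> L2 circle_measure \<Longrightarrow> (\<lambda>\<zeta>. D \<zeta> * f \<zeta>) \<in> L2 circle_measure"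
  by (rule cm.L2_bounded_mult[OF D_measurable D_le])

text \<open>The vector (p, 0) + q (\<theta>, \<Delta>). Both families of reproducing vectors and the
  normalised \<open>cvec\<close> have this shape, so membership and projection turn into conditions
  on \<open>p\<close> and \<open>q\<close>.\<close>

definition vec :: "cfun \<Rightarrow> cfun \<Rightarrow> cfun \<times> cfun" where
  "vec p q = (\<lambda>\<zeta>. p \<zeta> + q \<zeta> * B \<zeta>, \<lambda>\<zeta>. q \<zeta> * D \<zeta>)"

text \<open>The integral condition says that \<open>vec p q\<close> is orthogonal to all \<open>(\<theta> h, \<Delta> h)\<close>, since \<open>\<bar>\<theta>\<bar>\<^sup>2 + \<Delta>\<^sup>2 = 1\<close>
  almost everywhere on the circle.\<close>
definition adm :: "cfun \<Rightarrow> cfun \<Rightarrow> bool" where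
  "adm p q \<longleftrightarrow> bdd_circle p \<and> bdd_circle q \<and> (\<lambda>\<zeta>. p \<zeta> + q \<zeta> * B \<zeta>) \<in> H2 \<and>
     (\<forall>h\<in>H2. (\<integral>\<zeta>. (cnj (p \<zeta>) * B \<zeta> + cnj (q \<zeta>)) * h \<zeta> \<partial>circle_measure) = 0)"

lemma vec_L2:
  assumes "bdd_circle p" "bdd_circle q"
  shows "fst (vec p q) \<in> L2 circle_measure" "snd (vec p q) \<in> L2 circle_measure"
proof -
  have "p \<in> L2 circle_measure" "q \<in> L2 circle_measure" using assms cm.bdd_circle_L2 by auto
  then show "fst (vec p q) \<in> L2 circle_measure" "snd (vec p q) \<in> L2 circle_measure"
    using cm.L2_add[OF _ B_mult_L2, of p q] D_mult_L2[of q] by (simp_all add: vec_def mult.commute)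
qed

lemma adm_in_Kspace:
  assumes a: "adm p q" shows "vec p q \<in> Kspace \<theta>"
proof -
  have pq: "bdd_circle p" "bdd_circle q" using a by (auto simp: adm_def)
  have [measurable]: "p \<in> borel_measurable borel" "q \<in> borel_measurable borel" using pq bdd_circle_measurable by auto
  have qL: "q \<in> L2 circle_measure" using pq cm.bdd_circle_L2 by auto
  have "snd (vec p q) \<in> closDL2 D"
    unfolding closDL2_def using vec_L2[OF pq] qL by (auto simp: vec_def mult.commute intro!: bexI[of _ q])
  moreover have "ipK (vec p q) (\<lambda>\<zeta>. B \<zeta> * h \<zeta>, \<lambda>\<zeta>. D \<zeta> * h \<zeta>) = 0" if h: "h \<in> H2" for h
  proof -
    have hL: "h \<in> L2 circle_measure" using h by (rule H2_L2)
    have [measurable]: "h \<in> borel_measurable borel" using hL cm.L2_iff by auto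
    have i1: "integrable circle_measure (\<lambda>\<zeta>. fst (vec p q) \<zeta> * cnj (B \<zeta> * h \<zeta>))"
      by (intro cm.L2_mult_integrable cm.L2_cnj B_mult_L2 hL vec_L2 pq)
    have i2: "integrable circle_measure (\<lambda>\<zeta>. snd (vec p q) \<zeta> * cnj (D \<zeta> * h \<zeta>))"
      by (intro cm.L2_mult_integrable cm.L2_cnj D_mult_L2 hL vec_L2 pq)
    have "ipK (vec p q) (\<lambda>\<zeta>. B \<zeta> * h \<zeta>, \<lambda>\<zeta>. D \<zeta> * h \<zeta>)
      = (\<integral>\<zeta>. fst (vec p q) \<zeta> * cnj (B \<zeta> * h \<zeta>) + snd (vec p q) \<zeta> * cnj (D \<zeta> * h \<zeta>) \<partial>circle_measure)"
      unfolding ipK_def ip_def using i1 i2 by simp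
    also have "\<dots> = (\<integral>\<zeta>. cnj ((cnj (p \<zeta>) * B \<zeta> + cnj (q \<zeta>)) * h \<zeta>) \<partial>circle_measure)"
    proof (intro integral_cong_AE)
      show "AE \<zeta> in circle_measure. fst (vec p q) \<zeta> * cnj (B \<zeta> * h \<zeta>) + snd (vec p q) \<zeta> * cnj (D \<zeta> * h \<zeta>)
          = cnj ((cnj (p \<zeta>) * B \<zeta> + cnj (q \<zeta>)) * h \<zeta>)"
        using B_le
      proof eventually_elim
        case (elim \<zeta>)
        have "fst (vec p q) \<zeta> * cnj (B \<zeta> * h \<zeta>) + snd (vec p q) \<zeta> * cnj (D \<zeta> * h \<zeta>)
          = (p \<zeta> * cnj (B \<zeta>) + q \<zeta> * (B \<zeta> * cnj (B \<zeta>) + D \<zeta> * D \<zeta>)) * cnj (h \<zeta>)"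
          by (simp add: vec_def cnj_D algebra_simps)
        also have "\<dots> = (p \<zeta> * cnj (B \<zeta>) + q \<zeta>) * cnj (h \<zeta>)" by (simp add: D_sq[OF elim])
        finally show ?case by simp
      qed
    qed (auto simp: vec_def)
    also have "\<dots> = 0" unfolding integral_cnj_circle using a h by (simp add: adm_def)
    finally show ?thesis .
  qed
  ultimately show ?thesis using a by (simp add: Kspace_def adm_def vec_def)
qed

lemma adm_lincomb:
  assumes "adm p q" "adm p' q'" shows "adm (\<lambda>\<zeta>. a * p \<zeta> + p' \<zeta>) (\<lambda>\<zeta>. a * q \<zeta> + q' \<zeta>)"
  unfolding adm_def
proof (intro conjI ballI)
  have b: "bdd_circle p" "bdd_circle q" "bdd_circle p'" "bdd_circle q'" using assms by (auto simp: adm_def)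
  show "bdd_circle (\<lambda>\<zeta>. a * p \<zeta> + p' \<zeta>)" "bdd_circle (\<lambda>\<zeta>. a * q \<zeta> + q' \<zeta>)" using b by (auto intro: bdd_circle_lincomb)
  have "(\<lambda>\<zeta>. a * (p \<zeta> + q \<zeta> * B \<zeta>) + (p' \<zeta> + q' \<zeta> * B \<zeta>)) \<in> H2"
    using assms by (intro H2_lincomb) (auto simp: adm_def)
  then show "(\<lambda>\<zeta>. a * p \<zeta> + p' \<zeta> + (a * q \<zeta> + q' \<zeta>) * B \<zeta>) \<in> H2" by (simp add: algebra_simps)
  fix h assume h: "h \<in> H2"
  have hL: "h \<in> L2 circle_measure" using h by (rule H2_L2)
  have i: "integrable circle_measure (\<lambda>\<zeta>. (cnj (p \<zeta>) * B \<zeta> + cnj (q \<zeta>)) * h \<zeta>)"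
    if "bdd_circle p" "bdd_circle q" for p q
  proof -
    have "(\<lambda>\<zeta>. B \<zeta> * cnj (p \<zeta>) + cnj (q \<zeta>)) \<in> L2 circle_measure"
      using that by (intro cm.L2_add B_mult_L2 cm.L2_cnj cm.bdd_circle_L2)
    from cm.L2_mult_integrable[OF this hL] show ?thesis by (simp add: mult.commute)
  qed
  have "(\<integral>\<zeta>. (cnj (a * p \<zeta> + p' \<zeta>) * B \<zeta> + cnj (a * q \<zeta> + q' \<zeta>)) * h \<zeta> \<partial>circle_measure)
     = (\<integral>\<zeta>. cnj a * ((cnj (p \<zeta>) * B \<zeta> + cnj (q \<zeta>)) * h \<zeta>) + (cnj (p' \<zeta>) * B \<zeta> + cnj (q' \<zeta>)) * h \<zeta> \<partial>circle_measure)"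
    by (simp add: algebra_simps)
  also have "\<dots> = cnj a * (\<integral>\<zeta>. (cnj (p \<zeta>) * B \<zeta> + cnj (q \<zeta>)) * h \<zeta> \<partial>circle_measure)
      + (\<integral>\<zeta>. (cnj (p' \<zeta>) * B \<zeta> + cnj (q' \<zeta>)) * h \<zeta> \<partial>circle_measure)"
    using i b by simp
  also have "\<dots> = 0" using assms h by (simp add: adm_def)
  finally show "(\<integral>\<zeta>. (cnj (a * p \<zeta> + p' \<zeta>) * B \<zeta> + cnj (a * q \<zeta> + q' \<zeta>)) * h \<zeta> \<partial>circle_measure) = 0" .
qed

lemma adm_zero: "adm (\<lambda>_. 0) (\<lambda>_. 0)"
  by (simp add: adm_def bdd_circle_const H2_def cm.L2_iff)

lemma adm_cmult: "adm p q \<Longrightarrow> adm (\<lambda>\<zeta>. a * p \<zeta>) (\<lambda>\<zeta>. a * q \<zeta>)"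
  using adm_lincomb[OF _ adm_zero, of p q a] by simp

text \<open>Boundary values of the reproducing kernel of the analytic component at
  \<open>l\<close>.\<close>

definition quot1 :: "complex \<Rightarrow> complex \<Rightarrow> complex" where
  "quot1 l \<zeta> = (1 - cnj (\<theta> l) * B \<zeta>) * szego l \<zeta>"

text \<open>Boundary values of the difference quotient of \<theta> at \<open>l\<close>, the analytic
  component of the conjugate kernel.\<close>

definition quot2 :: "complex \<Rightarrow> complex \<Rightarrow> complex" where
  "quot2 l \<zeta> = (B \<zeta> - \<theta> l) / (\<zeta> - l)"

lemma quot1_H2: "cmod l < 1 \<Longrightarrow> quot1 l \<in> H2"
  and quot1_orth: "cmod l < 1 \<Longrightarrow> h \<in> H2 \<Longrightarrow> (\<integral>\<zeta>. \<zeta> * quot1 l \<zeta> * h \<zeta> \<partial>circle_measure) = 0"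
proof -
  assume l: "cmod l < 1"
  define q where "q z = (1 - cnj (\<theta> l) * \<theta> z) * szego l z" for z
  have nz: "1 - cnj l * z \<noteq> 0" if "cmod z \<le> 1" for z using one_minus_ne0(1)[of "cnj l" z] l that by simp
  have hol: "q holomorphic_on ball 0 1"
    unfolding q_def szego_def using nz by (intro holomorphic_intros theta_holomorphic) auto
  have bd: "cmod (q z) \<le> 2 * (1 / (1 - cmod l))" if "0 < cmod z" "cmod z < 1" for z
  proof -
    have "cmod (cnj l * z) \<le> cmod l" using that by (simp add: norm_mult mult_left_le)
    then have "1 - cmod l \<le> cmod (1 - cnj l * z)" using norm_triangle_ineq2[of 1 "cnj l * z"] by simp
    then have 1: "cmod (szego l z) \<le> 1 / (1 - cmod l)" using l by (simp add: szego_def norm_divide frac_le)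
    have "cmod (cnj (\<theta> l) * \<theta> z) \<le> 1"
      using theta_lt1[OF l] theta_lt1[of z] that unfolding norm_mult by (intro mult_le_one) auto
    then have "cmod (1 - cnj (\<theta> l) * \<theta> z) \<le> 2" using norm_triangle_ineq4[of 1 "cnj (\<theta> l) * \<theta> z"] by simp
    then show ?thesis unfolding q_def norm_mult using 1 by (intro mult_mono) auto
  qed
  have lim: "AE \<zeta> in circle_measure. (\<lambda>n. q (of_real (rad n) * \<zeta>)) \<longlonglongrightarrow> quot1 l \<zeta>"
    using AE_circle_measure_norm B_radial
  proof eventually_elim
    case (elim \<zeta>)
    have "(\<lambda>n. (1 - cnj (\<theta> l) * \<theta> (of_real (rad n) * \<zeta>)) * (1 / (1 - cnj l * (of_real (rad n) * \<zeta>))))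
       \<longlonglongrightarrow> (1 - cnj (\<theta> l) * B \<zeta>) * (1 / (1 - cnj l * (of_real 1 * \<zeta>)))"
      using nz[of \<zeta>] elim by (intro tendsto_intros rad_LIMSEQ) auto
    then show ?case by (simp add: szego_def q_def quot1_def)
  qed
  have [measurable]: "szego l \<in> borel_measurable borel" using bdd_szego[OF l] by (rule bdd_circle_measurable)
  have m: "quot1 l \<in> borel_measurable borel" unfolding quot1_def by measurable
  show "quot1 l \<in> H2" by (rule H2_boundary_mem[OF hol zero_less_one bd m lim])
  show "(\<integral>\<zeta>. \<zeta> * quot1 l \<zeta> * h \<zeta> \<partial>circle_measure) = 0" if "h \<in> H2"
    by (rule H2_boundary_orth[OF hol zero_less_one bd m lim that])
qed

lemma quot2_H2: "cmod l < 1 \<Longrightarrow> quot2 l \<in> H2"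
  and quot2_orth: "cmod l < 1 \<Longrightarrow> h \<in> H2 \<Longrightarrow> (\<integral>\<zeta>. \<zeta> * quot2 l \<zeta> * h \<zeta> \<partial>circle_measure) = 0"
proof -
  assume l: "cmod l < 1"
  define q where "q z = (if z = l then deriv \<theta> l else (\<theta> z - \<theta> l) / (z - l))" for z
  have hol: "q holomorphic_on ball 0 1"
    unfolding q_def using l by (intro pole_lemma theta_holomorphic) auto
  \<comment> \<open>The singularity at \<open>l\<close> is removable, but the elementary bound 2 /
    |z - l| is uniform only away from it; the annulus starts halfway between |l| and 1.\<close>
  have r1: "(1 + cmod l) / 2 < 1" using l by simp
  have bd: "cmod (q z) \<le> 2 / ((1 - cmod l) / 2)" if "(1 + cmod l) / 2 < cmod z" "cmod z < 1" for z
  proof -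
    have d: "(1 - cmod l) / 2 \<le> cmod (z - l)" using norm_triangle_ineq2[of z l] that by argo
    have "z \<noteq> l" using that l by auto
    then have "cmod (q z) = cmod (\<theta> z - \<theta> l) / cmod (z - l)" by (simp add: q_def norm_divide)
    also have "\<dots> \<le> 2 / ((1 - cmod l) / 2)"
      using theta_lt1[OF l] theta_lt1[of z] that norm_triangle_ineq4[of "\<theta> z" "\<theta> l"] d l by (intro frac_le) auto
    finally show ?thesis .
  qed
  have lim: "AE \<zeta> in circle_measure. (\<lambda>n. q (of_real (rad n) * \<zeta>)) \<longlonglongrightarrow> quot2 l \<zeta>"
    using AE_circle_measure_norm B_radial
  proof eventually_elim
    case (elim \<zeta>)
    have ne: "\<zeta> - l \<noteq> 0" using elim l by auto
    have "(\<lambda>n. (\<theta> (of_real (rad n) * \<zeta>) - \<theta> l) / (of_real (rad n) * \<zeta> - l))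
       \<longlonglongrightarrow> (B \<zeta> - \<theta> l) / (of_real 1 * \<zeta> - l)"
      using ne elim by (intro tendsto_intros rad_LIMSEQ) auto
    \<comment> \<open>Once \<open>rad n\<close> exceeds |l|, the radial point cannot be
      \<open>l\<close>, where \<open>q\<close> has its special value.\<close>
    moreover have "\<forall>\<^sub>F n in sequentially. (\<theta> (of_real (rad n) * \<zeta>) - \<theta> l) / (of_real (rad n) * \<zeta> - l) = q (of_real (rad n) * \<zeta>)"
      using order_tendstoD(1)[OF rad_LIMSEQ l]
    proof eventually_elim
      case (elim n)
      have "cmod (of_real (rad n) * \<zeta>) = rad n" using rad[of n] \<open>cmod \<zeta> = 1\<close> by (simp add: norm_mult)
      then show ?case using elim by (auto simp: q_def)
    qed
    ultimately have "(\<lambda>n. q (of_real (rad n) * \<zeta>)) \<longlonglongrightarrow> (B \<zeta> - \<theta> l) / (of_real 1 * \<zeta> - l)"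
      by (rule Lim_transform_eventually)
    then show ?case by (simp add: quot2_def)
  qed
  have m: "quot2 l \<in> borel_measurable borel" unfolding quot2_def by measurable
  show "quot2 l \<in> H2" by (rule H2_boundary_mem[OF hol r1 bd m lim])
  show "(\<integral>\<zeta>. \<zeta> * quot2 l \<zeta> * h \<zeta> \<partial>circle_measure) = 0" if "h \<in> H2"
    by (rule H2_boundary_orth[OF hol r1 bd m lim that])
qed

text \<open>The pair describes the reproducing vector at \<open>l\<close>. Its first component is
  \<open>quot1 l\<close>, while \<open>cnj_szego\<close> turns its orthogonality integral into that
  of \<zeta> times \<open>quot2 l\<close>.\<close>

lemma adm_kernel:
  assumes l: "cmod l < 1" shows "adm (szego l) (\<lambda>\<zeta>. - cnj (\<theta> l) * szego l \<zeta>)"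
  unfolding adm_def
proof (intro conjI ballI)
  have [measurable]: "szego l \<in> borel_measurable borel" using bdd_szego[OF l] by (rule bdd_circle_measurable)
  show "bdd_circle (szego l)" "bdd_circle (\<lambda>\<zeta>. - cnj (\<theta> l) * szego l \<zeta>)"
    by (intro bdd_circle_cmult bdd_szego l)+
  have "quot1 l = (\<lambda>\<zeta>. szego l \<zeta> + - cnj (\<theta> l) * szego l \<zeta> * B \<zeta>)"
    by (auto simp: quot1_def algebra_simps)
  then show "(\<lambda>\<zeta>. szego l \<zeta> + - cnj (\<theta> l) * szego l \<zeta> * B \<zeta>) \<in> H2" using quot1_H2[OF l] by simp
  fix h assume h: "h \<in> H2"
  have [measurable]: "h \<in> borel_measurable borel" "quot2 l \<in> borel_measurable borel"
    using H2_L2[OF h] H2_L2[OF quot2_H2[OF l]] cm.L2_iff by auto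
  have "(\<integral>\<zeta>. (cnj (szego l \<zeta>) * B \<zeta> + cnj (- cnj (\<theta> l) * szego l \<zeta>)) * h \<zeta> \<partial>circle_measure)
      = (\<integral>\<zeta>. \<zeta> * quot2 l \<zeta> * h \<zeta> \<partial>circle_measure)"
  proof (intro integral_cong_AE)
    show "AE \<zeta> in circle_measure. (cnj (szego l \<zeta>) * B \<zeta> + cnj (- cnj (\<theta> l) * szego l \<zeta>)) * h \<zeta> = \<zeta> * quot2 l \<zeta> * h \<zeta>"
      using AE_circle_measure_norm
    proof eventually_elim
      case (elim \<zeta>)
      have "cnj (szego l \<zeta>) * B \<zeta> + cnj (- cnj (\<theta> l) * szego l \<zeta>) = cnj (szego l \<zeta>) * (B \<zeta> - \<theta> l)"
        by (simp add: algebra_simps)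
      then show ?case by (simp add: cnj_szego[OF elim l] quot2_def)
    qed
  qed auto
  then show "(\<integral>\<zeta>. (cnj (szego l \<zeta>) * B \<zeta> + cnj (- cnj (\<theta> l) * szego l \<zeta>)) * h \<zeta> \<partial>circle_measure) = 0"
    using quot2_orth[OF l h] by simp
qed

text \<open>The mirror image of \<open>adm_kernel\<close>: \<open>quot2 l\<close> is the first
  component and \<open>quot1 l\<close> appears in the orthogonality integral.\<close>

lemma adm_conjugate_kernel:
  assumes l: "cmod l < 1" shows "adm (\<lambda>\<zeta>. - \<theta> l * (1 / (\<zeta> - l))) (\<lambda>\<zeta>. 1 / (\<zeta> - l))"
  unfolding adm_def
proof (intro conjI ballI)
  have [measurable]: "szego l \<in> borel_measurable borel" using bdd_szego[OF l] by (rule bdd_circle_measurable)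
  show "bdd_circle (\<lambda>\<zeta>. - \<theta> l * (1 / (\<zeta> - l)))" "bdd_circle (\<lambda>\<zeta>. 1 / (\<zeta> - l))"
    by (intro bdd_circle_cmult bdd_resolvent l)+
  have "quot2 l = (\<lambda>\<zeta>. - \<theta> l * (1 / (\<zeta> - l)) + 1 / (\<zeta> - l) * B \<zeta>)"
    by (auto simp: quot2_def diff_divide_distrib)
  then show "(\<lambda>\<zeta>. - \<theta> l * (1 / (\<zeta> - l)) + 1 / (\<zeta> - l) * B \<zeta>) \<in> H2" using quot2_H2[OF l] by simp
  fix h assume h: "h \<in> H2"
  have [measurable]: "h \<in> borel_measurable borel" "quot1 l \<in> borel_measurable borel"
    using H2_L2[OF h] H2_L2[OF quot1_H2[OF l]] cm.L2_iff by auto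
  have "(\<integral>\<zeta>. (cnj (- \<theta> l * (1 / (\<zeta> - l))) * B \<zeta> + cnj (1 / (\<zeta> - l))) * h \<zeta> \<partial>circle_measure)
      = (\<integral>\<zeta>. \<zeta> * quot1 l \<zeta> * h \<zeta> \<partial>circle_measure)"
  proof (intro integral_cong_AE)
    show "AE \<zeta> in circle_measure. (cnj (- \<theta> l * (1 / (\<zeta> - l))) * B \<zeta> + cnj (1 / (\<zeta> - l))) * h \<zeta> = \<zeta> * quot1 l \<zeta> * h \<zeta>"
      using AE_circle_measure_norm
    proof eventually_elim
      case (elim \<zeta>)
      have "cnj (- \<theta> l * (1 / (\<zeta> - l))) * B \<zeta> + cnj (1 / (\<zeta> - l)) = cnj (1 / (\<zeta> - l)) * (1 - cnj (\<theta> l) * B \<zeta>)"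
        unfolding complex_cnj_mult by (simp add: algebra_simps)
      then show ?case unfolding cnj_resolvent[OF elim l] quot1_def by (simp add: mult_ac)
    qed
  qed auto
  then show "(\<integral>\<zeta>. (cnj (- \<theta> l * (1 / (\<zeta> - l))) * B \<zeta> + cnj (1 / (\<zeta> - l))) * h \<zeta> \<partial>circle_measure) = 0"
    using quot1_orth[OF l h] by simp
qed

end

section \<open>The Clark operator on reproducing vectors\<close>

locale clark_map = clark_data +
  fixes \<Phi> :: "cfun \<times> cfun \<Rightarrow> cfun"
  assumes Phi: "clark_op \<mu> \<gamma> \<Phi>"
begin

lemma Phi_L2: "x \<in> Kspace \<theta> \<Longrightarrow> \<Phi> x \<in> L2 \<mu>"
  using Phi unfolding clark_op_def Let_def by blast

lemma Phi_linear: "x \<in> Kspace \<theta> \<Longrightarrow> y \<in> Kspace \<theta> \<Longrightarrow>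
    AE \<xi> in \<mu>. \<Phi> (\<lambda>\<zeta>. a * fst x \<zeta> + fst y \<zeta>, \<lambda>\<zeta>. a * snd x \<zeta> + snd y \<zeta>) \<xi> = a * \<Phi> x \<xi> + \<Phi> y \<xi>"
  using Phi unfolding clark_op_def Let_def by blast

lemma Phi_intertwines: "x \<in> Kspace \<theta> \<Longrightarrow> is_proj (Kspace \<theta>) (Mz x) u \<Longrightarrow>
    AE \<xi> in \<mu>. \<Phi> u \<xi> = Ugamma \<mu> \<gamma> (\<Phi> x) \<xi>"
  using Phi unfolding clark_op_def Let_def by blast

lemma Phi_cvec: "AE \<xi> in \<mu>. \<Phi> (cvec \<theta>) \<xi> = 1"
  using Phi unfolding clark_op_def Let_def by blast

lemma Phi_vec_lincomb:
  assumes "adm p q" "adm p' q'"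
  shows "AE \<xi> in \<mu>. \<Phi> (vec (\<lambda>\<zeta>. a * p \<zeta> + p' \<zeta>) (\<lambda>\<zeta>. a * q \<zeta> + q' \<zeta>)) \<xi> = a * \<Phi> (vec p q) \<xi> + \<Phi> (vec p' q') \<xi>"
proof -
  have "vec (\<lambda>\<zeta>. a * p \<zeta> + p' \<zeta>) (\<lambda>\<zeta>. a * q \<zeta> + q' \<zeta>) =
    (\<lambda>\<zeta>. a * fst (vec p q) \<zeta> + fst (vec p' q') \<zeta>, \<lambda>\<zeta>. a * snd (vec p q) \<zeta> + snd (vec p' q') \<zeta>)"
    by (auto simp: vec_def algebra_simps)
  then show ?thesis using Phi_linear[OF adm_in_Kspace adm_in_Kspace] assms by simp
qed

lemma Phi_vec_zero: "AE \<xi> in \<mu>. \<Phi> (vec (\<lambda>_. 0) (\<lambda>_. 0)) \<xi> = 0"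
  using Phi_vec_lincomb[OF adm_zero adm_zero, of 1] by simp

lemma Phi_vec_cmult:
  assumes "adm p q"
  shows "AE \<xi> in \<mu>. \<Phi> (vec (\<lambda>\<zeta>. a * p \<zeta>) (\<lambda>\<zeta>. a * q \<zeta>)) \<xi> = a * \<Phi> (vec p q) \<xi>"
  using Phi_vec_lincomb[OF assms adm_zero, of a] Phi_vec_zero by (auto elim!: eventually_elim2)

lemma szego_0: "szego 0 = (\<lambda>_. 1)"
  by (auto simp: szego_def)

text \<open>The reproducing vector at 0, which is \<open>cvec\<close> before normalisation;
  \<open>Phi_vac\<close> therefore finds the constant \<open>s\<close>.\<close>

definition vac :: "cfun \<times> cfun" where
  "vac = vec (\<lambda>_. 1) (\<lambda>_. - cnj (\<theta> 0))"

lemma adm_vac: "adm (\<lambda>_. 1) (\<lambda>_. - cnj (\<theta> 0))"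
  using adm_kernel[of 0] by (simp add: szego_0)

lemma Phi_vac: "AE \<xi> in \<mu>. \<Phi> vac \<xi> = of_real s"
proof -
  have s: "sqrt (1 - (cmod (\<theta> 0))\<^sup>2) = s" by (simp add: theta_0 s_def)
  have c: "cvec \<theta> = vec (\<lambda>_. (1 / of_real s) * 1) (\<lambda>_. (1 / of_real s) * - cnj (\<theta> 0))"
    unfolding cvec_def s vec_def by (auto simp: diff_divide_distrib)
  have "AE \<xi> in \<mu>. \<Phi> (cvec \<theta>) \<xi> = (1 / of_real s) * \<Phi> vac \<xi>"
    unfolding c vac_def by (rule Phi_vec_cmult[OF adm_vac])
  then show ?thesis using Phi_cvec by eventually_elim (use s_pos in \<open>simp add: field_simps\<close>)
qed

text \<open>The two vectors differ by c (\<theta>, \<Delta>), that is by c times the excluded vector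
  with h = 1, which is orthogonal to the model space. Projections can thus be written down
  explicitly.\<close>

lemma is_proj_vec:
  assumes a: "adm p q" "adm p' q'"
    and p: "\<And>\<zeta>. cmod \<zeta> = 1 \<Longrightarrow> \<zeta> * p \<zeta> = p' \<zeta>" and q: "\<And>\<zeta>. cmod \<zeta> = 1 \<Longrightarrow> \<zeta> * q \<zeta> = q' \<zeta> + c"
  shows "is_proj (Kspace \<theta>) (Mz (vec p q)) (vec p' q')"
  unfolding is_proj_def
proof (intro conjI ballI)
  show "vec p' q' \<in> Kspace \<theta>" by (rule adm_in_Kspace[OF a(2)])
  fix y assume y: "y \<in> Kspace \<theta>"
  have yL: "fst y \<in> L2 circle_measure" "snd y \<in> L2 circle_measure"
    using y H2_L2 by (auto simp: Kspace_def closDL2_def)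
  have [measurable]: "fst y \<in> borel_measurable borel" "snd y \<in> borel_measurable borel" using yL cm.L2_iff by auto
  have [measurable]: "p \<in> borel_measurable borel" "q \<in> borel_measurable borel"
    "p' \<in> borel_measurable borel" "q' \<in> borel_measurable borel"
    using a bdd_circle_measurable by (auto simp: adm_def)
  have one: "(\<lambda>_. 1) \<in> H2" using szego_H2[of 0] by (simp add: szego_0)
  have orth: "\<forall>h\<in>H2. ipK y (\<lambda>\<zeta>. B \<zeta> * h \<zeta>, \<lambda>\<zeta>. D \<zeta> * h \<zeta>) = 0" using y by (simp add: Kspace_def)
  have "ipK (\<lambda>\<zeta>. fst (Mz (vec p q)) \<zeta> - fst (vec p' q') \<zeta>, \<lambda>\<zeta>. snd (Mz (vec p q)) \<zeta> - snd (vec p' q') \<zeta>) y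
     = (\<integral>\<zeta>. c * cnj (fst y \<zeta> * cnj (B \<zeta> * 1)) \<partial>circle_measure) + (\<integral>\<zeta>. c * cnj (snd y \<zeta> * cnj (D \<zeta> * 1)) \<partial>circle_measure)"
    unfolding ipK_def ip_def
  proof (intro arg_cong2[where f="(+)"] integral_cong_AE)
    show "AE \<zeta> in circle_measure. fst (\<lambda>\<zeta>. fst (Mz (vec p q)) \<zeta> - fst (vec p' q') \<zeta>, \<lambda>\<zeta>. snd (Mz (vec p q)) \<zeta> - snd (vec p' q') \<zeta>) \<zeta> * cnj (fst y \<zeta>)
        = c * cnj (fst y \<zeta> * cnj (B \<zeta> * 1))"
      using AE_circle_measure_norm
    proof eventually_elim
      case (elim \<zeta>)
      have "\<zeta> * (p \<zeta> + q \<zeta> * B \<zeta>) - (p' \<zeta> + q' \<zeta> * B \<zeta>) = c * B \<zeta>"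
        using p[OF elim] q[OF elim] by (simp add: distrib_left flip: mult.assoc) (simp add: distrib_right)
      then show ?case by (simp add: vec_def Mz_def)
    qed
    show "AE \<zeta> in circle_measure. snd (\<lambda>\<zeta>. fst (Mz (vec p q)) \<zeta> - fst (vec p' q') \<zeta>, \<lambda>\<zeta>. snd (Mz (vec p q)) \<zeta> - snd (vec p' q') \<zeta>) \<zeta> * cnj (snd y \<zeta>)
        = c * cnj (snd y \<zeta> * cnj (D \<zeta> * 1))"
      using AE_circle_measure_norm
    proof eventually_elim
      case (elim \<zeta>)
      have "\<zeta> * (q \<zeta> * D \<zeta>) - q' \<zeta> * D \<zeta> = c * D \<zeta>"
        using q[OF elim] by (simp flip: mult.assoc) (simp add: distrib_right)
      then show ?case by (simp add: vec_def Mz_def)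
    qed
  qed (auto simp: vec_def Mz_def)
  also have "\<dots> = c * cnj (ipK y (\<lambda>\<zeta>. B \<zeta> * 1, \<lambda>\<zeta>. D \<zeta> * 1))"
    unfolding ipK_def ip_def integral_mult_right_zero integral_cnj_circle by (simp add: distrib_left)
  also have "ipK y (\<lambda>\<zeta>. B \<zeta> * 1, \<lambda>\<zeta>. D \<zeta> * 1) = 0" using bspec[OF orth one] .
  finally show "ipK (\<lambda>\<zeta>. fst (Mz (vec p q)) \<zeta> - fst (vec p' q') \<zeta>, \<lambda>\<zeta>. snd (Mz (vec p q)) \<zeta> - snd (vec p' q') \<zeta>) y = 0" by simp
qed

lemma ip_cnj: "ip \<mu> h cnj = (\<integral>\<xi>. h \<xi> * \<xi> \<partial>\<mu>)"
  by (simp add: ip_def)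

lemma szego_cauchy:
  assumes l: "cmod l < 1"
  shows "(\<integral>\<xi>. szego l \<xi> \<partial>\<mu>) = cnj ((F l + 1) / 2)"
proof -
  have "(\<integral>\<xi>. szego l \<xi> \<partial>\<mu>) = (\<integral>\<xi>. cnj (1 / (1 - cnj \<xi> * l)) \<partial>\<mu>)" by (simp add: szego_def mult.commute)
  also have "\<dots> = cnj (cauchy_int (\<lambda>_. 1) l)" unfolding integral_cnj_circle cauchy_int_def ..
  finally show ?thesis by (simp add: F_eq[OF l])
qed

text \<open>Modulo (\<theta>, \<Delta>), multiplication by \<zeta> sends the kernel to a combination
  of itself and \<open>vac\<close>. The intertwining relation then says that \<Phi> x times 1 - cnj
  l * \<xi> is a constant \<open>C\<close>.\<close>

lemma Phi_kernel:
  assumes l: "cmod l < 1"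
  shows "AE \<xi> in \<mu>. \<Phi> (vec (szego l) (\<lambda>\<zeta>. - cnj (\<theta> l) * szego l \<zeta>)) \<xi> = cnj (N l) * szego l \<xi>"
\<comment> \<open>The combination used below divides by \<open>cnj l\<close>; at l = 0 the kernel is
  \<open>vac\<close> itself.\<close>
proof (cases "l = 0")
  case True
  have "den 0 = 2" unfolding den_def R2_def using total by simp
  then show ?thesis using Phi_vac True by (simp add: szego_0 N_def vac_def)
next
  case False
  define x where "x = vec (szego l) (\<lambda>\<zeta>. - cnj (\<theta> l) * szego l \<zeta>)"
  define p where "p \<zeta> = (1 / cnj l) * szego l \<zeta> + (- 1 / cnj l) * 1" for \<zeta>
  define q where "q \<zeta> = (1 / cnj l) * (- cnj (\<theta> l) * szego l \<zeta>) + (- 1 / cnj l) * - cnj (\<theta> 0)" for \<zeta>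
  have ax: "adm (szego l) (\<lambda>\<zeta>. - cnj (\<theta> l) * szego l \<zeta>)" by (rule adm_kernel[OF l])
  have av: "adm (\<lambda>_. (- 1 / cnj l) * 1) (\<lambda>_. (- 1 / cnj l) * - cnj (\<theta> 0))" by (rule adm_cmult[OF adm_vac])
  have apq: "adm p q" unfolding p_def q_def by (rule adm_lincomb[OF ax av])
  have k: "cnj l * \<zeta> * szego l \<zeta> = szego l \<zeta> - 1" if "cmod \<zeta> = 1" for \<zeta>
    using one_minus_ne0(1)[of "cnj l" \<zeta>] that l by (simp add: szego_def divide_simps)
  have proj: "is_proj (Kspace \<theta>) (Mz x) (vec p q)"
    unfolding x_def
  proof (rule is_proj_vec[OF ax apq])
    fix \<zeta> :: complex assume \<zeta>: "cmod \<zeta> = 1"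
    have e: "\<zeta> * szego l \<zeta> = (szego l \<zeta> - 1) / cnj l" using k[OF \<zeta>] False by (simp add: field_simps)
    show "\<zeta> * szego l \<zeta> = p \<zeta>" unfolding e p_def by (simp add: diff_divide_distrib)
    have "\<zeta> * (- cnj (\<theta> l) * szego l \<zeta>) = - cnj (\<theta> l) * ((szego l \<zeta> - 1) / cnj l)"
      unfolding e[symmetric] by simp
    also have "\<dots> = q \<zeta> + (cnj (\<theta> l) - cnj (\<theta> 0)) / cnj l"
      using False unfolding q_def by (simp add: field_simps)
    finally show "\<zeta> * (- cnj (\<theta> l) * szego l \<zeta>) = q \<zeta> + (cnj (\<theta> l) - cnj (\<theta> 0)) / cnj l" .
  qed
  have xK: "x \<in> Kspace \<theta>" unfolding x_def by (rule adm_in_Kspace[OF ax])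
  \<comment> \<open>\<open>C\<close> still contains the unknown image of x through the rank-one term
    of \<open>Ugamma\<close>.\<close>
  define C where "C = of_real s + cnj l * (\<gamma> - 1) * ip \<mu> (\<Phi> x) cnj"
  have "AE \<xi> in \<mu>. \<Phi> (vec p q) \<xi> = (1 / cnj l) * \<Phi> x \<xi> + \<Phi> (vec (\<lambda>_. (- 1 / cnj l) * 1) (\<lambda>_. (- 1 / cnj l) * - cnj (\<theta> 0))) \<xi>"
    unfolding p_def q_def x_def by (rule Phi_vec_lincomb[OF ax av])
  moreover have "AE \<xi> in \<mu>. \<Phi> (vec (\<lambda>_. (- 1 / cnj l) * 1) (\<lambda>_. (- 1 / cnj l) * - cnj (\<theta> 0))) \<xi> = (- 1 / cnj l) * \<Phi> vac \<xi>"
    unfolding vac_def by (rule Phi_vec_cmult[OF adm_vac])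
  ultimately have y: "AE \<xi> in \<mu>. \<Phi> x \<xi> = C * szego l \<xi>"
    using Phi_vac Phi_intertwines[OF xK proj] on_circle
  proof eventually_elim
    case (elim \<xi>)
    have "(1 / cnj l) * \<Phi> x \<xi> + (- 1 / cnj l) * of_real s = \<xi> * \<Phi> x \<xi> + (\<gamma> - 1) * ip \<mu> (\<Phi> x) cnj"
      using elim(1-4) by (simp add: Ugamma_def)
    then have "cnj l * ((1 / cnj l) * \<Phi> x \<xi> + (- 1 / cnj l) * of_real s) = cnj l * (\<xi> * \<Phi> x \<xi> + (\<gamma> - 1) * ip \<mu> (\<Phi> x) cnj)"
      by simp
    then have "\<Phi> x \<xi> * (1 - cnj l * \<xi>) = C"
      using False unfolding C_def by (simp add: algebra_simps)
    moreover have "1 - cnj l * \<xi> \<noteq> 0" using one_minus_ne0(1)[of "cnj l" \<xi>] elim l by simp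
    ultimately show ?case unfolding szego_def by (simp add: field_simps)
  qed
  have [measurable]: "\<Phi> x \<in> borel_measurable borel" using Phi_L2[OF xK] by (simp add: L2_iff)
  have [measurable]: "szego l \<in> borel_measurable borel" using bdd_szego[OF l] by (rule bdd_circle_measurable)
  have si: "integrable \<mu> (szego l)" by (intro L2_integrable bdd_circle_L2 bdd_szego l)
  \<comment> \<open>Inserting \<Phi> x = C \<open>szego l\<close> into that inner product makes
    \<open>C\<close> appear on both sides; the resulting linear equation has coefficient
    \<open>cnj (den l)\<close>. The factor \<open>cnj l\<close> makes the identity \<open>k\<close>
    applicable.\<close>
  have "cnj l * ip \<mu> (\<Phi> x) cnj = (\<integral>\<xi>. C * (szego l \<xi> - 1) \<partial>\<mu>)"
    unfolding ip_cnj integral_mult_right_zero[symmetric]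
  proof (intro integral_cong_AE)
    show "AE \<xi> in \<mu>. cnj l * (\<Phi> x \<xi> * \<xi>) = C * (szego l \<xi> - 1)"
      using y on_circle
    proof eventually_elim
      case (elim \<xi>)
      have "cnj l * (\<Phi> x \<xi> * \<xi>) = C * (cnj l * \<xi> * szego l \<xi>)" using elim(1) by (simp add: mult_ac)
      then show ?case using k[OF elim(2)] by simp
    qed
  qed measurable
  also have "\<dots> = C * (cnj ((F l + 1) / 2) - 1)"
    using si total szego_cauchy[OF l] by simp
  finally have "C = of_real s + (\<gamma> - 1) * (C * (cnj ((F l + 1) / 2) - 1))"
    unfolding C_def by (metis (no_types, lifting) mult.assoc mult.commute)
  then have "C * cnj (den l) = 2 * of_real s" unfolding den_def by (simp add: field_simps; algebra)
  then have "C = cnj (N l)" using den_ne0[OF l] unfolding N_def by (simp add: field_simps)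
  then show ?thesis using y unfolding x_def by simp
qed

text \<open>As in \<open>Phi_kernel\<close>, the intertwining relation leaves one unknown constant.
  Its equation is now C \<open>num l\<close> = 2 s \<theta> l, and since \<open>num\<close> is
  \<theta> times \<open>den\<close>, a factor \<theta> l must be cancelled.\<close>

lemma Phi_conjugate_kernel:
  assumes l: "cmod l < 1" and th: "\<theta> l \<noteq> 0"
  shows "AE \<xi> in \<mu>. \<Phi> (vec (\<lambda>\<zeta>. - \<theta> l * (1 / (\<zeta> - l))) (\<lambda>\<zeta>. 1 / (\<zeta> - l))) \<xi> = N l * (1 / (\<xi> - l))"
proof -
  define k where "k \<zeta> = 1 / (\<zeta> - l)" for \<zeta>
  define x where "x = vec (\<lambda>\<zeta>. - \<theta> l * k \<zeta>) k"
  define p where "p \<zeta> = l * (- \<theta> l * k \<zeta>) + (- \<theta> l) * 1" for \<zeta>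
  define q where "q \<zeta> = l * k \<zeta> + (- \<theta> l) * - cnj (\<theta> 0)" for \<zeta>
  have ax: "adm (\<lambda>\<zeta>. - \<theta> l * k \<zeta>) k" using adm_conjugate_kernel[OF l] unfolding k_def .
  have av: "adm (\<lambda>_. (- \<theta> l) * 1) (\<lambda>_. (- \<theta> l) * - cnj (\<theta> 0))" by (rule adm_cmult[OF adm_vac])
  have apq: "adm p q" unfolding p_def q_def by (rule adm_lincomb[OF ax av])
  have k: "\<zeta> * k \<zeta> = l * k \<zeta> + 1" if "cmod \<zeta> = 1" for \<zeta>
    using that l by (auto simp: k_def divide_simps)
  have proj: "is_proj (Kspace \<theta>) (Mz x) (vec p q)"
    unfolding x_def
  proof (rule is_proj_vec[OF ax apq])
    fix \<zeta> :: complex assume \<zeta>: "cmod \<zeta> = 1"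
    have "\<zeta> * (- \<theta> l * k \<zeta>) = - \<theta> l * (\<zeta> * k \<zeta>)" by simp
    then show "\<zeta> * (- \<theta> l * k \<zeta>) = p \<zeta>" unfolding k[OF \<zeta>] p_def by (simp add: algebra_simps)
    show "\<zeta> * k \<zeta> = q \<zeta> + (1 - \<theta> l * cnj (\<theta> 0))" unfolding k[OF \<zeta>] q_def by simp
  qed
  have xK: "x \<in> Kspace \<theta>" unfolding x_def by (rule adm_in_Kspace[OF ax])
  define C where "C = - \<theta> l * of_real s - (\<gamma> - 1) * ip \<mu> (\<Phi> x) cnj"
  have "AE \<xi> in \<mu>. \<Phi> (vec p q) \<xi> = l * \<Phi> x \<xi> + \<Phi> (vec (\<lambda>_. (- \<theta> l) * 1) (\<lambda>_. (- \<theta> l) * - cnj (\<theta> 0))) \<xi>"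
    unfolding p_def q_def x_def by (rule Phi_vec_lincomb[OF ax av])
  moreover have "AE \<xi> in \<mu>. \<Phi> (vec (\<lambda>_. (- \<theta> l) * 1) (\<lambda>_. (- \<theta> l) * - cnj (\<theta> 0))) \<xi> = (- \<theta> l) * \<Phi> vac \<xi>"
    unfolding vac_def by (rule Phi_vec_cmult[OF adm_vac])
  ultimately have y: "AE \<xi> in \<mu>. \<Phi> x \<xi> = C * k \<xi>"
    using Phi_vac Phi_intertwines[OF xK proj] on_circle
  proof eventually_elim
    case (elim \<xi>)
    have "l * \<Phi> x \<xi> + (- \<theta> l) * of_real s = \<xi> * \<Phi> x \<xi> + (\<gamma> - 1) * ip \<mu> (\<Phi> x) cnj"
      using elim(1-4) by (simp add: Ugamma_def)
    then have "\<Phi> x \<xi> * (\<xi> - l) = C" unfolding C_def by (simp add: algebra_simps)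
    moreover have "\<xi> - l \<noteq> 0" using elim l by auto
    ultimately show ?case unfolding k_def by (simp add: field_simps)
  qed
  have [measurable]: "\<Phi> x \<in> borel_measurable borel" using Phi_L2[OF xK] by (simp add: L2_iff)
  have [measurable]: "k \<in> borel_measurable borel" unfolding k_def by measurable
  have [measurable]: "szego l \<in> borel_measurable borel" using bdd_szego[OF l] by (rule bdd_circle_measurable)
  have "ip \<mu> (\<Phi> x) cnj = (\<integral>\<xi>. C * cnj (szego l \<xi>) \<partial>\<mu>)"
    unfolding ip_cnj
  proof (intro integral_cong_AE)
    show "AE \<xi> in \<mu>. \<Phi> x \<xi> * \<xi> = C * cnj (szego l \<xi>)"
      using y on_circle by eventually_elim (simp add: cnj_szego[OF _ l] k_def)
  qed measurable
  also have "\<dots> = C * ((F l + 1) / 2)"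
    unfolding integral_mult_right_zero integral_cnj_circle szego_cauchy[OF l] by simp
  finally have "C = - \<theta> l * of_real s - (\<gamma> - 1) * (C * ((F l + 1) / 2))"
    unfolding C_def by metis
  then have "C * num l = 2 * of_real s * \<theta> l" unfolding num_def by (simp add: field_simps; algebra)
  then have "C = N l" using th den_ne0[OF l] unfolding N_def theta_eq by (simp add: field_simps)
  then show ?thesis using y unfolding x_def k_def by simp
qed

end

section \<open>Representation of the adjoint image\<close>

lemma (in circle_finite_measure) cauchy_int_minus:
  assumes f: "integrable M f" and l: "cmod l < 1"
  shows "cauchy_int f l - (\<integral>\<xi>. f \<xi> \<partial>M) = l * (\<integral>\<xi>. f \<xi> * (1 / (\<xi> - l)) \<partial>M)"
proof -
  have [measurable]: "f \<in> borel_measurable borel" using borel_measurable_integrable[OF f] by simp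
  have "cauchy_int f l - (\<integral>\<xi>. f \<xi> \<partial>M) = (\<integral>\<xi>. f \<xi> / (1 - cnj \<xi> * l) - f \<xi> \<partial>M)"
    unfolding cauchy_int_def using integrable_cauchy[OF f l] f by simp
  also have "\<dots> = (\<integral>\<xi>. l * (f \<xi> * (1 / (\<xi> - l))) \<partial>M)"
  proof (intro integral_cong_AE)
    show "AE \<xi> in M. f \<xi> / (1 - cnj \<xi> * l) - f \<xi> = l * (f \<xi> * (1 / (\<xi> - l)))"
      using on_circle
    proof eventually_elim
      case (elim \<xi>)
      have ne: "\<xi> - l \<noteq> 0" using elim l by auto
      have "f \<xi> / (1 - cnj \<xi> * l) = f \<xi> * cnj (szego l \<xi>)" by (simp add: szego_def mult.commute)
      also have "\<dots> = f \<xi> * (\<xi> * (1 / (\<xi> - l)))" using cnj_szego[OF elim l] by simp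
      also have "\<dots> - f \<xi> = l * (f \<xi> * (1 / (\<xi> - l)))" using ne by (simp add: field_simps)
      finally show ?case .
    qed
  qed auto
  finally show ?thesis unfolding integral_mult_right_zero .
qed

locale clark_image = clark_map +
  fixes f g1 g2 :: cfun
  assumes f_L2: "f \<in> L2 \<mu>" and g: "is_adjoint_image \<mu> \<gamma> \<Phi> f (g1, g2)"
begin

lemma g_K: "(g1, g2) \<in> Kspace \<theta>"
  using g by (simp add: is_adjoint_image_def)

lemma g_adj: "x \<in> Kspace \<theta> \<Longrightarrow> ipK (g1, g2) x = ip \<mu> f (\<Phi> x)"
  using g unfolding is_adjoint_image_def by blast

lemma g1_H2: "g1 \<in> H2" and g2_L2: "g2 \<in> L2 circle_measure"
  using g_K by (auto simp: Kspace_def closDL2_def)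

lemma g1_L2: "g1 \<in> L2 circle_measure"
  using g1_H2 by (rule H2_L2)

lemma measurable_data [measurable]: "f \<in> borel_measurable borel" "g1 \<in> borel_measurable borel" "g2 \<in> borel_measurable borel"
  using f_L2 g1_L2 g2_L2 L2_iff cm.L2_iff by auto

lemma f_int: "integrable \<mu> f"
  using f_L2 by (rule L2_integrable)

lemma g1_int: "integrable circle_measure g1"
  using g1_L2 by (rule cm.L2_integrable)

definition gm :: cfun where "gm \<zeta> = cnj (B \<zeta>) * g1 \<zeta> + D \<zeta> * g2 \<zeta>"

lemma gm_L2: "gm \<in> L2 circle_measure"
proof -
  have "(\<lambda>\<zeta>. cnj (B \<zeta>) * g1 \<zeta>) \<in> L2 circle_measure"
    using B_le by (intro cm.L2_bounded_mult[where B=1] g1_L2) auto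
  then show ?thesis unfolding gm_def by (intro cm.L2_add D_mult_L2 g2_L2)
qed

lemma gm_measurable [measurable]: "gm \<in> borel_measurable borel"
  using gm_L2 cm.L2_iff by auto

lemma gm_int: "integrable circle_measure gm"
  using gm_L2 by (rule cm.L2_integrable)

lemma gm_ip:
  assumes h: "h \<in> L2 circle_measure"
  shows "ipK (g1, g2) (\<lambda>\<zeta>. B \<zeta> * h \<zeta>, \<lambda>\<zeta>. D \<zeta> * h \<zeta>) = (\<integral>\<zeta>. gm \<zeta> * cnj (h \<zeta>) \<partial>circle_measure)"
proof -
  have i: "integrable circle_measure (\<lambda>\<zeta>. g1 \<zeta> * cnj (B \<zeta> * h \<zeta>))" "integrable circle_measure (\<lambda>\<zeta>. g2 \<zeta> * cnj (D \<zeta> * h \<zeta>))"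
    by (intro cm.L2_mult_integrable cm.L2_cnj B_mult_L2 D_mult_L2 h g1_L2 g2_L2)+
  have "ipK (g1, g2) (\<lambda>\<zeta>. B \<zeta> * h \<zeta>, \<lambda>\<zeta>. D \<zeta> * h \<zeta>) = (\<integral>\<zeta>. g1 \<zeta> * cnj (B \<zeta> * h \<zeta>) + g2 \<zeta> * cnj (D \<zeta> * h \<zeta>) \<partial>circle_measure)"
    unfolding ipK_def ip_def fst_conv snd_conv by (rule Bochner_Integration.integral_add[OF i, symmetric])
  also have "\<dots> = (\<integral>\<zeta>. gm \<zeta> * cnj (h \<zeta>) \<partial>circle_measure)"
    by (simp add: gm_def cnj_D algebra_simps)
  finally show ?thesis .
qed

text \<open>This is the orthogonality in \<open>Kspace\<close> moved onto \<open>gm\<close>: only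
  negative Fourier modes remain, so its Poisson integral is purely antianalytic.\<close>

lemma gm_orth:
  assumes h: "h \<in> H2" shows "(\<integral>\<zeta>. gm \<zeta> * cnj (h \<zeta>) \<partial>circle_measure) = 0"
proof -
  have "\<forall>h\<in>H2. ipK (g1, g2) (\<lambda>\<zeta>. B \<zeta> * h \<zeta>, \<lambda>\<zeta>. D \<zeta> * h \<zeta>) = 0" using g_K by (simp add: Kspace_def)
  from bspec[OF this h] show ?thesis using gm_ip[OF H2_L2[OF h]] by simp
qed

text \<open>The parameter \<open>p\<close> tests \<open>g1\<close> and the parameter
  \<open>q\<close> tests \<open>gm\<close>. For either family of kernels one of the two integrals
  vanishes, by \<open>gm_orth\<close> or \<open>g1_resolvent\<close>, and the other is a Cauchy-type
  integral.\<close>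

lemma ipK_vec:
  assumes pq: "bdd_circle p" "bdd_circle q"
  shows "ipK (g1, g2) (vec p q) = (\<integral>\<zeta>. g1 \<zeta> * cnj (p \<zeta>) \<partial>circle_measure) + (\<integral>\<zeta>. gm \<zeta> * cnj (q \<zeta>) \<partial>circle_measure)"
proof -
  have L: "p \<in> L2 circle_measure" "q \<in> L2 circle_measure" using pq cm.bdd_circle_L2 by auto
  have i: "integrable circle_measure (\<lambda>\<zeta>. g1 \<zeta> * cnj (p \<zeta>))" "integrable circle_measure (\<lambda>\<zeta>. g1 \<zeta> * cnj (B \<zeta> * q \<zeta>))"
    by (intro cm.L2_mult_integrable cm.L2_cnj B_mult_L2 L g1_L2)+
  have "ipK (g1, g2) (vec p q) = (\<integral>\<zeta>. g1 \<zeta> * cnj (p \<zeta>) + g1 \<zeta> * cnj (B \<zeta> * q \<zeta>) \<partial>circle_measure)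
      + (\<integral>\<zeta>. g2 \<zeta> * cnj (D \<zeta> * q \<zeta>) \<partial>circle_measure)"
    unfolding ipK_def ip_def vec_def by (simp add: algebra_simps)
  also have "\<dots> = (\<integral>\<zeta>. g1 \<zeta> * cnj (p \<zeta>) \<partial>circle_measure) + ipK (g1, g2) (\<lambda>\<zeta>. B \<zeta> * q \<zeta>, \<lambda>\<zeta>. D \<zeta> * q \<zeta>)"
    unfolding Bochner_Integration.integral_add[OF i] ipK_def ip_def by simp
  finally show ?thesis by (simp add: gm_ip[OF L(2)])
qed

lemma g1_resolvent:
  assumes l: "cmod l < 1" shows "(\<integral>\<zeta>. g1 \<zeta> * cnj (1 / (\<zeta> - l)) \<partial>circle_measure) = 0"
proof -
  have [measurable]: "szego l \<in> borel_measurable borel" using bdd_szego[OF l] by (rule bdd_circle_measurable)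
  have "(\<integral>\<zeta>. g1 \<zeta> * cnj (1 / (\<zeta> - l)) \<partial>circle_measure) = (\<integral>\<zeta>. \<zeta> * szego l \<zeta> * g1 \<zeta> \<partial>circle_measure)"
  proof (intro integral_cong_AE)
    show "AE \<zeta> in circle_measure. g1 \<zeta> * cnj (1 / (\<zeta> - l)) = \<zeta> * szego l \<zeta> * g1 \<zeta>"
      using AE_circle_measure_norm
    proof eventually_elim
      case (elim \<zeta>)
      show ?case unfolding cnj_resolvent[OF elim l] by simp
    qed
  qed measurable
  then show ?thesis using szego_orth[OF l g1_H2] by simp
qed

lemma H2_ext_eq_cauchy: "H2_ext g1 l = cm.cauchy_int g1 l"
  by (simp add: H2_ext_def cm.cauchy_int_def)

lemma cauchy_szego: "cm.cauchy_int h l = (\<integral>\<zeta>. h \<zeta> * cnj (szego l \<zeta>) \<partial>circle_measure)"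
  by (simp add: cm.cauchy_int_def szego_def mult.commute)

lemma g_plus:
  assumes l: "cmod l < 1"
  shows "H2_ext g1 l = N l * cauchy_int f l"
proof -
  let ?x = "vec (szego l) (\<lambda>\<zeta>. - cnj (\<theta> l) * szego l \<zeta>)"
  have K: "?x \<in> Kspace \<theta>" by (rule adm_in_Kspace[OF adm_kernel[OF l]])
  have [measurable]: "\<Phi> ?x \<in> borel_measurable borel" using Phi_L2[OF K] by (simp add: L2_iff)
  have [measurable]: "szego l \<in> borel_measurable borel" using bdd_szego[OF l] by (rule bdd_circle_measurable)
  have "(\<integral>\<zeta>. gm \<zeta> * cnj (- cnj (\<theta> l) * szego l \<zeta>) \<partial>circle_measure) = (\<integral>\<zeta>. - \<theta> l * (gm \<zeta> * cnj (szego l \<zeta>)) \<partial>circle_measure)"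
    by (simp add: mult_ac)
  also have "\<dots> = 0" unfolding integral_mult_right_zero gm_orth[OF szego_H2[OF l]] by simp
  finally have "H2_ext g1 l = ipK (g1, g2) ?x"
    using ipK_vec[OF bdd_szego[OF l] bdd_circle_cmult[OF bdd_szego[OF l]], of "- cnj (\<theta> l)"]
    by (simp only: H2_ext_eq_cauchy cauchy_szego add_0_right)
  also have "\<dots> = ip \<mu> f (\<Phi> ?x)" by (rule g_adj[OF K])
  also have "\<dots> = (\<integral>\<xi>. N l * (f \<xi> / (1 - cnj \<xi> * l)) \<partial>\<mu>)"
    unfolding ip_def
  proof (intro integral_cong_AE)
    show "AE \<xi> in \<mu>. f \<xi> * cnj (\<Phi> ?x \<xi>) = N l * (f \<xi> / (1 - cnj \<xi> * l))"
      using Phi_kernel[OF l] by eventually_elim (simp add: szego_def mult.commute)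
  qed measurable
  finally show ?thesis unfolding integral_mult_right_zero cauchy_int_def .
qed

text \<open>\<open>W\<close> and \<open>V\<close> are the conjugates of the antianalytic parts of
  the Poisson integrals of \<open>gm\<close> and of f \<mu>, as \<open>P_int_eq_cauchy\<close>
  shows.\<close>

definition W :: "complex \<Rightarrow> complex" where
  "W l = cm.cauchy_int (\<lambda>\<zeta>. cnj (gm \<zeta>)) l - (\<integral>\<zeta>. cnj (gm \<zeta>) \<partial>circle_measure)"

definition V :: "complex \<Rightarrow> complex" where
  "V l = cauchy_int (\<lambda>\<xi>. cnj (f \<xi>)) l - (\<integral>\<xi>. cnj (f \<xi>) \<partial>\<mu>)"

lemma W_eq_NV_if:
  assumes l: "cmod l < 1" and th: "\<theta> l \<noteq> 0"
  shows "W l = N l * V l"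
proof -
  let ?k = "\<lambda>\<zeta>. 1 / (\<zeta> - l)"
  let ?x = "vec (\<lambda>\<zeta>. - \<theta> l * ?k \<zeta>) ?k"
  have K: "?x \<in> Kspace \<theta>" by (rule adm_in_Kspace[OF adm_conjugate_kernel[OF l]])
  have [measurable]: "\<Phi> ?x \<in> borel_measurable borel" using Phi_L2[OF K] by (simp add: L2_iff)
  have "(\<integral>\<zeta>. g1 \<zeta> * cnj (- \<theta> l * ?k \<zeta>) \<partial>circle_measure) = (\<integral>\<zeta>. - cnj (\<theta> l) * (g1 \<zeta> * cnj (?k \<zeta>)) \<partial>circle_measure)"
    by (simp add: mult_ac)
  also have "\<dots> = 0" unfolding integral_mult_right_zero g1_resolvent[OF l] by simp
  finally have "(\<integral>\<zeta>. gm \<zeta> * cnj (?k \<zeta>) \<partial>circle_measure) = ipK (g1, g2) ?x"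
    using ipK_vec[OF bdd_circle_cmult[OF bdd_resolvent[OF l]] bdd_resolvent[OF l], of "- \<theta> l"]
    by (simp only: add_0_left)
  also have "\<dots> = ip \<mu> f (\<Phi> ?x)" by (rule g_adj[OF K])
  also have "\<dots> = (\<integral>\<xi>. cnj (N l * (cnj (f \<xi>) * ?k \<xi>)) \<partial>\<mu>)"
    unfolding ip_def
  proof (intro integral_cong_AE)
    show "AE \<xi> in \<mu>. f \<xi> * cnj (\<Phi> ?x \<xi>) = cnj (N l * (cnj (f \<xi>) * ?k \<xi>))"
      using Phi_conjugate_kernel[OF l th] by eventually_elim simp
  qed measurable
  also have "\<dots> = cnj (N l * (\<integral>\<xi>. cnj (f \<xi>) * ?k \<xi> \<partial>\<mu>))"
    unfolding integral_cnj_circle integral_mult_right_zero ..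
  finally have 1: "(\<integral>\<zeta>. gm \<zeta> * cnj (?k \<zeta>) \<partial>circle_measure) = cnj (N l * (\<integral>\<xi>. cnj (f \<xi>) * ?k \<xi> \<partial>\<mu>))" .
  have "W l = l * (\<integral>\<zeta>. cnj (gm \<zeta> * cnj (?k \<zeta>)) \<partial>circle_measure)"
    unfolding W_def using cm.cauchy_int_minus[of "\<lambda>\<zeta>. cnj (gm \<zeta>)" l] gm_int l by simp
  also have "\<dots> = l * (N l * (\<integral>\<xi>. cnj (f \<xi>) * ?k \<xi> \<partial>\<mu>))"
    unfolding integral_cnj_circle 1 by simp
  also have "\<dots> = N l * V l"
    unfolding V_def using cauchy_int_minus[of "\<lambda>\<xi>. cnj (f \<xi>)" l] f_int l by simp
  finally show ?thesis .
qed

text \<open>The zeros of \<theta> are passed by analytic continuation: both sides are holomorphic in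
  the disc and agree on a nonempty open set.\<close>

lemma W_eq_NV:
  assumes l: "cmod l < 1" and th: "\<exists>z. cmod z < 1 \<and> \<theta> z \<noteq> 0"
  shows "W l = N l * V l"
proof (rule analytic_continuation_open[of "ball 0 1 \<inter> \<theta> -` (- {0})" "ball 0 1" W "\<lambda>z. N z * V z"])
  show "open (ball 0 1 \<inter> \<theta> -` (- {0}))"
    by (intro continuous_open_preimage continuous_theta) auto
  show "ball 0 1 \<inter> \<theta> -` (- {0}) \<noteq> {}" using th by auto
  show "W holomorphic_on ball 0 1"
    unfolding W_def using gm_int by (intro holomorphic_intros cm.cauchy_int_holomorphic) auto
  show "(\<lambda>z. N z * V z) holomorphic_on ball 0 1"
    unfolding V_def using f_int by (intro holomorphic_intros cauchy_int_holomorphic N_holomorphic) auto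
qed (use l W_eq_NV_if in auto)

lemma P_int_gm:
  assumes l: "cmod l < 1" shows "cm.P_int gm l = cnj (W l)"
  using cm.P_int_eq_cauchy[OF gm_int l] gm_orth[OF szego_H2[OF l]] unfolding W_def cauchy_szego[of gm] by simp

lemma P_int_g1:
  assumes l: "cmod l < 1" shows "cm.P_int g1 l = H2_ext g1 l"
proof -
  have "cm.cauchy_int (\<lambda>\<zeta>. cnj (g1 \<zeta>)) l - (\<integral>\<zeta>. cnj (g1 \<zeta>) \<partial>circle_measure)
      = l * (\<integral>\<zeta>. cnj (g1 \<zeta> * cnj (1 / (\<zeta> - l))) \<partial>circle_measure)"
    using cm.cauchy_int_minus[of "\<lambda>\<zeta>. cnj (g1 \<zeta>)" l] g1_int l by simp
  also have "\<dots> = 0" unfolding integral_cnj_circle g1_resolvent[OF l] by simp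
  finally show ?thesis using cm.P_int_eq_cauchy[OF g1_int l] by (simp add: H2_ext_eq_cauchy)
qed

text \<open>The two halves of the Poisson kernel are recovered separately, the analytic one from
  \<open>g_plus\<close> and the antianalytic one from \<open>W_eq_NV\<close>.\<close>

lemma P_int_f:
  assumes l: "cmod l < 1" and th: "\<exists>z. cmod z < 1 \<and> \<theta> z \<noteq> 0"
  shows "P_int f l = H2_ext g1 l / N l + cm.P_int gm l / cnj (N l)"
  using P_int_eq_cauchy[OF f_int l] g_plus[OF l] P_int_gm[OF l] W_eq_NV[OF l th] N_ne0[OF l]
  unfolding V_def[symmetric] by simp

section \<open>The covariance estimate and the comparison with Poisson quotients\<close>

definition G :: "complex \<Rightarrow> real" where "G \<zeta> = (cmod (g1 \<zeta>))\<^sup>2 + (cmod (g2 \<zeta>))\<^sup>2"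

lemma G_int: "integrable circle_measure G"
  unfolding G_def using g1_L2 g2_L2 by (simp add: cm.L2_iff)

text \<open>A variance computation: \<theta> z is the Poisson mean of \<open>B\<close>, and adding
  |D|^2 = 1 - |B|^2 removes the only term whose mean is not known.\<close>

lemma integral_defect:
  assumes z: "cmod z < 1"
  shows "integrable circle_measure (\<lambda>\<zeta>. ((cmod (B \<zeta> - \<theta> z))\<^sup>2 + (cmod (D \<zeta>))\<^sup>2) * poisson z \<zeta>)"
    and "(\<integral>\<zeta>. ((cmod (B \<zeta> - \<theta> z))\<^sup>2 + (cmod (D \<zeta>))\<^sup>2) * poisson z \<zeta> \<partial>circle_measure) = 1 - (cmod (\<theta> z))\<^sup>2"
proof -
  define c where "c = 1 + (cmod (\<theta> z))\<^sup>2"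
  have ae: "AE \<zeta> in circle_measure. ((cmod (B \<zeta> - \<theta> z))\<^sup>2 + (cmod (D \<zeta>))\<^sup>2) * poisson z \<zeta>
      = c * poisson z \<zeta> - 2 * Re (cnj (\<theta> z) * (B \<zeta> * of_real (poisson z \<zeta>)))"
    using B_le
  proof eventually_elim
    case (elim \<zeta>)
    have "0 \<le> 1 - (cmod (B \<zeta>))\<^sup>2" using elim by (simp add: abs_square_le_1)
    then have "(cmod (D \<zeta>))\<^sup>2 = 1 - (cmod (B \<zeta>))\<^sup>2" unfolding Delta_def norm_of_real by simp
    moreover have "(cmod (B \<zeta> - \<theta> z))\<^sup>2 = (cmod (B \<zeta>))\<^sup>2 + (cmod (\<theta> z))\<^sup>2 - 2 * Re (cnj (\<theta> z) * B \<zeta>)"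
      unfolding cmod_power2 by (simp add: power2_eq_square algebra_simps)
    ultimately have "(cmod (B \<zeta> - \<theta> z))\<^sup>2 + (cmod (D \<zeta>))\<^sup>2 = c - 2 * Re (cnj (\<theta> z) * B \<zeta>)" by (simp add: c_def)
    then have "((cmod (B \<zeta> - \<theta> z))\<^sup>2 + (cmod (D \<zeta>))\<^sup>2) * poisson z \<zeta> = c * poisson z \<zeta> - 2 * (Re (cnj (\<theta> z) * B \<zeta>) * poisson z \<zeta>)"
      by (simp add: left_diff_distrib)
    also have "Re (cnj (\<theta> z) * B \<zeta>) * poisson z \<zeta> = Re (cnj (\<theta> z) * (B \<zeta> * of_real (poisson z \<zeta>)))"
      by (simp add: algebra_simps)
    finally show ?case .
  qed
  have Bi: "integrable circle_measure B" using B_le by (intro cm.integrable_const_bound[where B=1]) auto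
  have i1: "integrable circle_measure (\<lambda>\<zeta>. c * poisson z \<zeta>)" by (intro integrable_mult_right cm.integrable_poisson z)
  have i0: "integrable circle_measure (\<lambda>\<zeta>. cnj (\<theta> z) * (B \<zeta> * of_real (poisson z \<zeta>)))"
    by (intro integrable_mult_right cm.integrable_poisson_mult z Bi)
  have i2: "integrable circle_measure (\<lambda>\<zeta>. 2 * Re (cnj (\<theta> z) * (B \<zeta> * of_real (poisson z \<zeta>))))"
    using integrable_Re[OF i0] by (rule integrable_mult_right)
  have i3: "integrable circle_measure (\<lambda>\<zeta>. c * poisson z \<zeta> - 2 * Re (cnj (\<theta> z) * (B \<zeta> * of_real (poisson z \<zeta>))))"
    using i1 i2 by (rule Bochner_Integration.integrable_diff)
  show "integrable circle_measure (\<lambda>\<zeta>. ((cmod (B \<zeta> - \<theta> z))\<^sup>2 + (cmod (D \<zeta>))\<^sup>2) * poisson z \<zeta>)"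
    by (rule integrable_cong_AE_imp[OF i3]) (use ae in auto)
  have "(\<integral>\<zeta>. ((cmod (B \<zeta> - \<theta> z))\<^sup>2 + (cmod (D \<zeta>))\<^sup>2) * poisson z \<zeta> \<partial>circle_measure)
     = (\<integral>\<zeta>. c * poisson z \<zeta> - 2 * Re (cnj (\<theta> z) * (B \<zeta> * of_real (poisson z \<zeta>))) \<partial>circle_measure)"
    using ae by (intro integral_cong_AE) auto
  also have "\<dots> = (\<integral>\<zeta>. c * poisson z \<zeta> \<partial>circle_measure) - (\<integral>\<zeta>. 2 * Re (cnj (\<theta> z) * (B \<zeta> * of_real (poisson z \<zeta>))) \<partial>circle_measure)"
    by (rule Bochner_Integration.integral_diff[OF i1 i2])
  also have "(\<integral>\<zeta>. c * poisson z \<zeta> \<partial>circle_measure) = c" using P_one_circle_measure[OF z] by (simp add: cm.P_one_def)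
  also have "(\<integral>\<zeta>. 2 * Re (cnj (\<theta> z) * (B \<zeta> * of_real (poisson z \<zeta>))) \<partial>circle_measure) = 2 * Re (cnj (\<theta> z) * cm.P_int B z)"
    unfolding integral_mult_right_zero integral_Re[OF i0] cm.P_int_def ..
  also have "2 * Re (cnj (\<theta> z) * cm.P_int B z) = 2 * (cmod (\<theta> z))\<^sup>2"
    unfolding B_poisson[OF z] cmod_power2 by (simp add: power2_eq_square)
  finally show "(\<integral>\<zeta>. ((cmod (B \<zeta> - \<theta> z))\<^sup>2 + (cmod (D \<zeta>))\<^sup>2) * poisson z \<zeta> \<partial>circle_measure) = 1 - (cmod (\<theta> z))\<^sup>2"
    by (simp add: c_def)
qed

text \<open>The difference on the left is the Poisson integral at \<open>z\<close> of \<open>(cnj \<theta> - cnj (\<theta> z)) g\<^sub>1 + \<Delta> g\<^sub>2\<close>, and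
  \<open>integral_defect\<close> evaluates the first factor of the Cauchy--Schwarz inequality.\<close>
lemma covariance_bound:
  assumes z: "cmod z < 1"
  shows "(cmod (cm.P_int gm z - cnj (\<theta> z) * H2_ext g1 z))\<^sup>2
     \<le> (1 - (cmod (\<theta> z))\<^sup>2) * (\<integral>\<zeta>. G \<zeta> * poisson z \<zeta> \<partial>circle_measure)"
proof -
  define A where "A = cm.P_int gm z - cnj (\<theta> z) * H2_ext g1 z"
  define X where "X = 1 - (cmod (\<theta> z))\<^sup>2"
  define Y where "Y = (\<integral>\<zeta>. G \<zeta> * poisson z \<zeta> \<partial>circle_measure)"
  have X0: "X > 0" using theta_lt1[OF z] by (simp add: X_def abs_square_less_1)
  define u where "u \<zeta> = (gm \<zeta> - cnj (\<theta> z) * g1 \<zeta>) * complex_of_real (poisson z \<zeta>)" for \<zeta>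
  have iu: "integrable circle_measure u"
    unfolding u_def by (intro cm.integrable_poisson_mult z Bochner_Integration.integrable_diff gm_int integrable_mult_right g1_int)
  have "A = (\<integral>\<zeta>. u \<zeta> \<partial>circle_measure)"
    unfolding A_def P_int_g1[OF z, symmetric] cm.P_int_def u_def left_diff_distrib mult.assoc
    using cm.integrable_poisson_mult[OF z gm_int] cm.integrable_poisson_mult[OF z g1_int] by simp
  then have Au: "cmod A \<le> (\<integral>\<zeta>. cmod (u \<zeta>) \<partial>circle_measure)" using integral_norm_bound by metis
  \<comment> \<open>Cauchy-Schwarz in parametric form, from 2 a b \<le> a^2 + b^2. The value t = |A|
    / X chosen afterwards is the optimal one.\<close>
  have main: "2 * t * cmod A \<le> t\<^sup>2 * X + Y" if t: "t \<ge> 0" for t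
  proof -
    have "2 * t * cmod A \<le> (\<integral>\<zeta>. 2 * t * cmod (u \<zeta>) \<partial>circle_measure)"
      using Au t by (simp add: mult_left_mono)
    also have "\<dots> \<le> (\<integral>\<zeta>. t\<^sup>2 * (((cmod (B \<zeta> - \<theta> z))\<^sup>2 + (cmod (D \<zeta>))\<^sup>2) * poisson z \<zeta>) + G \<zeta> * poisson z \<zeta> \<partial>circle_measure)"
    proof (intro integral_mono Bochner_Integration.integrable_add integrable_mult_right integrable_norm iu integral_defect(1) z cm.integrable_poisson_mult_real G_int)
      fix \<zeta>
      define b where "b = cmod (B \<zeta> - \<theta> z)"
      define d where "d = cmod (D \<zeta>)"
      have "gm \<zeta> - cnj (\<theta> z) * g1 \<zeta> = cnj (B \<zeta> - \<theta> z) * g1 \<zeta> + D \<zeta> * g2 \<zeta>" by (simp add: gm_def algebra_simps)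
      then have "cmod (gm \<zeta> - cnj (\<theta> z) * g1 \<zeta>) \<le> b * cmod (g1 \<zeta>) + d * cmod (g2 \<zeta>)"
        using norm_triangle_ineq[of "cnj (B \<zeta> - \<theta> z) * g1 \<zeta>" "D \<zeta> * g2 \<zeta>"]
        unfolding b_def d_def norm_mult complex_mod_cnj by simp
      then have "2 * t * cmod (gm \<zeta> - cnj (\<theta> z) * g1 \<zeta>) \<le> 2 * t * (b * cmod (g1 \<zeta>) + d * cmod (g2 \<zeta>))"
        using t by (intro mult_left_mono) auto
      also have "\<dots> \<le> t\<^sup>2 * (b\<^sup>2 + d\<^sup>2) + G \<zeta>"
        using zero_le_power2[of "t * b - cmod (g1 \<zeta>)"] zero_le_power2[of "t * d - cmod (g2 \<zeta>)"]
        unfolding G_def by (simp add: power2_diff power_mult_distrib algebra_simps)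
      finally have "2 * t * cmod (gm \<zeta> - cnj (\<theta> z) * g1 \<zeta>) * poisson z \<zeta> \<le> (t\<^sup>2 * (b\<^sup>2 + d\<^sup>2) + G \<zeta>) * poisson z \<zeta>"
        using poisson_nonneg[OF z] by (rule mult_right_mono)
      then show "2 * t * cmod (u \<zeta>) \<le> t\<^sup>2 * (((cmod (B \<zeta> - \<theta> z))\<^sup>2 + (cmod (D \<zeta>))\<^sup>2) * poisson z \<zeta>) + G \<zeta> * poisson z \<zeta>"
        unfolding u_def b_def d_def norm_mult norm_of_real using poisson_nonneg[OF z, of \<zeta>] by (simp add: algebra_simps)
    qed
    also have "\<dots> = t\<^sup>2 * X + Y"
      unfolding X_def Y_def integral_defect(2)[OF z, symmetric]
      by (subst Bochner_Integration.integral_add)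
         (intro integrable_mult_right integral_defect(1) z cm.integrable_poisson_mult_real G_int | simp)+
    finally show ?thesis .
  qed
  have "2 * (cmod A / X) * cmod A \<le> (cmod A / X)\<^sup>2 * X + Y" using X0 by (intro main) auto
  then have "(cmod A)\<^sup>2 / X \<le> Y" using X0 by (simp add: power2_eq_square field_simps)
  then show ?thesis using X0 unfolding A_def[symmetric] X_def[symmetric] Y_def[symmetric] by (simp add: pos_divide_le_eq mult.commute)
qed

text \<open>In \<open>den z + cnj (num z)\<close> the constants cancel and \<open>F z\<close> enters
  only through its real part, which is \<open>P_one z\<close>.\<close>

lemma clark_symbol_identity:
  assumes z: "cmod z < 1"
  shows "cnj (N z) + cnj (\<theta> z) * N z = (1 - cnj \<gamma>) / of_real s * of_real (1 - (cmod (\<theta> z))\<^sup>2)"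
proof -
  have d: "den z \<noteq> 0" "cnj (den z) \<noteq> 0" using den_ne0[OF z] by auto
  have ss: "complex_of_real s \<noteq> 0" using s_pos by simp
  have "den z + cnj (num z) = (1 - cnj \<gamma>) * (F z + cnj (F z))" by (simp add: den_def num_def algebra_simps)
  also have "F z + cnj (F z) = of_real (2 * P_one z)" unfolding complex_add_cnj Re_F[OF z] ..
  finally have e: "den z + cnj (num z) = (1 - cnj \<gamma>) * of_real (2 * P_one z)" .
  have "cnj (N z) + cnj (\<theta> z) * N z = 2 * of_real s * (den z + cnj (num z)) / (den z * cnj (den z))"
    unfolding N_def theta_eq using d by (simp add: field_simps)
  also have "\<dots> = (1 - cnj \<gamma>) / of_real s * ((2 * of_real s / den z) * cnj (2 * of_real s / den z) * of_real (P_one z))"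
    unfolding e using d ss by (simp add: field_simps)
  also have "\<dots> = (1 - cnj \<gamma>) / of_real s * of_real (1 - (cmod (\<theta> z))\<^sup>2)"
    unfolding one_minus_theta_sq[OF z] of_real_mult complex_norm_square N_def ..
  finally show ?thesis .
qed

lemma clark_quotient_bound:
  assumes z: "cmod z < 1" and th: "\<exists>z. cmod z < 1 \<and> \<theta> z \<noteq> 0"
  shows "(cmod ((1 - cnj \<gamma>) / of_real s * H2_ext g1 z - P_int f z / of_real (P_one z)))\<^sup>2
     \<le> (\<integral>\<zeta>. G \<zeta> * poisson z \<zeta> \<partial>circle_measure) / P_one z"
proof -
  define A where "A = cm.P_int gm z - cnj (\<theta> z) * H2_ext g1 z"
  define X where "X = 1 - (cmod (\<theta> z))\<^sup>2"
  define Y where "Y = (\<integral>\<zeta>. G \<zeta> * poisson z \<zeta> \<partial>circle_measure)"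
  have X0: "X > 0" using theta_lt1[OF z] by (simp add: X_def abs_square_less_1)
  have XP: "X = (cmod (N z))\<^sup>2 * P_one z" unfolding X_def by (rule one_minus_theta_sq[OF z])
  have n: "N z \<noteq> 0" "cnj (N z) \<noteq> 0" using N_ne0[OF z] by auto
  have P0: "P_one z > 0" by (rule P_one_pos'[OF z])
  have XC: "complex_of_real X = N z * cnj (N z) * of_real (P_one z)"
    unfolding XP of_real_mult complex_norm_square ..
  have "P_int f z / of_real (P_one z) = (H2_ext g1 z / N z + (A + cnj (\<theta> z) * H2_ext g1 z) / cnj (N z)) / of_real (P_one z)"
    unfolding P_int_f[OF z th] A_def by simp
  also have "\<dots> = (H2_ext g1 z * (cnj (N z) + cnj (\<theta> z) * N z) + A * N z) / of_real X"
    unfolding XC using n P0 by (simp add: field_simps)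
  also have "\<dots> = (1 - cnj \<gamma>) / of_real s * H2_ext g1 z + A * N z / of_real X"
    unfolding clark_symbol_identity[OF z] X_def[symmetric] using X0 by (simp add: add_divide_distrib)
  finally have "cmod ((1 - cnj \<gamma>) / of_real s * H2_ext g1 z - P_int f z / of_real (P_one z)) = cmod (A * N z / of_real X)"
    by (simp add: norm_minus_commute)
  then have "(cmod ((1 - cnj \<gamma>) / of_real s * H2_ext g1 z - P_int f z / of_real (P_one z)))\<^sup>2 = (cmod A)\<^sup>2 * (cmod (N z))\<^sup>2 / X\<^sup>2"
    by (simp add: norm_divide norm_mult power_divide power_mult_distrib)
  also have "\<dots> \<le> (X * Y) * (cmod (N z))\<^sup>2 / X\<^sup>2"
    using covariance_bound[OF z] unfolding A_def X_def Y_def by (intro divide_right_mono mult_right_mono) auto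
  \<comment> \<open>Since X is |N|^2 \<open>P_one\<close>, the possibly unbounded factor N cancels
    and only the Poisson integral of \<mu> remains in the denominator.\<close>
  also have "\<dots> = Y / P_one z" using X0 n P0 unfolding XP by (simp add: power2_eq_square)
  finally show ?thesis unfolding Y_def .
qed

end

section \<open>Boundary limits relative to the Lebesgue decomposition\<close>

lemma nt_lim_divide:
  "nt_lim F \<zeta> a \<Longrightarrow> nt_lim G \<zeta> b \<Longrightarrow> b \<noteq> 0 \<Longrightarrow> nt_lim (\<lambda>z. F z / G z) \<zeta> (a / b)"
  unfolding nt_lim_def by (auto intro: tendsto_divide)

section \<open>The sum of the given measure and Lebesgue measure as a common reference\<close>

lemma nn_integral_sum_of_measures:
  assumes s: "sets M1 = sets M" "sets M2 = sets M"
    and e: "\<And>A. A \<in> sets M \<Longrightarrow> emeasure M A = emeasure M1 A + emeasure M2 A"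
    and f: "f \<in> borel_measurable M"
  shows "(\<integral>\<^sup>+x. f x \<partial>M) = (\<integral>\<^sup>+x. f x \<partial>M1) + (\<integral>\<^sup>+x. f x \<partial>M2)"
proof -
  have m12: "borel_measurable M1 = borel_measurable M" "borel_measurable M2 = borel_measurable M"
    by (rule measurable_cong_sets; simp add: s)+
  show ?thesis using f
  proof (induction rule: borel_measurable_induct)
    case (cong f g)
    have "space M1 = space M" "space M2 = space M" by (rule sets_eq_imp_space_eq; rule s)+
    then have "(\<integral>\<^sup>+x. f x \<partial>M1) = (\<integral>\<^sup>+x. g x \<partial>M1)" "(\<integral>\<^sup>+x. f x \<partial>M2) = (\<integral>\<^sup>+x. g x \<partial>M2)"
      "(\<integral>\<^sup>+x. f x \<partial>M) = (\<integral>\<^sup>+x. g x \<partial>M)"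
      using cong(3) by (auto intro!: nn_integral_cong)
    then show ?case using cong(4) by simp
  next
    case (set A)
    then show ?case using e s by simp
  next
    case (mult u c)
    then have "u \<in> borel_measurable M1" "u \<in> borel_measurable M2" by (simp_all add: m12)
    then show ?case using mult by (simp add: nn_integral_cmult distrib_left)
  next
    case (add u v)
    have "u \<in> borel_measurable M1" "u \<in> borel_measurable M2" "v \<in> borel_measurable M1" "v \<in> borel_measurable M2"
      using add(1,3) by (simp_all add: m12)
    then show ?case using add by (simp add: nn_integral_add ac_simps)
  next
    case (seq U)
    have m: "U i \<in> borel_measurable M1" "U i \<in> borel_measurable M2" for i
      using seq(1)[of i] by (simp_all add: m12)
    have inc: "incseq (\<lambda>i. \<integral>\<^sup>+x. U i x \<partial>N)" for N
      using seq(3) by (auto simp: incseq_def le_fun_def intro!: nn_integral_mono)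
    have "(\<integral>\<^sup>+x. (SUP i. U i x) \<partial>M) = (SUP i. (\<integral>\<^sup>+x. U i x \<partial>M1) + (\<integral>\<^sup>+x. U i x \<partial>M2))"
      using seq by (subst nn_integral_monotone_convergence_SUP) auto
    also have "\<dots> = (SUP i. (\<integral>\<^sup>+x. U i x \<partial>M1)) + (SUP i. (\<integral>\<^sup>+x. U i x \<partial>M2))"
      by (rule ennreal_SUP_add[OF inc inc])
    also have "\<dots> = (\<integral>\<^sup>+x. (SUP i. U i x) \<partial>M1) + (\<integral>\<^sup>+x. (SUP i. U i x) \<partial>M2)"
      using seq m by (simp add: nn_integral_monotone_convergence_SUP)
    finally show ?case using seq(4) by (simp add: image_comp)
  qed
qed

definition sum_measure :: "complex measure \<Rightarrow> complex measure \<Rightarrow> complex measure" where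
  "sum_measure M1 M2 = measure_of UNIV (sets borel) (\<lambda>A. emeasure M1 A + emeasure M2 A)"

lemma sets_sum_measure [measurable_cong, simp]: "sets (sum_measure M1 M2) = sets borel"
  unfolding sum_measure_def using sets.sigma_sets_eq[of "borel :: complex measure"] by simp

lemma emeasure_sum_measure:
  assumes s: "sets M1 = sets borel" "sets M2 = sets borel" and A: "A \<in> sets borel"
  shows "emeasure (sum_measure M1 M2) A = emeasure M1 A + emeasure M2 A"
proof (rule emeasure_measure_of[OF sum_measure_def])
  show "countably_additive (sets (sum_measure M1 M2)) (\<lambda>A. emeasure M1 A + emeasure M2 A)"
    using s by (auto simp: countably_additive_def suminf_add[symmetric] suminf_emeasure image_subset_iff)
qed (use A in \<open>auto simp: positive_def\<close>)

locale lebesgue_split = circle_finite_measure \<mu> for \<mu> :: "complex measure" +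
  fixes w :: "complex \<Rightarrow> real" and S :: "complex set"
  assumes total_mass: "measure \<mu> UNIV = 1"
    and w_meas [measurable]: "w \<in> borel_measurable borel" and w_nonneg: "\<And>z. w z \<ge> 0"
    and S_borel [measurable]: "S \<in> sets borel"
    and S_null: "emeasure circle_measure S = 0"
    and decomp: "\<And>A. A \<in> sets borel \<Longrightarrow>
        emeasure \<mu> A = emeasure \<mu> (A \<inter> S) + (\<integral>\<^sup>+ z. ennreal (w z) * indicator A z \<partial>circle_measure)"
begin

definition \<sigma> :: "complex measure" where "\<sigma> = sum_measure \<mu> circle_measure"

text \<open>\<open>d1\<close> and \<open>d2\<close> are the densities of \<mu> and of
  \<open>circle_measure\<close> with respect to \<sigma>: on \<open>S\<close> the measure \<sigma>
  is \<mu> alone, and off \<open>S\<close> it is (1 + w) times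
  \<open>circle_measure\<close>.\<close>

definition d1 :: "complex \<Rightarrow> real" where "d1 z = (if z \<in> S then 1 else w z / (1 + w z))"

definition d2 :: "complex \<Rightarrow> real" where "d2 z = (if z \<in> S then 0 else 1 / (1 + w z))"

lemma d_meas [measurable]: "d1 \<in> borel_measurable borel" "d2 \<in> borel_measurable borel"
  unfolding d1_def d2_def by measurable

lemma d_nonneg: "d1 z \<ge> 0" "d2 z \<ge> 0" and d2_le: "d2 z \<le> 1"
  using w_nonneg[of z] by (auto simp: d1_def d2_def)

lemma sets_\<sigma> [measurable_cong, simp]: "sets \<sigma> = sets borel"
  by (simp add: \<sigma>_def)

lemma AE_not_S: "AE z in circle_measure. z \<notin> S"
  using S_null by (intro AE_not_in) (auto simp: null_sets_def)

lemma nn_integral_\<sigma>: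
  assumes "f \<in> borel_measurable borel"
  shows "(\<integral>\<^sup>+x. f x \<partial>\<sigma>) = (\<integral>\<^sup>+x. f x \<partial>\<mu>) + (\<integral>\<^sup>+x. f x \<partial>circle_measure)"
  using assms by (intro nn_integral_sum_of_measures) (auto simp: \<sigma>_def emeasure_sum_measure)

lemma nn_integral_\<mu>:
  assumes [measurable]: "f \<in> borel_measurable borel"
  shows "(\<integral>\<^sup>+x. f x \<partial>\<mu>) = (\<integral>\<^sup>+x. indicator S x * f x \<partial>\<mu>) + (\<integral>\<^sup>+x. ennreal (w x) * f x \<partial>circle_measure)"
proof -
  have "(\<integral>\<^sup>+x. f x \<partial>\<mu>) = (\<integral>\<^sup>+x. f x \<partial>density \<mu> (indicator S)) + (\<integral>\<^sup>+x. f x \<partial>density circle_measure (\<lambda>x. ennreal (w x)))"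
  proof (rule nn_integral_sum_of_measures)
    fix A assume "A \<in> sets \<mu>"
    then have [measurable]: "A \<in> sets borel" by simp
    have "emeasure (density \<mu> (indicator S)) A = emeasure \<mu> (A \<inter> S)"
      by (subst emeasure_density) (auto simp: Int_commute simp flip: indicator_inter_arith intro!: nn_integral_indicator)
    then show "emeasure \<mu> A = emeasure (density \<mu> (indicator S)) A + emeasure (density circle_measure (\<lambda>x. ennreal (w x))) A"
      using decomp[of A] by (simp add: emeasure_density)
  qed auto
  then show ?thesis by (simp add: nn_integral_density)
qed

lemma density_d1: "density \<sigma> (\<lambda>x. ennreal (d1 x)) = \<mu>"
proof (rule measure_eqI)
  fix A assume "A \<in> sets (density \<sigma> (\<lambda>x. ennreal (d1 x)))"
  then have A [measurable]: "A \<in> sets borel" by simp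
  have "emeasure (density \<sigma> (\<lambda>x. ennreal (d1 x))) A = (\<integral>\<^sup>+x. ennreal (d1 x) * indicator A x \<partial>\<sigma>)"
    by (intro emeasure_density) auto
  also have "\<dots> = (\<integral>\<^sup>+x. indicator S x * (ennreal (d1 x) * indicator A x) \<partial>\<mu>)
     + (\<integral>\<^sup>+x. ennreal (w x) * (ennreal (d1 x) * indicator A x) \<partial>circle_measure)
     + (\<integral>\<^sup>+x. ennreal (d1 x) * indicator A x \<partial>circle_measure)"
    by (simp add: nn_integral_\<sigma> nn_integral_\<mu>[of "\<lambda>x. ennreal (d1 x) * indicator A x"])
  also have "(\<integral>\<^sup>+x. indicator S x * (ennreal (d1 x) * indicator A x) \<partial>\<mu>) = emeasure \<mu> (A \<inter> S)"
  proof -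
    have "(\<integral>\<^sup>+x. indicator S x * (ennreal (d1 x) * indicator A x) \<partial>\<mu>) = (\<integral>\<^sup>+x. indicator (A \<inter> S) x \<partial>\<mu>)"
      by (intro nn_integral_cong) (auto simp: d1_def split: split_indicator)
    then show ?thesis by simp
  qed
  also have "emeasure \<mu> (A \<inter> S) + (\<integral>\<^sup>+x. ennreal (w x) * (ennreal (d1 x) * indicator A x) \<partial>circle_measure)
     + (\<integral>\<^sup>+x. ennreal (d1 x) * indicator A x \<partial>circle_measure)
    = emeasure \<mu> (A \<inter> S) + (\<integral>\<^sup>+x. ennreal (w x) * (ennreal (d1 x) * indicator A x) + ennreal (d1 x) * indicator A x \<partial>circle_measure)"
    by (simp add: nn_integral_add add.assoc)
  also have "(\<integral>\<^sup>+x. ennreal (w x) * (ennreal (d1 x) * indicator A x) + ennreal (d1 x) * indicator A x \<partial>circle_measure)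
    = (\<integral>\<^sup>+x. ennreal (w x) * indicator A x \<partial>circle_measure)"
  proof (intro nn_integral_cong_AE)
    show "AE x in circle_measure. ennreal (w x) * (ennreal (d1 x) * indicator A x) + ennreal (d1 x) * indicator A x
       = ennreal (w x) * indicator A x"
      using AE_not_S
    proof eventually_elim
      case (elim x)
      have "(w x + 1) * d1 x = w x" using elim w_nonneg[of x] by (simp add: d1_def add.commute)
      then have "w x * d1 x + d1 x = w x" by (simp add: distrib_right)
      then have "ennreal (w x) * ennreal (d1 x) + ennreal (d1 x) = ennreal (w x)"
        using w_nonneg[of x] d_nonneg[of x] by (simp flip: ennreal_mult ennreal_plus)
      then show ?case by (auto simp: indicator_def)
    qed
  qed
  finally show "emeasure (density \<sigma> (\<lambda>x. ennreal (d1 x))) A = emeasure \<mu> A" using decomp[OF A] by simp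
qed simp

lemma density_d2: "density \<sigma> (\<lambda>x. ennreal (d2 x)) = circle_measure"
proof (rule measure_eqI)
  fix A assume "A \<in> sets (density \<sigma> (\<lambda>x. ennreal (d2 x)))"
  then have A [measurable]: "A \<in> sets borel" by simp
  have "emeasure (density \<sigma> (\<lambda>x. ennreal (d2 x))) A = (\<integral>\<^sup>+x. ennreal (d2 x) * indicator A x \<partial>\<sigma>)"
    by (intro emeasure_density) auto
  also have "\<dots> = (\<integral>\<^sup>+x. indicator S x * (ennreal (d2 x) * indicator A x) \<partial>\<mu>)
     + (\<integral>\<^sup>+x. ennreal (w x) * (ennreal (d2 x) * indicator A x) \<partial>circle_measure)
     + (\<integral>\<^sup>+x. ennreal (d2 x) * indicator A x \<partial>circle_measure)"
    by (simp add: nn_integral_\<sigma> nn_integral_\<mu>[of "\<lambda>x. ennreal (d2 x) * indicator A x"])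
  also have "(\<integral>\<^sup>+x. indicator S x * (ennreal (d2 x) * indicator A x) \<partial>\<mu>) = (\<integral>\<^sup>+x. 0 \<partial>\<mu>)"
    by (intro nn_integral_cong) (auto simp: indicator_def d2_def)
  also have "(\<integral>\<^sup>+x. 0 \<partial>\<mu>) + (\<integral>\<^sup>+x. ennreal (w x) * (ennreal (d2 x) * indicator A x) \<partial>circle_measure)
     + (\<integral>\<^sup>+x. ennreal (d2 x) * indicator A x \<partial>circle_measure)
    = (\<integral>\<^sup>+x. ennreal (w x) * (ennreal (d2 x) * indicator A x) + ennreal (d2 x) * indicator A x \<partial>circle_measure)"
    by (simp add: nn_integral_add)
  also have "(\<integral>\<^sup>+x. ennreal (w x) * (ennreal (d2 x) * indicator A x) + ennreal (d2 x) * indicator A x \<partial>circle_measure)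
    = (\<integral>\<^sup>+x. indicator A x \<partial>circle_measure)"
  proof (intro nn_integral_cong_AE)
    show "AE x in circle_measure. ennreal (w x) * (ennreal (d2 x) * indicator A x) + ennreal (d2 x) * indicator A x = indicator A x"
      using AE_not_S
    proof eventually_elim
      case (elim x)
      have "w x * d2 x + d2 x = 1" using elim w_nonneg[of x] by (simp add: d2_def field_simps)
      then have "ennreal (w x) * ennreal (d2 x) + ennreal (d2 x) = 1"
        using w_nonneg[of x] d_nonneg[of x] by (simp flip: ennreal_mult ennreal_plus)
      then show ?case by (auto simp: indicator_def)
    qed
  qed
  finally show "emeasure (density \<sigma> (\<lambda>x. ennreal (d2 x))) A = emeasure circle_measure A" by simp
qed simp

lemma circle_finite_measure_\<sigma>: "circle_finite_measure \<sigma>"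
proof (intro circle_finite_measure.intro finite_measureI circle_finite_measure_axioms.intro)
  have sp: "space \<sigma> = UNIV" using sets_eq_imp_space_eq[OF sets_\<sigma>] by simp
  have e: "emeasure \<sigma> A = emeasure \<mu> A + emeasure circle_measure A" if "A \<in> sets borel" for A
    unfolding \<sigma>_def using that by (intro emeasure_sum_measure) auto
  show "emeasure \<sigma> (space \<sigma>) \<noteq> \<infinity>"
    unfolding sp by (subst e) (auto simp: emeasure_eq_measure cm.emeasure_eq_measure)
  have "{\<xi>. cmod \<xi> \<noteq> 1} \<in> sets borel" by measurable
  moreover have "emeasure \<mu> {\<xi>. cmod \<xi> \<noteq> 1} = 0" "emeasure circle_measure {\<xi>. cmod \<xi> \<noteq> 1} = 0"
    using on_circle cm.on_circle by (auto simp: AE_iff_measurable[OF _ refl])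
  ultimately have "emeasure \<sigma> {\<xi>. cmod \<xi> \<noteq> 1} = 0" by (simp add: e)
  then show "AE \<xi> in \<sigma>. cmod \<xi> = 1" by (intro AE_I[of _ _ "{\<xi>. cmod \<xi> \<noteq> 1}"]) (auto simp: sp)
qed simp

sublocale sg: circle_finite_measure \<sigma>
  by (rule circle_finite_measure_\<sigma>)

lemma AE_\<mu>: "AE x in \<sigma>. Q x \<Longrightarrow> AE x in \<mu>. Q x"
  by (subst density_d1[symmetric], subst AE_density) (auto elim: eventually_mono)

lemma AE_circle: "AE x in \<sigma>. Q x \<Longrightarrow> AE x in circle_measure. Q x"
  by (subst density_d2[symmetric], subst AE_density) (auto elim: eventually_mono)

lemma integrable_d1:
  fixes h :: "complex \<Rightarrow> complex"
  assumes "integrable \<mu> h" shows "integrable \<sigma> (\<lambda>x. of_real (d1 x) * h x)"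
proof -
  have [measurable]: "h \<in> borel_measurable borel" using borel_measurable_integrable[OF assms] by simp
  show ?thesis using assms d_nonneg
    by (subst (asm) density_d1[symmetric], subst (asm) integrable_density) (auto simp: scaleR_conv_of_real)
qed

lemma integrable_d2:
  fixes h :: "complex \<Rightarrow> complex"
  assumes "integrable circle_measure h" shows "integrable \<sigma> (\<lambda>x. of_real (d2 x) * h x)"
proof -
  have [measurable]: "h \<in> borel_measurable borel" using borel_measurable_integrable[OF assms] by simp
  show ?thesis using assms d_nonneg
    by (subst (asm) density_d2[symmetric], subst (asm) integrable_density) (auto simp: scaleR_conv_of_real)
qed

lemma P_int_d1:
  assumes [measurable]: "h \<in> borel_measurable borel" shows "P_int h z = sg.P_int (\<lambda>x. of_real (d1 x) * h x) z"
  unfolding P_int_def sg.P_int_def using d_nonneg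
  by (subst density_d1[symmetric], subst integral_density) (auto simp: scaleR_conv_of_real mult_ac)

lemma P_int_d2:
  assumes [measurable]: "h \<in> borel_measurable borel" shows "cm.P_int h z = sg.P_int (\<lambda>x. of_real (d2 x) * h x) z"
  unfolding cm.P_int_def sg.P_int_def using d_nonneg
  by (subst density_d2[symmetric], subst integral_density) (auto simp: scaleR_conv_of_real mult_ac)

text \<open>The constant 1 is the Poisson integral of \<open>circle_measure\<close>, which \<sigma>
  dominates.\<close>

sublocale sg: circle_measure_pos \<sigma> 1
proof
  fix z :: complex assume z: "cmod z < 1"
  have "1 = cm.P_one z" by (simp add: P_one_circle_measure[OF z])
  also have "\<dots> = (\<integral>\<xi>. d2 \<xi> * poisson z \<xi> \<partial>\<sigma>)"
    unfolding cm.P_one_def using d_nonneg by (subst density_d2[symmetric], subst integral_density) auto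
  also have "\<dots> \<le> sg.P_one z"
    unfolding sg.P_one_def
  proof (intro integral_mono sg.integrable_poisson z)
    show "integrable \<sigma> (\<lambda>\<xi>. d2 \<xi> * poisson z \<xi>)"
      using d_nonneg d2_le by (intro sg.integrable_poisson_mult_real z sg.integrable_const_bound[where B=1]) auto
    show "d2 \<xi> * poisson z \<xi> \<le> poisson z \<xi>" for \<xi>
      using d2_le[of \<xi>] d_nonneg[of \<xi>] poisson_nonneg[OF z, of \<xi>] by (simp add: mult_left_le_one_le)
  qed
  finally show "1 \<le> sg.P_one z" .
qed simp

definition dens :: "(complex \<Rightarrow> complex) \<Rightarrow> (complex \<Rightarrow> real) \<Rightarrow> complex \<Rightarrow> complex" where
  "dens h d x = of_real (d x) * h x"

lemma P_one_ratio:
  assumes z: "cmod z < 1"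
  shows "sg.ratio (dens (\<lambda>_. 1) d1) z = of_real (P_one z) / of_real (sg.P_one z)"
    and "sg.ratio (dens (\<lambda>_. 1) d2) z = 1 / of_real (sg.P_one z)"
proof -
  have "of_real (P_one z) = P_int (\<lambda>_. 1) z" "1 = cm.P_int (\<lambda>_. 1) z"
    using P_one_circle_measure[OF z] unfolding P_one_def P_int_def cm.P_int_def cm.P_one_def by simp_all
  then show "sg.ratio (dens (\<lambda>_. 1) d1) z = of_real (P_one z) / of_real (sg.P_one z)"
    and "sg.ratio (dens (\<lambda>_. 1) d2) z = 1 / of_real (sg.P_one z)"
    unfolding sg.ratio_def dens_def[abs_def] by (simp_all add: P_int_d1 P_int_d2)
qed

lemma ratio_limits:
  "integrable \<mu> h \<Longrightarrow> AE \<zeta> in \<sigma>. nt_lim (sg.ratio (dens h d1)) \<zeta> (of_real (d1 \<zeta>) * h \<zeta>)"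
  "integrable circle_measure h \<Longrightarrow> AE \<zeta> in \<sigma>. nt_lim (sg.ratio (dens h d2)) \<zeta> (of_real (d2 \<zeta>) * h \<zeta>)"
  using sg.poisson_ratio_nt_lim[OF integrable_d1[of h]] sg.poisson_ratio_nt_lim[OF integrable_d2[of h]]
  unfolding dens_def[abs_def] by auto

text \<open>Both quotients are quotients of \<sigma>-ratios, in which the Poisson integral of
  \<sigma> cancels. At points of \<open>S\<close> the densities are 1 and 0, so the denominator
  limit is 1 and anything Lebesgue-integrable has limit 0.\<close>

lemma singular_quotient_nt_lim:
  assumes h: "integrable \<mu> h" and k: "integrable circle_measure k"
  shows "AE \<zeta> in \<mu>. \<zeta> \<in> S \<longrightarrow> nt_lim (\<lambda>z. P_int h z / of_real (P_one z)) \<zeta> (h \<zeta>)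
     \<and> nt_lim (\<lambda>z. cm.P_int k z / of_real (P_one z)) \<zeta> 0"
proof (rule AE_\<mu>)
  have [measurable]: "h \<in> borel_measurable borel" "k \<in> borel_measurable borel"
    using borel_measurable_integrable[OF h] borel_measurable_integrable[OF k] by auto
  have one: "integrable \<mu> (\<lambda>_. 1::complex)" by simp
  have e1: "sg.ratio (dens h d1) z / sg.ratio (dens (\<lambda>_. 1) d1) z = P_int h z / of_real (P_one z)"
    and e2: "sg.ratio (dens k d2) z / sg.ratio (dens (\<lambda>_. 1) d1) z = cm.P_int k z / of_real (P_one z)" if z: "cmod z < 1" for z
    unfolding P_one_ratio[OF z] unfolding sg.ratio_def dens_def[abs_def] using sg.P_one_pos[OF z]
    by (simp_all add: P_int_d1[of h] P_int_d2[of k])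
  show "AE \<zeta> in \<sigma>. \<zeta> \<in> S \<longrightarrow> nt_lim (\<lambda>z. P_int h z / of_real (P_one z)) \<zeta> (h \<zeta>)
     \<and> nt_lim (\<lambda>z. cm.P_int k z / of_real (P_one z)) \<zeta> 0"
    using ratio_limits(1)[OF h] ratio_limits(1)[OF one] ratio_limits(2)[OF k]
  proof eventually_elim
    case (elim \<zeta>)
    show ?case
    proof (intro impI)
      assume "\<zeta> \<in> S"
      then have d: "d1 \<zeta> = 1" "d2 \<zeta> = 0" by (auto simp: d1_def d2_def)
      have "nt_lim (\<lambda>z. sg.ratio (dens h d1) z / sg.ratio (dens (\<lambda>_. 1) d1) z) \<zeta> (h \<zeta> / 1)"
        "nt_lim (\<lambda>z. sg.ratio (dens k d2) z / sg.ratio (dens (\<lambda>_. 1) d1) z) \<zeta> (0 / 1)"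
        using elim unfolding d by (intro nt_lim_divide; simp)+
      then show "nt_lim (\<lambda>z. P_int h z / of_real (P_one z)) \<zeta> (h \<zeta>) \<and> nt_lim (\<lambda>z. cm.P_int k z / of_real (P_one z)) \<zeta> 0"
        using nt_lim_cong[OF e1] nt_lim_cong[OF e2] by simp
    qed
  qed
qed

text \<open>Here the \<sigma>-ratio of \<open>h\<close> is divided by that of
  \<open>circle_measure\<close>, whose own Poisson integral is 1. The limit acquires the factor
  \<open>d1\<close> / \<open>d2\<close>, equal to \<open>w\<close> off \<open>S\<close>.\<close>

lemma absolutely_continuous_nt_lim:
  assumes h: "integrable \<mu> h"
  shows "AE \<zeta> in circle_measure. nt_lim (P_int h) \<zeta> (of_real (w \<zeta>) * h \<zeta>)"
proof -
  have [measurable]: "h \<in> borel_measurable borel"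
    using borel_measurable_integrable[OF h] by auto
  have one: "integrable circle_measure (\<lambda>_. 1::complex)" by simp
  have e: "sg.ratio (dens h d1) z / sg.ratio (dens (\<lambda>_. 1) d2) z = P_int h z" if z: "cmod z < 1" for z
    unfolding P_one_ratio[OF z] unfolding sg.ratio_def dens_def[abs_def] using sg.P_one_pos[OF z]
    by (simp add: P_int_d1[of h])
  show ?thesis
    using AE_circle[OF ratio_limits(1)[OF h]] AE_circle[OF ratio_limits(2)[OF one]] AE_not_S
  proof eventually_elim
    case (elim \<zeta>)
    have w: "1 + w \<zeta> > 0" using w_nonneg[of \<zeta>] by simp
    have d: "d2 \<zeta> \<noteq> 0" "d1 \<zeta> / d2 \<zeta> = w \<zeta>" using elim(3) w by (auto simp: d1_def d2_def)
    have "nt_lim (\<lambda>z. sg.ratio (dens h d1) z / sg.ratio (dens (\<lambda>_. 1) d2) z) \<zeta> (of_real (d1 \<zeta>) * h \<zeta> / of_real (d2 \<zeta>))"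
      using elim(1,2) d(1) by (intro nt_lim_divide) simp_all
    also have "of_real (d1 \<zeta>) * h \<zeta> / of_real (d2 \<zeta>) = of_real (d1 \<zeta> / d2 \<zeta>) * h \<zeta>" by simp
    finally show ?case unfolding d(2) using nt_lim_cong[OF e] by simp
  qed
qed

text \<open>Uniqueness of Poisson integrals through boundary values: equal Poisson integrals have
  equal \<sigma>-ratios, so the densities \<open>d1\<close> and \<open>d2\<close> agree
  \<sigma>-almost everywhere.\<close>

lemma eq_circle_measure_if_P_one:
  assumes P: "\<And>z. cmod z < 1 \<Longrightarrow> P_one z = 1"
  shows "\<mu> = circle_measure"
proof -
  have e: "sg.ratio (dens (\<lambda>_. 1) d1) z = sg.ratio (dens (\<lambda>_. 1) d2) z" if z: "cmod z < 1" for z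
    unfolding P_one_ratio[OF z] P[OF z] by simp
  have one: "integrable \<mu> (\<lambda>_. 1::complex)" "integrable circle_measure (\<lambda>_. 1::complex)" by simp_all
  have "AE \<zeta> in \<sigma>. ennreal (d1 \<zeta>) = ennreal (d2 \<zeta>)"
    using ratio_limits(1)[OF one(1)] ratio_limits(2)[OF one(2)] sg.on_circle
  proof eventually_elim
    case (elim \<zeta>)
    have "nt_lim (sg.ratio (dens (\<lambda>_. 1) d1)) \<zeta> (of_real (d2 \<zeta>) * 1)"
      using elim(2) nt_lim_cong[of "sg.ratio (dens (\<lambda>_. 1) d1)" "sg.ratio (dens (\<lambda>_. 1) d2)", OF e] by blast
    from nt_lim_unique[OF elim(1) this elim(3)]
    have "complex_of_real (d1 \<zeta>) * 1 = of_real (d2 \<zeta>) * 1" .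
    then show ?case by simp
  qed
  then have "density \<sigma> (\<lambda>x. ennreal (d1 x)) = density \<sigma> (\<lambda>x. ennreal (d2 x))"
    by (intro density_cong) auto
  then show ?thesis unfolding density_d1 density_d2 .
qed

end

section \<open>Boundary limits of the Clark representation\<close>

context clark_data
begin

text \<open>Since \<open>Re (1 + F z)\<close> exceeds 1, the logarithm of 1 + F is holomorphic with
  nonnegative real part ln |1 + F|. Its mean over every dilated circle is \<open>Ln 2\<close>,
  because F 0 = 1, and Fatou's lemma makes the lower limit finite almost everywhere.\<close>

lemma F_not_infinite:
  "AE \<zeta> in circle_measure. \<not> filterlim (\<lambda>n. cmod (1 + F (of_real (rad n) * \<zeta>))) at_top sequentially"
proof -
  have Re1: "Re (1 + F z) > 1" if "cmod z < 1" for z using Re_F[OF that] P_one_pos'[OF that] by simp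
  have hol: "(\<lambda>z. Ln (1 + F z)) holomorphic_on ball 0 1"
    using Re1 by (intro holomorphic_intros F_holomorphic) (force simp: complex_nonpos_Reals_iff)
  define L where "L z = (if cmod z < 1 then Ln (1 + F z) else 0)" for z
  have [measurable]: "L \<in> borel_measurable borel"
    unfolding L_def by (intro borel_measurable_cutoff holomorphic_on_imp_continuous_on hol)
  define q where "q n \<zeta> = L (of_real (rad n) * \<zeta>)" for n \<zeta>
  have [measurable]: "q n \<in> borel_measurable borel" for n unfolding q_def by measurable
  have R: "1 / rad n > 1" for n using rad[of n] by simp
  have in_disc: "cmod (of_real (rad n) * z) < 1" if "cmod z < 1 / rad n" for n z
    using that rad[of n] by (simp add: norm_mult field_simps)
  have q_hol: "q n holomorphic_on ball 0 (1 / rad n)" for n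
  proof -
    have "(\<lambda>z. Ln (1 + F (of_real (rad n) * z))) holomorphic_on ball 0 (1 / rad n)"
      using in_disc[of _ n] by (intro holomorphic_on_compose_gen[OF _ hol, unfolded o_def] holomorphic_intros) auto
    moreover have "Ln (1 + F (of_real (rad n) * z)) = q n z" if "z \<in> ball 0 (1 / rad n)" for z
      using in_disc[of z n] that by (simp add: q_def L_def)
    ultimately show ?thesis by (rule holomorphic_transform)
  qed
  have F0: "F 0 = 1" unfolding R2_def using total by simp
  have mean: "(\<integral>\<zeta>. q n \<zeta> \<partial>circle_measure) = Ln 2" for n
    using mean_value_circle_measure[OF q_hol R, of n] by (simp add: q_def L_def F0)
  have int: "integrable circle_measure (q n)" for n
  proof -
    have "compact (q n ` sphere 0 1)"
      using q_hol[of n] R[of n]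
      by (intro compact_continuous_image holomorphic_on_imp_continuous_on) (auto elim!: holomorphic_on_subset)
    then obtain C where "\<And>x. x \<in> q n ` sphere 0 1 \<Longrightarrow> cmod x \<le> C" using compact_imp_bounded bounded_iff by metis
    then show ?thesis by (intro integrable_circle_bounded[where B=C]) auto
  qed
  have Req: "Re (q n \<zeta>) = ln (cmod (1 + F (of_real (rad n) * \<zeta>)))" "Re (q n \<zeta>) \<ge> 0" if "cmod \<zeta> = 1" for n \<zeta>
  proof -
    have z: "cmod (of_real (rad n) * \<zeta>) < 1" using that rad[of n] by (simp add: norm_mult)
    then have c: "cmod (1 + F (of_real (rad n) * \<zeta>)) \<ge> 1"
      using Re1[OF z] complex_Re_le_cmod[of "1 + F (of_real (rad n) * \<zeta>)"] by linarith
    then have "1 + F (of_real (rad n) * \<zeta>) \<noteq> 0" by auto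
    then show "Re (q n \<zeta>) = ln (cmod (1 + F (of_real (rad n) * \<zeta>)))" using z by (simp add: q_def L_def)
    then show "Re (q n \<zeta>) \<ge> 0" using c by simp
  qed
  have nn: "(\<integral>\<^sup>+\<zeta>. ennreal (Re (q n \<zeta>)) \<partial>circle_measure) = ennreal (Re (Ln 2))" for n
  proof -
    have "(\<integral>\<^sup>+\<zeta>. ennreal (Re (q n \<zeta>)) \<partial>circle_measure) = ennreal (\<integral>\<zeta>. Re (q n \<zeta>) \<partial>circle_measure)"
      using int[of n] AE_circle_measure_norm Req(2)
      by (intro nn_integral_eq_integral integrable_Re) (auto elim!: eventually_mono)
    then show ?thesis using mean[of n] int[of n] by simp
  qed
  have "(\<integral>\<^sup>+\<zeta>. liminf (\<lambda>n. ennreal (Re (q n \<zeta>))) \<partial>circle_measure) \<le> liminf (\<lambda>n. \<integral>\<^sup>+\<zeta>. ennreal (Re (q n \<zeta>)) \<partial>circle_measure)"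
    by (intro nn_integral_liminf) auto
  also have "\<dots> = ennreal (Re (Ln 2))" unfolding nn by (simp add: Liminf_const)
  finally have "(\<integral>\<^sup>+\<zeta>. liminf (\<lambda>n. ennreal (Re (q n \<zeta>))) \<partial>circle_measure) \<noteq> \<infinity>"
    using ennreal_less_top by (metis infinity_ennreal_def leD)
  then have "AE \<zeta> in circle_measure. liminf (\<lambda>n. ennreal (Re (q n \<zeta>))) \<noteq> \<infinity>"
    by (intro nn_integral_noteq_infinite) auto
  then show ?thesis
    using AE_circle_measure_norm
  proof eventually_elim
    case (elim \<zeta>)
    show ?case
    proof
      assume "filterlim (\<lambda>n. cmod (1 + F (of_real (rad n) * \<zeta>))) at_top sequentially"
      then have "filterlim (\<lambda>n. ln (cmod (1 + F (of_real (rad n) * \<zeta>)))) at_top sequentially"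
        by (rule filterlim_compose[OF ln_at_top])
      then have "filterlim (\<lambda>n. Re (q n \<zeta>)) at_top sequentially" by (simp add: Req(1)[OF elim(2)])
      then have "(\<lambda>n. ennreal (Re (q n \<zeta>))) \<longlonglongrightarrow> top" by (simp add: ennreal_tendsto_top_eq_at_top)
      then have "liminf (\<lambda>n. ennreal (Re (q n \<zeta>))) = top" by (intro lim_imp_Liminf) auto
      then show False using elim(1) by simp
    qed
  qed
qed

lemma theta0_eq: "cmod z < 1 \<Longrightarrow> theta \<mu> 0 z = (F z - 1) / (F z + 1)" and one_plus_F_ne0: "cmod z < 1 \<Longrightarrow> F z + 1 \<noteq> 0"
proof -
  assume z: "cmod z < 1"
  show "theta \<mu> 0 z = (F z - 1) / (F z + 1)" by (simp add: theta_def)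
  have "Re (F z + 1) > 0" using Re_F[OF z] P_one_pos'[OF z] by simp
  then show "F z + 1 \<noteq> 0" by (metis less_irrefl zero_complex.simps(1))
qed

lemma one_minus_theta0: "cmod z < 1 \<Longrightarrow> 1 - theta \<mu> 0 z = 2 / (F z + 1)"
  using one_plus_F_ne0[of z] by (simp add: theta0_eq divide_simps)

text \<open>A boundary value 1 would force |1 + F| = 2 / |1 - \<theta>_0| to infinity along the
  radius, which \<open>F_not_infinite\<close> excludes almost everywhere.\<close>

lemma theta0_radial:
  "AE \<zeta> in circle_measure. (\<lambda>n. theta \<mu> 0 (of_real (rad n) * \<zeta>)) \<longlonglongrightarrow> bdry (theta \<mu> 0) \<zeta> \<and> bdry (theta \<mu> 0) \<zeta> \<noteq> 1"
proof -
  interpret zero: clark_data \<mu> 0 by unfold_locales (use total in auto)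
  show ?thesis using zero.B_radial F_not_infinite AE_circle_measure_norm
  proof eventually_elim
    case (elim \<zeta>)
    have z: "cmod (of_real (rad n) * \<zeta>) < 1" for n using elim(3) rad[of n] by (simp add: norm_mult)
    have "bdry (theta \<mu> 0) \<zeta> \<noteq> 1"
    proof
      assume "bdry (theta \<mu> 0) \<zeta> = 1"
      then have "(\<lambda>n. cmod (1 - theta \<mu> 0 (of_real (rad n) * \<zeta>))) \<longlonglongrightarrow> cmod (1 - 1)"
        using elim(1) by (intro tendsto_intros) simp
      moreover have "cmod (1 - theta \<mu> 0 (of_real (rad n) * \<zeta>)) > 0" for n
        using one_plus_F_ne0[OF z] by (simp add: one_minus_theta0[OF z])
      ultimately have "filterlim (\<lambda>n. inverse (cmod (1 - theta \<mu> 0 (of_real (rad n) * \<zeta>)))) at_top sequentially"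
        by (intro filterlim_inverse_at_top) auto
      then have "filterlim (\<lambda>n. 2 * inverse (cmod (1 - theta \<mu> 0 (of_real (rad n) * \<zeta>)))) at_top sequentially"
        by (intro filterlim_tendsto_pos_mult_at_top[OF tendsto_const]) auto
      also have "(\<lambda>n. 2 * inverse (cmod (1 - theta \<mu> 0 (of_real (rad n) * \<zeta>)))) = (\<lambda>n. cmod (1 + F (of_real (rad n) * \<zeta>)))"
        using one_plus_F_ne0[OF z] by (simp add: one_minus_theta0[OF z] norm_divide inverse_eq_divide add.commute)
      finally show False using elim(2) by simp
    qed
    then show ?case using elim(1) by simp
  qed
qed

text \<open>Expresses 1 / N through \<theta>_0, which gives the coefficients of (2). The right side
  has boundary limits wherever the radial limit of \<theta>_0 exists and differs from 1.\<close>

lemma inverse_N_eq: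
  assumes z: "cmod z < 1"
  shows "1 / N z = (1 - cnj \<gamma> * theta \<mu> 0 z) / (of_real s * (1 - theta \<mu> 0 z))"
proof -
  have ss: "complex_of_real s \<noteq> 0" using s_pos by simp
  have F1: "F z + 1 \<noteq> 0" by (rule one_plus_F_ne0[OF z])
  have "1 - cnj \<gamma> * theta \<mu> 0 z = den z / (F z + 1)"
    using F1 unfolding theta0_eq[OF z] den_def by (simp add: divide_simps) (simp add: algebra_simps)
  then show ?thesis using F1 ss den_ne0[OF z] unfolding one_minus_theta0[OF z] N_def by (simp add: divide_simps)
qed

end

context clark_image
begin

lemma singular_part:
  assumes th: "\<exists>z. cmod z < 1 \<and> \<theta> z \<noteq> 0" and \<zeta>: "nt_lim (\<lambda>z. P_int f z / of_real (P_one z)) \<zeta> (f \<zeta>)"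
    "nt_lim (\<lambda>z. cm.P_int (\<lambda>\<xi>. of_real (G \<xi>)) z / of_real (P_one z)) \<zeta> 0"
  shows "nt_lim (\<lambda>z. (1 - cnj \<gamma>) / of_real s * H2_ext g1 z) \<zeta> (f \<zeta>)"
  unfolding nt_lim_def
proof (intro allI impI)
  fix \<alpha> :: real assume \<alpha>: "\<alpha> > 1"
  let ?h = "\<lambda>z. (1 - cnj \<gamma>) / of_real s * H2_ext g1 z" and ?q = "\<lambda>z. P_int f z / of_real (P_one z)"
    and ?e = "\<lambda>z. cm.P_int (\<lambda>\<xi>. of_real (G \<xi>)) z / of_real (P_one z)"
  have q: "(?q \<longlongrightarrow> f \<zeta>) (at \<zeta> within stolz \<zeta> \<alpha>)" and e: "(?e \<longlongrightarrow> 0) (at \<zeta> within stolz \<zeta> \<alpha>)"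
    using \<zeta> \<alpha> by (auto simp: nt_lim_def)
  have "((\<lambda>z. ?h z - ?q z) \<longlongrightarrow> 0) (at \<zeta> within stolz \<zeta> \<alpha>)"
  proof (rule Lim_null_comparison)
    show "\<forall>\<^sub>F z in at \<zeta> within stolz \<zeta> \<alpha>. norm (?h z - ?q z) \<le> sqrt (cmod (?e z))"
      using eventually_disc
    proof eventually_elim
      case (elim z)
      have "cm.P_int (\<lambda>\<xi>. of_real (G \<xi>)) z = of_real (\<integral>\<zeta>. G \<zeta> * poisson z \<zeta> \<partial>circle_measure)"
        unfolding cm.P_int_def by (simp flip: of_real_mult)
      then have "?e z = of_real ((\<integral>\<zeta>. G \<zeta> * poisson z \<zeta> \<partial>circle_measure) / P_one z)" by simp
      then have "(\<integral>\<zeta>. G \<zeta> * poisson z \<zeta> \<partial>circle_measure) / P_one z \<le> cmod (?e z)"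
        by (simp only: norm_of_real abs_ge_self)
      then show ?case using clark_quotient_bound[OF elim th] by (intro real_le_rsqrt) simp
    qed
    have "((\<lambda>z. sqrt (cmod (?e z))) \<longlongrightarrow> sqrt (cmod 0)) (at \<zeta> within stolz \<zeta> \<alpha>)"
      by (intro tendsto_intros e)
    then show "((\<lambda>z. sqrt (cmod (?e z))) \<longlongrightarrow> 0) (at \<zeta> within stolz \<zeta> \<alpha>)" by simp
  qed
  from tendsto_add[OF this q] show "(?h \<longlongrightarrow> f \<zeta>) (at \<zeta> within stolz \<zeta> \<alpha>)" by simp
qed

text \<open>Radial limits of \<open>P_int_f\<close> suffice: the hypothesis fixes the left limit,
  and each factor on the right converges along \<open>rad\<close>.\<close>

lemma absolutely_continuous_part:
  assumes th: "\<exists>z. cmod z < 1 \<and> \<theta> z \<noteq> 0"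
    and f: "AE \<zeta> in circle_measure. nt_lim (P_int f) \<zeta> (r \<zeta>)"
  shows "AE \<zeta> in circle_measure. of_real s * r \<zeta> =
      (1 - cnj \<gamma> * bdry (theta \<mu> 0) \<zeta>) / (1 - bdry (theta \<mu> 0) \<zeta>) * g1 \<zeta>
    + (1 - \<gamma> * cnj (bdry (theta \<mu> 0) \<zeta>)) / (1 - cnj (bdry (theta \<mu> 0) \<zeta>)) * gm \<zeta>"
  using f cm.poisson_ratio_nt_lim[OF g1_int] cm.poisson_ratio_nt_lim[OF gm_int] theta0_radial AE_circle_measure_norm
proof eventually_elim
  case (elim \<zeta>)
  define t where "t = bdry (theta \<mu> 0) \<zeta>"
  define z where "z n = of_real (rad n) * \<zeta>" for n
  have z: "cmod (z n) < 1" for n using elim(5) rad[of n] by (simp add: z_def norm_mult)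
  have ss: "complex_of_real s \<noteq> 0" using s_pos by simp
  have t: "1 - t \<noteq> 0" "(\<lambda>n. theta \<mu> 0 (z n)) \<longlonglongrightarrow> t" using elim(4) by (auto simp: t_def z_def)
  have lN: "(\<lambda>n. 1 / N (z n)) \<longlonglongrightarrow> (1 - cnj \<gamma> * t) / (of_real s * (1 - t))"
    unfolding inverse_N_eq[OF z] using t ss by (intro tendsto_intros) auto
  have l1: "(\<lambda>n. cm.P_int g1 (z n)) \<longlonglongrightarrow> g1 \<zeta>" and l2: "(\<lambda>n. cm.P_int gm (z n)) \<longlonglongrightarrow> gm \<zeta>"
    using nt_lim_radial[OF elim(2,5)] nt_lim_radial[OF elim(3,5)]
    unfolding z_def[symmetric] ratio_circle_measure[OF z] .
  have "(\<lambda>n. cm.P_int g1 (z n) * (1 / N (z n)) + cm.P_int gm (z n) * cnj (1 / N (z n)))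
     \<longlonglongrightarrow> g1 \<zeta> * ((1 - cnj \<gamma> * t) / (of_real s * (1 - t))) + gm \<zeta> * cnj ((1 - cnj \<gamma> * t) / (of_real s * (1 - t)))"
    by (intro tendsto_intros l1 l2 lN)
  also have "(\<lambda>n. cm.P_int g1 (z n) * (1 / N (z n)) + cm.P_int gm (z n) * cnj (1 / N (z n))) = (\<lambda>n. P_int f (z n))"
    by (simp add: P_int_f[OF z th] P_int_g1[OF z])
  finally have "r \<zeta> = g1 \<zeta> * ((1 - cnj \<gamma> * t) / (of_real s * (1 - t))) + gm \<zeta> * cnj ((1 - cnj \<gamma> * t) / (of_real s * (1 - t)))"
    using nt_lim_radial[OF elim(1,5)] LIMSEQ_unique unfolding z_def by blast
  moreover have "1 - cnj t \<noteq> 0" using t(1) by (metis complex_cnj_cancel_iff complex_cnj_diff complex_cnj_one right_minus_eq)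
  ultimately show ?case unfolding t_def[symmetric] using t(1) ss by (simp add: divide_simps) (simp add: algebra_simps)
qed

end

theorem theorem4p4:
  fixes \<mu> :: "complex measure" and \<gamma> :: complex and w :: "complex \<Rightarrow> real"
    and S :: "complex set" and f :: cfun and \<Phi> :: "cfun \<times> cfun \<Rightarrow> cfun"
    and g1 g2 :: cfun
  assumes prob: "prob_space \<mu>" and sets_mu: "sets \<mu> = sets borel"
    and supp: "emeasure \<mu> (- sphere 0 1) = 0"
    and not_leb: "\<mu> \<noteq> circle_measure"
    and gamma: "cmod \<gamma> < 1"
    and w_meas: "w \<in> borel_measurable borel" and w_nonneg: "\<And>z. w z \<ge> 0"
    and S_borel: "S \<in> sets borel" and S_T: "S \<subseteq> sphere 0 1"
    and S_null: "emeasure circle_measure S = 0"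
    and decomp: "\<And>A. A \<in> sets borel \<Longrightarrow>
        emeasure \<mu> A = emeasure \<mu> (A \<inter> S) + (\<integral>\<^sup>+ z. ennreal (w z) * indicator A z \<partial>circle_measure)"
    and f_L2: "f \<in> L2 \<mu>"
    and Phi: "clark_op \<mu> \<gamma> \<Phi>"
    and g: "is_adjoint_image \<mu> \<gamma> \<Phi> f (g1, g2)"
  shows "(AE \<zeta> in \<mu>. \<zeta> \<in> S \<longrightarrow>
            nt_lim (\<lambda>z. (1 - cnj \<gamma>) / complex_of_real (sqrt (1 - (cmod \<gamma>)^2)) * H2_ext g1 z) \<zeta> (f \<zeta>))
       \<and> (AE \<zeta> in circle_measure.
            complex_of_real (sqrt (1 - (cmod \<gamma>)^2) * w \<zeta>) * f \<zeta> =
              (1 - cnj \<gamma> * bdry (theta \<mu> 0) \<zeta>) / (1 - bdry (theta \<mu> 0) \<zeta>) * g1 \<zeta>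
            + (1 - \<gamma> * cnj (bdry (theta \<mu> 0) \<zeta>)) / (1 - cnj (bdry (theta \<mu> 0) \<zeta>))
               * (cnj (bdry (theta \<mu> \<gamma>) \<zeta>) * g1 \<zeta> + Delta (theta \<mu> \<gamma>) \<zeta> * g2 \<zeta>))"
proof -
  interpret prob_space \<mu> by (rule prob)
  have sp: "space \<mu> = UNIV" using sets_eq_imp_space_eq[OF sets_mu] by simp
  have total1: "measure \<mu> UNIV = 1" using prob_space sp by simp
  have "AE \<xi> in \<mu>. cmod \<xi> = 1"
    using supp sets_mu by (intro AE_I[of _ _ "- sphere 0 1"]) auto
  then interpret circle_finite_measure \<mu> by unfold_locales (use sets_mu in auto)
  interpret clark_image \<mu> \<gamma> \<Phi> f g1 g2
    by unfold_locales (fact total1 gamma Phi f_L2 g)+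
  interpret lebesgue_split \<mu> w S
    by unfold_locales (fact total1 w_meas w_nonneg S_borel S_null decomp)+
  \<comment> \<open>If \<theta> vanished identically, \<theta> 0 = - \<gamma> would give \<gamma> =
    0, then \<open>num\<close> = 0 would give F = 1, and \<mu> would have the Poisson integral of
    Lebesgue measure.\<close>
  have th: "\<exists>z. cmod z < 1 \<and> \<theta> z \<noteq> 0"
  proof (rule ccontr)
    assume "\<not> ?thesis"
    then have t0: "\<theta> z = 0" if "cmod z < 1" for z using that by auto
    then have \<gamma>0: "\<gamma> = 0" using theta_0 t0[of 0] by simp
    have "P_one z = 1" if z: "cmod z < 1" for z
    proof -
      have "num z = 0" using t0[OF z] den_ne0[OF z] by (simp add: theta_eq)
      then have "(1 - \<gamma>) * F z - (1 + \<gamma>) = 0" unfolding num_def .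
      then have "F z = 1" by (simp add: \<gamma>0)
      then show ?thesis using Re_F[OF z] by simp
    qed
    then show False using eq_circle_measure_if_P_one not_leb by blast
  qed
  have "AE \<zeta> in \<mu>. \<zeta> \<in> S \<longrightarrow> nt_lim (\<lambda>z. (1 - cnj \<gamma>) / of_real s * H2_ext g1 z) \<zeta> (f \<zeta>)"
    using singular_quotient_nt_lim[OF f_int integrable_of_real[OF G_int]]
    by eventually_elim (use singular_part[OF th] in blast)
  moreover have "AE \<zeta> in circle_measure. of_real s * (of_real (w \<zeta>) * f \<zeta>) =
      (1 - cnj \<gamma> * bdry (theta \<mu> 0) \<zeta>) / (1 - bdry (theta \<mu> 0) \<zeta>) * g1 \<zeta>
    + (1 - \<gamma> * cnj (bdry (theta \<mu> 0) \<zeta>)) / (1 - cnj (bdry (theta \<mu> 0) \<zeta>)) * gm \<zeta>"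
    by (rule absolutely_continuous_part[OF th absolutely_continuous_nt_lim[OF f_int]])
  ultimately show ?thesis unfolding s_def gm_def by (simp only: of_real_mult mult.assoc)
qed

end
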